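(* Let $K:\mathbb{R}^2\to(-\infty,0]$ be a nonpositive, locally bounded function which is not identically zero. Assume that $\alpha_1(K)>0$ and that there exists $p>1$ such that $\alpha_p(K)>-\infty$. Then for every $\alpha\in(0,\alpha_1(K))$ the equation $$\Delta u+K(x)e^{2u}=0\quad\text{in }\mathbb{R}^2$$ possesses a unique solution $u_\alpha$ satisfying $u_\alpha(x)=\alpha\ln|x|+O(1)$ as $|x|\to\infty$. Moreover, $$\int_{\mathbb{R}^2}K e^{2u_\alpha}\,dx=-2\alpha\pi,$$ and there exists $c_\alpha\in\mathbb{R}$ such that for every $\beta\in(0,\alpha_1(K)-\alpha)$, $$u_\alpha(x)=\alpha\ln|x|+c_\alpha+o\left(|x|^{-\frac{2\beta}{1+2\beta}}\right)\quad\text{as }|x|\to\infty.$$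
   Context: For a measurable function $K$ on $\mathbb{R}^2$ and $p\ge 1$, define $$\alpha_p(K)=\sup\left\{\alpha\in\mathbb{R}:\ \int_{\mathbb{R}^2}|K(x)|^p(1+|x|)^{2\alpha p+2(p-1)}\,dx<+\infty\right\}\in[-\infty,+\infty],$$ with the convention $\sup\emptyset=-\infty$. In particular $\alpha_1(K)=\sup\{\alpha\in\mathbb{R}:\int_{\mathbb{R}^2}|K(x)|(1+|x|)^{2\alpha}dx<+\infty\}$. "Locally bounded" means measurable and bounded on compact sets. Solutions are continuous functions $u$ on $\mathbb{R}^2$ satisfying the equation in the sense of distributions; "not identically zero" is understood almost everywhere. *)

theory Defs
  imports "HOL-Analysis.Analysis" "HOL-Library.Landau_Symbols"
begin

definition partial_deriv :: "'n::finite \<Rightarrow> (real ^ 'n \<Rightarrow> real) \<Rightarrow> real ^ 'n \<Rightarrow> real" where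
  "partial_deriv i f x = deriv (\<lambda>t. f (x + t *\<^sub>R axis i 1)) 0"

definition laplacian :: "(real ^ 'n::finite \<Rightarrow> real) \<Rightarrow> real ^ 'n \<Rightarrow> real" where
  "laplacian f x = (\<Sum>i\<in>UNIV. partial_deriv i (partial_deriv i f) x)"

primrec C_k :: "nat \<Rightarrow> (real ^ 'n::finite \<Rightarrow> real) \<Rightarrow> bool" where
  "C_k 0 f \<longleftrightarrow> continuous_on UNIV f"
| "C_k (Suc k) f \<longleftrightarrow> f differentiable_on UNIV \<and> (\<forall>i. C_k k (partial_deriv i f))"

definition test_function :: "(real ^ 'n::finite \<Rightarrow> real) \<Rightarrow> bool" where
  "test_function \<phi> \<longleftrightarrow> (\<forall>k. C_k k \<phi>) \<and> compact (closure {x. \<phi> x \<noteq> 0})"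

definition locally_bounded :: "(real ^ 2 \<Rightarrow> real) \<Rightarrow> bool" where
  "locally_bounded K \<longleftrightarrow>
     K \<in> borel_measurable lebesgue \<and> (\<forall>C. compact C \<longrightarrow> bounded (K ` C))"

text \<open>In \<^typ>\<open>ereal\<close> the supremum of the empty set is \<open>-\<infinity>\<close>, as required.\<close>

definition alpha :: "real \<Rightarrow> (real ^ 2 \<Rightarrow> real) \<Rightarrow> ereal" where
  "alpha p K = (SUP a \<in> {a::real.
     (\<integral>\<^sup>+ x. ennreal (\<bar>K x\<bar> powr p * (1 + norm x) powr (2 * a * p + 2 * (p - 1))) \<partial>lebesgue)
       < \<infinity>}. ereal a)"

text \<open>
  The equation \<open>\<Delta>u + K e\<^sup>2\<^sup>u = 0\<close> in the sense of distributions. Both integrands are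
  integrable whenever \<open>K\<close> is locally bounded and \<open>u\<close> is continuous.
\<close>

definition is_solution :: "(real ^ 2 \<Rightarrow> real) \<Rightarrow> (real ^ 2 \<Rightarrow> real) \<Rightarrow> bool" where
  "is_solution K u \<longleftrightarrow> continuous_on UNIV u \<and>
     (\<forall>\<phi>. test_function \<phi> \<longrightarrow>
        (\<integral>x. u x * laplacian \<phi> x \<partial>lebesgue) + (\<integral>x. K x * exp (2 * u x) * \<phi> x \<partial>lebesgue) = 0)"

definition log_growth :: "real \<Rightarrow> (real ^ 2 \<Rightarrow> real) \<Rightarrow> bool" where
  "log_growth a u \<longleftrightarrow> (\<lambda>x. u x - a * ln (norm x)) \<in> O[at_infinity](\<lambda>_. 1)"

end

theory Submission imports Defs begin

text \<open>
  Write \<open>f = -K e\<^sup>2\<^sup>u\<close>. Since \<open>u\<close> minus the logarithmic potential of \<open>f\<close> is weakly harmonic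
  with sublinear growth, it is constant, so the solutions with logarithmic growth are exactly the
  functions \<open>u = c + (2\<pi>)\<^sup>-\<^sup>1 \<integral> ln |x - y| f(y) dy\<close> with \<open>f\<close> of mass \<open>2\<pi>\<alpha>\<close>, and the
  expansion at infinity is that of the potential. The densities \<open>f, f'\<close> of two
  solutions \<open>u, v\<close> have the same mass, so \<open>\<integral> (u - v)(f - f') dx\<close> is a multiple of the logarithmic
  energy of a neutral density and hence nonpositive, while \<open>(u - v)(e\<^sup>2\<^sup>u - e\<^sup>2\<^sup>v) \<ge> 0\<close>. Existence: with \<open>W = -K (1 + |x|)\<^sup>2\<^sup>\<alpha>\<close>
  and \<open>f = W \<rho>\<close>, the representation of \<open>u\<close> becomes \<open>ln \<rho> / 2 + G \<rho> = c\<close> with an integral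
  operator \<open>G\<close> over \<open>W dx\<close> that has a nonnegative kernel and is positive semidefinite on neutral
  densities; an explicit iteration for this equation contracts in \<open>L\<^sup>2\<close>.
\<close>

subsection \<open>Compactly supported functions on Euclidean space\<close>

text \<open>The hypothesis on \<open>alpha p K\<close> with p > 1 gives an L^p bound whose
  polynomial weight may decay arbitrarily fast. It makes the logarithmic singularity integrable at
  every point, but with a bound that may grow polynomially in the point. The asymptotics survive
  because far out the singular part can be traded for a large multiple of ln |x| on a region where a
  moment of the density makes it small. That moment has order g = min 1 (2 \<beta>), is what
  \<alpha> + \<beta> < \<open>alpha 1 K\<close> leaves over, and alone sets the rate: the potential
  has error O((1 + ln |x|) |x|^(-g)), and 2 \<beta> / (1 + 2 \<beta>) lies strictly below g. The
  equation ln \<rho> / 2 + G \<rho> = c is the Euler-Lagrange equation of half the integral of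
  \<rho> ln \<rho> - \<rho> + \<rho> G \<rho> under fixed mass, c being the multiplier. Positivity
  of G is available on neutral densities, that is, along this constraint, and the iteration is
  gradient descent inside it.\<close>

lemma lborel_integral_affine:
  fixes f :: "'a::euclidean_space \<Rightarrow> real"
  assumes [measurable]: "f \<in> borel_measurable borel" and c: "c \<noteq> 0"
  shows "(\<integral>x. f x \<partial>lborel) = \<bar>c\<bar> ^ DIM('a) * (\<integral>x. f (t + c *\<^sub>R x) \<partial>lborel)"
proof -
  have "(\<integral>x. f x \<partial>lborel) = (\<integral>x. f x \<partial>density (distr lborel borel (\<lambda>x. t + c *\<^sub>R x)) (\<lambda>_. ennreal (\<bar>c\<bar> ^ DIM('a))))"
    using lborel_affine[OF c, of t] by simp
  also have "\<dots> = (\<integral>x. \<bar>c\<bar> ^ DIM('a) * f x \<partial>distr lborel borel (\<lambda>x. t + c *\<^sub>R x))"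
    by (subst integral_density) auto
  also have "\<dots> = \<bar>c\<bar> ^ DIM('a) * (\<integral>x. f (t + c *\<^sub>R x) \<partial>lborel)"
    by (subst integral_distr) auto
  finally show ?thesis .
qed

lemma lborel_nn_integral_affine:
  fixes f :: "'a::euclidean_space \<Rightarrow> ennreal"
  assumes [measurable]: "f \<in> borel_measurable borel" and c: "c \<noteq> 0"
  shows "(\<integral>\<^sup>+x. f x \<partial>lborel) = ennreal (\<bar>c\<bar> ^ DIM('a)) * (\<integral>\<^sup>+x. f (t + c *\<^sub>R x) \<partial>lborel)"
proof -
  have "(\<integral>\<^sup>+x. f x \<partial>lborel) = (\<integral>\<^sup>+x. f x \<partial>density (distr lborel borel (\<lambda>x. t + c *\<^sub>R x)) (\<lambda>_. ennreal (\<bar>c\<bar> ^ DIM('a))))"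
    using lborel_affine[OF c, of t] by simp
  also have "\<dots> = (\<integral>\<^sup>+x. ennreal (\<bar>c\<bar> ^ DIM('a)) * f x \<partial>distr lborel borel (\<lambda>x. t + c *\<^sub>R x))"
    by (subst nn_integral_density) auto
  also have "\<dots> = ennreal (\<bar>c\<bar> ^ DIM('a)) * (\<integral>\<^sup>+x. f (t + c *\<^sub>R x) \<partial>lborel)"
    by (subst nn_integral_distr) (auto simp: nn_integral_cmult)
  finally show ?thesis .
qed

lemma lborel_integrable_affine:
  fixes f :: "'a::euclidean_space \<Rightarrow> real"
  assumes f: "integrable lborel f" and c: "c \<noteq> 0"
  shows "integrable lborel (\<lambda>x. f (t + c *\<^sub>R x))"
proof -
  have [measurable]: "f \<in> borel_measurable borel" using f by auto
  have "(\<integral>\<^sup>+x. ennreal (norm (f x)) \<partial>lborel) = ennreal (\<bar>c\<bar> ^ DIM('a)) * (\<integral>\<^sup>+x. ennreal (norm (f (t + c *\<^sub>R x))) \<partial>lborel)"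
    by (rule lborel_nn_integral_affine[OF _ c]) auto
  moreover have "(\<integral>\<^sup>+x. ennreal (norm (f x)) \<partial>lborel) < \<infinity>"
    using f by (simp add: integrable_iff_bounded)
  ultimately have "(\<integral>\<^sup>+x. ennreal (norm (f (t + c *\<^sub>R x))) \<partial>lborel) < \<infinity>"
    using c by (auto simp: ennreal_mult_less_top)
  thus ?thesis by (auto simp: integrable_iff_bounded)
qed

lemma lborel_integral_shift:
  fixes f :: "'a::euclidean_space \<Rightarrow> real"
  assumes "f \<in> borel_measurable borel"
  shows "(\<integral>x. f (x + c) \<partial>lborel) = (\<integral>x. f x \<partial>lborel)"
  using lborel_integral_affine[of f 1 c] assms by (simp add: add.commute)

lemma lborel_integrable_shift:
  fixes f :: "'a::euclidean_space \<Rightarrow> real"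
  assumes "integrable lborel f"
  shows "integrable lborel (\<lambda>x. f (x + c))"
  using lborel_integrable_affine[of f 1 c] assms by (simp add: add.commute)

lemma integrable_bounded_cball:
  fixes g :: "'a::euclidean_space \<Rightarrow> real"
  assumes "g \<in> borel_measurable borel" "\<And>x. \<bar>g x\<bar> \<le> C" "\<And>x. norm x > R \<Longrightarrow> g x = 0"
  shows "integrable lborel g"
proof (rule integrableI_bounded_set[where A="cball 0 R" and B=C])
  show "emeasure lborel (cball (0::'a) R) < \<infinity>" by (rule emeasure_lborel_cball_finite)
qed (use assms in auto)

lemma continuous_cpt_supp_bounded:
  fixes g :: "'a::euclidean_space \<Rightarrow> real"
  assumes "continuous_on UNIV g" "\<And>x. norm x > R \<Longrightarrow> g x = 0"
  obtains C where "0 \<le> C" "\<And>x. \<bar>g x\<bar> \<le> C"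
proof -
  have "compact (g ` cball 0 R)"
    using assms(1) by (intro compact_continuous_image continuous_on_subset[OF assms(1)]) auto
  then obtain C where C: "\<And>x. x \<in> cball 0 R \<Longrightarrow> \<bar>g x\<bar> \<le> C"
    using compact_imp_bounded[of "g ` cball 0 R"] unfolding bounded_iff by (metis image_eqI real_norm_def)
  have "\<bar>g x\<bar> \<le> max C 0" for x
    using C[of x] assms(2)[of x] by (cases "norm x > R") auto
  thus thesis using that[of "max C 0"] by auto
qed

lemma bounded_on_cball:
  fixes v :: "'a::euclidean_space \<Rightarrow> real"
  assumes "continuous_on UNIV v"
  shows "\<exists>C\<ge>0. \<forall>x. norm x \<le> R \<longrightarrow> \<bar>v x\<bar> \<le> C"
proof -
  have "compact (v ` cball 0 R)"
    by (intro compact_continuous_image continuous_on_subset[OF assms]) auto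
  then obtain C where C: "\<forall>y\<in>v ` cball 0 R. norm y \<le> C" using compact_imp_bounded bounded_iff by metis
  have "\<bar>v x\<bar> \<le> max C 0" if "norm x \<le> R" for x
  proof -
    have "norm (v x) \<le> C" using C that by auto
    thus ?thesis by simp
  qed
  thus ?thesis by (intro exI[of _ "max C 0"]) auto
qed

lemma integrable_cpt_supp:
  fixes g :: "'a::euclidean_space \<Rightarrow> real"
  assumes "continuous_on UNIV g" "\<And>x. norm x > R \<Longrightarrow> g x = 0"
  shows "integrable lborel g"
proof -
  obtain C where C: "\<And>x. \<bar>g x\<bar> \<le> C" using continuous_cpt_supp_bounded[OF assms] by blast
  show ?thesis
    by (rule integrable_bounded_cball[OF _ C assms(2)])
       (use assms(1) in \<open>auto intro: borel_measurable_continuous_onI\<close>)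
qed

subsection \<open>Partial derivatives and integration by parts\<close>

text \<open>\<open>partial_deriv\<close> is a \<open>deriv\<close> at 0 and becomes a genuine
  derivative through differentiability. Having it at every parameter t of the line allows the mean
  value theorem along a segment in direction i.\<close>

lemma partial_deriv_DERIV:
  fixes f :: "real ^ 'n::finite \<Rightarrow> real"
  assumes "f differentiable (at (x + t *\<^sub>R axis i 1))"
  shows "((\<lambda>t. f (x + t *\<^sub>R axis i 1)) has_real_derivative partial_deriv i f (x + t *\<^sub>R axis i 1)) (at t)"
proof -
  let ?e = "axis i 1 :: real^'n"
  obtain D where D: "(f has_derivative D) (at (x + t *\<^sub>R ?e))"
    using assms by (auto simp: differentiable_def)
  have g: "((\<lambda>s. x + s *\<^sub>R ?e) has_derivative (\<lambda>s. s *\<^sub>R ?e)) (at t)"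
    by (auto intro!: derivative_eq_intros)
  have "((\<lambda>s. f (x + s *\<^sub>R ?e)) has_derivative (\<lambda>s. D (s *\<^sub>R ?e))) (at t)"
    using has_derivative_compose[OF g D] by (simp add: o_def)
  moreover have "(\<lambda>s. D (s *\<^sub>R ?e)) = (*) (D ?e)"
    using has_derivative_linear[OF D] by (auto simp: linear_iff fun_eq_iff)
  ultimately have 1: "((\<lambda>s. f (x + s *\<^sub>R ?e)) has_real_derivative D ?e) (at t)"
    by (simp add: has_field_derivative_def)
  have g: "((\<lambda>s. x + t *\<^sub>R ?e + s *\<^sub>R ?e) has_derivative (\<lambda>s. s *\<^sub>R ?e)) (at 0)"
    by (auto intro!: derivative_eq_intros)
  have "((\<lambda>s. f (x + t *\<^sub>R ?e + s *\<^sub>R ?e)) has_derivative (\<lambda>s. D (s *\<^sub>R ?e))) (at 0)"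
    using has_derivative_compose[OF g] D by (simp add: o_def)
  hence "((\<lambda>s. f (x + t *\<^sub>R ?e + s *\<^sub>R ?e)) has_real_derivative D ?e) (at 0)"
    using \<open>(\<lambda>s. D (s *\<^sub>R ?e)) = (*) (D ?e)\<close> by (simp add: has_field_derivative_def)
  hence "partial_deriv i f (x + t *\<^sub>R ?e) = D ?e"
    unfolding partial_deriv_def by (rule DERIV_imp_deriv)
  with 1 show ?thesis by simp
qed

lemma partial_deriv_eqI:
  "((\<lambda>t. f (x + t *\<^sub>R axis i 1)) has_real_derivative D) (at 0) \<Longrightarrow> partial_deriv i f x = D"
  unfolding partial_deriv_def by (rule DERIV_imp_deriv)

lemma partial_deriv_DERIV0:
  fixes f :: "real ^ 'n::finite \<Rightarrow> real"
  assumes "f differentiable (at x)"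
  shows "((\<lambda>t. f (x + t *\<^sub>R axis i 1)) has_real_derivative partial_deriv i f x) (at 0)"
  using partial_deriv_DERIV[of f x 0 i] assms by simp

lemma partial_deriv_mult:
  fixes f g :: "real ^ 'n::finite \<Rightarrow> real"
  assumes "f differentiable (at x)" "g differentiable (at x)"
  shows "partial_deriv i (\<lambda>x. f x * g x) x = partial_deriv i f x * g x + f x * partial_deriv i g x"
  by (rule partial_deriv_eqI)
     (use DERIV_mult[OF partial_deriv_DERIV0[OF assms(1)] partial_deriv_DERIV0[OF assms(2)]] in
      \<open>simp add: algebra_simps\<close>)

lemma partial_deriv_diff:
  fixes f g :: "real ^ 'n::finite \<Rightarrow> real"
  assumes "f differentiable (at x)" "g differentiable (at x)"
  shows "partial_deriv i (\<lambda>x. f x - g x) x = partial_deriv i f x - partial_deriv i g x"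
  by (rule partial_deriv_eqI)
     (use DERIV_diff[OF partial_deriv_DERIV0[OF assms(1)] partial_deriv_DERIV0[OF assms(2)]] in simp)

lemma partial_deriv_add:
  fixes f g :: "real ^ 'n::finite \<Rightarrow> real"
  assumes "f differentiable (at x)" "g differentiable (at x)"
  shows "partial_deriv i (\<lambda>x. f x + g x) x = partial_deriv i f x + partial_deriv i g x"
  by (rule partial_deriv_eqI)
     (use DERIV_add[OF partial_deriv_DERIV0[OF assms(1)] partial_deriv_DERIV0[OF assms(2)]] in simp)

text \<open>Outside the ball f vanishes on a neighbourhood in the axis line, which fixes the value
  of \<open>deriv\<close> there.\<close>

lemma partial_deriv_supp:
  fixes f :: "real ^ 'n::finite \<Rightarrow> real"
  assumes "\<And>x. norm x > R \<Longrightarrow> f x = 0" "norm x > R"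
  shows "partial_deriv i f x = 0"
proof (rule partial_deriv_eqI)
  have "continuous (at 0) (\<lambda>t. norm (x + t *\<^sub>R axis i 1 :: real^'n))"
    by (intro continuous_intros)
  hence "((\<lambda>t. norm (x + t *\<^sub>R axis i 1 :: real^'n)) \<longlongrightarrow> norm x) (at 0)"
    by (simp add: continuous_at)
  hence "\<forall>\<^sub>F t in at 0. R < norm (x + t *\<^sub>R axis i 1 :: real^'n)"
    using assms(2) by (rule order_tendstoD)
  hence ev: "\<forall>\<^sub>F t in at 0. f (x + t *\<^sub>R axis i 1) = 0"
    by eventually_elim (rule assms(1))
  have "\<forall>\<^sub>F t in nhds 0. f (x + t *\<^sub>R axis i 1) = 0"
    using ev assms unfolding eventually_at_filter
    by (auto elim!: eventually_mono)
  thus "((\<lambda>t. f (x + t *\<^sub>R axis i 1)) has_real_derivative 0) (at 0)"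
    by (subst DERIV_cong_ev[OF refl _ refl, where g="\<lambda>_. 0"]) auto
qed

lemma norm_sq_has_derivative:
  "((\<lambda>x::'a::real_inner. (norm (x - y))\<^sup>2) has_derivative (\<lambda>h. 2 * ((x - y) \<bullet> h))) (at x)"
proof -
  have "((\<lambda>x. (x - y) \<bullet> (x - y)) has_derivative (\<lambda>h. (x - y) \<bullet> h + h \<bullet> (x - y))) (at x)"
    by (auto intro!: derivative_eq_intros)
  thus ?thesis by (simp add: power2_norm_eq_inner inner_commute mult_2[symmetric])
qed

lemma norm_sq_axis_deriv:
  "((\<lambda>t. (norm (x + t *\<^sub>R axis i 1 - y :: real^'n))\<^sup>2) has_real_derivative 2 * ((x - y) $ i)) (at 0)"
proof -
  have "(norm (x + t *\<^sub>R axis i 1 - y :: real^'n))\<^sup>2 = (norm (x - y))\<^sup>2 + t * (2 * ((x - y) $ i)) + t\<^sup>2" for t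
  proof -
    have "x + t *\<^sub>R axis i 1 - y = (x - y) + t *\<^sub>R axis i 1" by simp
    moreover have "(norm (z + t *\<^sub>R axis i 1))\<^sup>2 = (norm z)\<^sup>2 + t * (2 * (z $ i)) + t\<^sup>2" for z :: "real^'n"
      by (simp only: power2_norm_eq_inner)
         (simp add: inner_add_left inner_add_right inner_axis inner_axis' power2_eq_square algebra_simps)
    ultimately show ?thesis by (simp only:)
  qed
  thus ?thesis by (auto intro!: derivative_eq_intros)
qed

text \<open>Translation invariance makes every difference quotient integrate to 0. The mean value
  theorem bounds the quotients by the maximum of the derivative on a ball enlarged by the largest
  step 1, so dominated convergence passes this on to the derivative.\<close>

lemma integral_partial_deriv_eq_0:
  fixes F :: "real ^ 'n::finite \<Rightarrow> real"
  assumes dF: "F differentiable_on UNIV" and cF: "continuous_on UNIV (partial_deriv i F)"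
    and supp: "\<And>x. norm x > R \<Longrightarrow> F x = 0"
  shows "(\<integral>x. partial_deriv i F x \<partial>lborel) = 0"
proof -
  let ?e = "axis i 1 :: real^'n"
  have dF': "F differentiable (at x)" for x
    using dF by (simp add: differentiable_on_def)
  have cont: "continuous_on UNIV F" using dF by (rule differentiable_imp_continuous_on)
  have mF[measurable]: "F \<in> borel_measurable borel" "partial_deriv i F \<in> borel_measurable borel"
    using cont cF by (auto intro: borel_measurable_continuous_onI)
  have iF: "integrable lborel F" by (rule integrable_cpt_supp[OF cont supp])
  obtain C where C: "C \<ge> 0" "\<And>x. \<bar>partial_deriv i F x\<bar> \<le> C"
  proof (rule continuous_cpt_supp_bounded[OF cF])
    show "partial_deriv i F x = 0" if "norm x > R" for x
      by (rule partial_deriv_supp[OF supp that])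
  qed blast
  define h where "h n = 1 / (real n + 1)" for n
  have h: "h n > 0" "h n \<le> 1" for n by (auto simp: h_def)
  define q where "q n x = (F (x + h n *\<^sub>R ?e) - F x) / h n" for n x
  have q0: "(\<integral>x. q n x \<partial>lborel) = 0" for n
  proof -
    have "(\<integral>x. F (x + h n *\<^sub>R ?e) - F x \<partial>lborel) = 0"
      by (subst Bochner_Integration.integral_diff)
         (auto intro: iF lborel_integrable_shift simp: lborel_integral_shift)
    thus ?thesis by (simp add: q_def)
  qed
  have "(\<lambda>n. \<integral>x. q n x \<partial>lborel) \<longlonglongrightarrow> (\<integral>x. partial_deriv i F x \<partial>lborel)"
  proof (rule integral_dominated_convergence[where w="\<lambda>x. C * indicator (cball 0 (R+1)) x"])
    show "integrable lborel (\<lambda>x::real^'n. C * indicator (cball 0 (R+1)) x)"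
      using emeasure_lborel_cball_finite[of "0::real^'n" "R+1"] by (auto simp: integrable_indicator_iff)
    show "AE x in lborel. (\<lambda>n. q n x) \<longlonglongrightarrow> partial_deriv i F x"
    proof (rule AE_I2)
      fix x
      have "((\<lambda>t. (F (x + t *\<^sub>R ?e) - F x) / t) \<longlongrightarrow> partial_deriv i F x) (at 0)"
        using partial_deriv_DERIV0[OF dF', of x i] by (simp add: has_field_derivative_iff)
      moreover have "filterlim h (at 0) sequentially"
        unfolding filterlim_at h_def
        using LIMSEQ_inverse_real_of_nat by (auto simp: field_simps)
      ultimately show "(\<lambda>n. q n x) \<longlonglongrightarrow> partial_deriv i F x"
        unfolding q_def by (rule filterlim_compose)
    qed
    show "AE x in lborel. norm (q n x) \<le> C * indicator (cball 0 (R+1)) x" for n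
    proof (rule AE_I2)
      fix x :: "real^'n"
      show "norm (q n x) \<le> C * indicator (cball 0 (R+1)) x"
      proof (cases "norm x \<le> R + 1")
        case True
        obtain z where "F (x + h n *\<^sub>R ?e) - F (x + 0 *\<^sub>R ?e) = (h n - 0) * partial_deriv i F (x + z *\<^sub>R ?e)"
          using MVT2[of 0 "h n" "\<lambda>t. F (x + t *\<^sub>R ?e)" "\<lambda>t. partial_deriv i F (x + t *\<^sub>R ?e)"]
            partial_deriv_DERIV[OF dF'] h(1)[of n] by blast
        hence "q n x = partial_deriv i F (x + z *\<^sub>R ?e)" using h(1)[of n] by (simp add: q_def)
        thus ?thesis using C(2) True by simp
      next
        case False
        have "norm x \<le> norm (x + h n *\<^sub>R ?e) + norm (h n *\<^sub>R ?e)"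
          by (metis add_diff_cancel norm_triangle_ineq4)
        hence "norm (x + h n *\<^sub>R ?e) > R" using False h[of n] by simp
        hence "q n x = 0" using supp False by (simp add: q_def)
        thus ?thesis using C(1) by simp
      qed
    qed
  qed (auto simp: q_def)
  hence "(\<lambda>n::nat. 0::real) \<longlonglongrightarrow> (\<integral>x. partial_deriv i F x \<partial>lborel)" by (simp add: q0)
  thus ?thesis by (simp add: LIMSEQ_const_iff)
qed

text \<open>\<open>laplacian \<phi>\<close> inherits continuity and bounded support, which makes it
  a harmless factor in the integrals against u and against potentials.\<close>

lemma test_functionE:
  assumes "test_function (\<phi> :: real ^ 'n::finite \<Rightarrow> real)"
  obtains R where "R > 0" "\<And>x. norm x > R \<Longrightarrow> \<phi> x = 0"
    "\<phi> differentiable_on UNIV" "continuous_on UNIV \<phi>" "\<And>i. partial_deriv i \<phi> differentiable_on UNIV"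
    "\<And>i j. continuous_on UNIV (partial_deriv i (partial_deriv j \<phi>))"
    "\<And>i. continuous_on UNIV (partial_deriv i \<phi>)"
    "continuous_on UNIV (laplacian \<phi>)" "\<And>x. norm x > R \<Longrightarrow> laplacian \<phi> x = 0"
proof -
  have "C_k (Suc (Suc 0)) \<phi>" using assms by (auto simp: test_function_def simp del: C_k.simps)
  hence *: "\<phi> differentiable_on UNIV" "\<And>i. partial_deriv i \<phi> differentiable_on UNIV"
     "\<And>i j. continuous_on UNIV (partial_deriv i (partial_deriv j \<phi>))" by auto
  have "bounded (closure {x. \<phi> x \<noteq> 0})"
    using assms by (auto simp: test_function_def compact_imp_bounded)
  then obtain R where R: "\<And>x. x \<in> closure {x. \<phi> x \<noteq> 0} \<Longrightarrow> norm x \<le> R" by (auto simp: bounded_iff)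
  have R': "\<phi> x = 0" if "norm x > max R 1" for x
    using R[of x] that closure_subset[of "{x. \<phi> x \<noteq> 0}"] by force
  show thesis
  proof (rule that[of "max R 1"])
    show "continuous_on UNIV (laplacian \<phi>)" unfolding laplacian_def[abs_def]
      by (intro continuous_intros *)
    show "laplacian \<phi> x = 0" if "norm x > max R 1" for x
      unfolding laplacian_def
      by (intro sum.neutral ballI partial_deriv_supp[of "max R 1"] that R') auto
  qed (use * R' in \<open>auto intro: differentiable_imp_continuous_on\<close>)
qed

text \<open>L need not have compact support, but the field L d_i phi - (d_i L) phi does, and in its
  i-th derivative the mixed terms cancel. Summing over i gives Green's identity without boundary
  terms.\<close>

lemma integral_laplacian_by_parts:
  fixes L :: "real ^ 'n::finite \<Rightarrow> real"
  assumes phi: "test_function \<phi>"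
    and L: "L differentiable_on UNIV" "\<And>i. partial_deriv i L differentiable_on UNIV"
      "\<And>i. continuous_on UNIV (partial_deriv i (partial_deriv i L))"
  shows "(\<integral>x. L x * laplacian \<phi> x \<partial>lborel) = (\<integral>x. laplacian L x * \<phi> x \<partial>lborel)"
proof -
  obtain R where "R > 0" and R: "\<And>x. norm x > R \<Longrightarrow> \<phi> x = 0"
    "\<phi> differentiable_on UNIV" "continuous_on UNIV \<phi>" "\<And>i. partial_deriv i \<phi> differentiable_on UNIV"
    "\<And>i j. continuous_on UNIV (partial_deriv i (partial_deriv j \<phi>))"
    "\<And>i. continuous_on UNIV (partial_deriv i \<phi>)"
    "continuous_on UNIV (laplacian \<phi>)" "\<And>x. norm x > R \<Longrightarrow> laplacian \<phi> x = 0"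
    by (rule test_functionE[OF phi]) blast
  have d: "\<phi> differentiable at x" "partial_deriv i \<phi> differentiable at x"
          "L differentiable at x" "partial_deriv i L differentiable at x" for i x
    using R(2,4) L by (auto simp: differentiable_on_def)
  have s1: "partial_deriv i \<phi> x = 0" if "norm x > R" for i x
    by (rule partial_deriv_supp[of R \<phi>]) (use that R(1) in auto)
  have s2: "partial_deriv i (partial_deriv i \<phi>) x = 0" if "norm x > R" for i x
    by (rule partial_deriv_supp[of R]) (use that s1 in auto)
  define F where "F i = (\<lambda>x. L x * partial_deriv i \<phi> x - partial_deriv i L x * \<phi> x)" for i
  have dF: "partial_deriv i (F i) x = L x * partial_deriv i (partial_deriv i \<phi>) x
        - partial_deriv i (partial_deriv i L) x * \<phi> x" for i x
    unfolding F_def using d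
    by (subst partial_deriv_diff) (auto intro!: differentiable_mult simp: partial_deriv_mult)
  have cL: "continuous_on UNIV L" using L(1) by (rule differentiable_imp_continuous_on)
  have "(\<integral>x. partial_deriv i (F i) x \<partial>lborel) = 0" for i
  proof (rule integral_partial_deriv_eq_0[where R=R])
    show "F i differentiable_on UNIV" unfolding F_def differentiable_on_def
      using d by (auto intro!: differentiable_diff differentiable_mult)
    have "continuous_on UNIV (\<lambda>x. L x * partial_deriv i (partial_deriv i \<phi>) x
        - partial_deriv i (partial_deriv i L) x * \<phi> x)"
      by (intro continuous_intros R L cL)
    thus "continuous_on UNIV (partial_deriv i (F i))" using dF by simp
    show "F i x = 0" if "R < norm x" for x
      using that R(1) s1 by (simp add: F_def)
  qed
  hence z: "(\<integral>x. (L x * partial_deriv i (partial_deriv i \<phi>) x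
        - partial_deriv i (partial_deriv i L) x * \<phi> x) \<partial>lborel) = 0" for i
    by (simp add: dF)
  have int: "integrable lborel (\<lambda>x. L x * partial_deriv i (partial_deriv i \<phi>) x
        - partial_deriv i (partial_deriv i L) x * \<phi> x)" for i
    by (rule integrable_cpt_supp[where R=R])
       (auto intro!: continuous_intros R L cL simp: R(1) s2)
  have int1: "integrable lborel (\<lambda>x. L x * laplacian \<phi> x)"
    by (rule integrable_cpt_supp[where R=R]) (auto intro!: continuous_intros R cL simp: R(8))
  have int2: "integrable lborel (\<lambda>x. laplacian L x * \<phi> x)"
    by (rule integrable_cpt_supp[where R=R])
       (auto intro!: continuous_intros R L cL simp: laplacian_def R(1))
  have "(\<integral>x. L x * laplacian \<phi> x \<partial>lborel) - (\<integral>x. laplacian L x * \<phi> x \<partial>lborel)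
      = (\<integral>x. L x * laplacian \<phi> x - laplacian L x * \<phi> x \<partial>lborel)"
    using int1 int2 by simp
  also have "\<dots> = (\<integral>x. (\<Sum>i\<in>UNIV. L x * partial_deriv i (partial_deriv i \<phi>) x
        - partial_deriv i (partial_deriv i L) x * \<phi> x) \<partial>lborel)"
    by (simp add: laplacian_def sum_distrib_left sum_distrib_right sum_subtractf)
  also have "\<dots> = 0" by (subst Bochner_Integration.integral_sum) (auto simp: int z)
  finally show ?thesis by simp
qed

subsection \<open>Integration over the plane in Cartesian coordinates\<close>

text \<open>Iterated integrals belong to the product measure on pairs of reals, the equation to
  \<open>real ^ 2\<close>; this linear bijection carries Lebesgue measure from the former to the
  latter.\<close>

definition mk2 :: "real \<Rightarrow> real \<Rightarrow> real ^ 2" where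
  "mk2 a b = a *\<^sub>R axis 1 1 + b *\<^sub>R axis 2 1"

lemma mk2_nth [simp]: "mk2 a b $ 1 = a" "mk2 a b $ 2 = b"
  by (auto simp: mk2_def axis_def)

lemma norm_mk2: "norm (mk2 a b) = sqrt (a\<^sup>2 + b\<^sup>2)"
  by (simp add: norm_vec_def L2_set_def UNIV_2)

lemma mk2_borel [measurable]: "(\<lambda>p. mk2 (fst p) (snd p)) \<in> borel_measurable borel"
  unfolding mk2_def by (intro borel_measurable_continuous_onI continuous_intros)

text \<open>Boxes determine Lebesgue measure, and the preimage of a box is the box with the same
  sides.\<close>

lemma distr_mk2: "distr lborel borel (\<lambda>p. mk2 (fst p) (snd p)) = lborel"
proof (rule lborel_eqI[symmetric])
  fix l u :: "real ^ 2" assume lu: "\<And>b. b \<in> Basis \<Longrightarrow> l \<bullet> b \<le> u \<bullet> b"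
  have *: "l $ 1 \<le> u $ 1" "l $ 2 \<le> u $ 2"
    using lu[of "axis 1 1"] lu[of "axis 2 1"] by (auto simp: Basis_vec_def inner_axis)
  have eq: "(\<lambda>p. mk2 (fst p) (snd p)) -` box l u = box (l $ 1, l $ 2) (u $ 1, u $ 2)"
    by (auto simp: mem_box_cart forall_2 mem_box Basis_prod_def)
  have B: "(Basis :: (real^2) set) = {axis 1 1, axis 2 1}"
    by (auto simp: Basis_vec_def UNIV_2)
  have ne: "axis 1 1 \<noteq> (axis 2 1 :: real^2)" by (simp add: axis_eq_axis)
  have "emeasure (distr lborel borel (\<lambda>p. mk2 (fst p) (snd p))) (box l u) = emeasure lborel (box (l $ 1, l $ 2) (u $ 1, u $ 2))"
    by (subst emeasure_distr) (auto simp: eq)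
  also have "\<dots> = ennreal ((u $ 1 - l $ 1) * (u $ 2 - l $ 2))"
    using * by (subst emeasure_lborel_box) (auto simp: Basis_prod_def prod.union_disjoint prod.insert)
  also have "\<dots> = ennreal (\<Prod>b\<in>Basis. (u - l) \<bullet> b)"
    using ne by (simp add: B inner_axis)
  finally show "emeasure (distr lborel borel (\<lambda>p. mk2 (fst p) (snd p))) (box l u) = ennreal (\<Prod>b\<in>Basis. (u - l) \<bullet> b)" .
qed simp

lemma nn_integral_plane:
  assumes [measurable]: "f \<in> borel_measurable (borel :: (real^2) measure)"
  shows "(\<integral>\<^sup>+x. f x \<partial>lborel) = (\<integral>\<^sup>+a. \<integral>\<^sup>+b. f (mk2 a b) \<partial>lborel \<partial>lborel)"
proof -
  have [measurable]: "(\<lambda>p. f (mk2 (fst p) (snd p))) \<in> borel_measurable (lborel \<Otimes>\<^sub>M lborel)"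
    unfolding lborel_prod by measurable
  have "(\<integral>\<^sup>+x. f x \<partial>lborel) = (\<integral>\<^sup>+x. f x \<partial>distr lborel borel (\<lambda>p. mk2 (fst p) (snd p)))"
    by (simp add: distr_mk2)
  also have "\<dots> = (\<integral>\<^sup>+p. f (mk2 (fst p) (snd p)) \<partial>(lborel \<Otimes>\<^sub>M lborel))"
    by (subst nn_integral_distr) (auto simp: lborel_prod)
  also have "\<dots> = (\<integral>\<^sup>+a. \<integral>\<^sup>+b. f (mk2 a b) \<partial>lborel \<partial>lborel)"
    by (subst lborel.nn_integral_fst[symmetric]) auto
  finally show ?thesis .
qed

section \<open>Closed-form integrals over the line and the plane\<close>

lemma nn_integral_FTC_UNIV:
  fixes f F :: "real \<Rightarrow> real"
  assumes "\<And>x. DERIV F x :> f x" "continuous_on UNIV f" "\<And>x. 0 \<le> f x"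
    "(F \<longlongrightarrow> A) at_bot" "(F \<longlongrightarrow> B) at_top"
  shows "(\<integral>\<^sup>+x. f x \<partial>lborel) = ennreal (B - A)"
proof -
  have i: "set_integrable lborel (einterval (-\<infinity>) \<infinity>) f" "(LBINT x=-\<infinity>..\<infinity>. f x) = B - A"
    using interval_integral_FTC_nonneg[of "-\<infinity>" "\<infinity>" F f A B] assms
    by (auto simp: ereal_tendsto_simps1 continuous_on_eq_continuous_at)
  hence "integrable lborel f" by (simp add: set_integrable_def)
  moreover have "(\<integral>x. f x \<partial>lborel) = B - A"
    using i(2) by (simp add: interval_lebesgue_integral_def set_lebesgue_integral_def)
  ultimately show ?thesis using assms(3) by (subst nn_integral_eq_integral) auto
qed

lemma nn_integral_inverse_square_quadratic:
  fixes A :: real assumes A: "A > 0"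
  shows "(\<integral>\<^sup>+x. ennreal (1 / (A\<^sup>2 + x\<^sup>2)\<^sup>2) \<partial>lborel) = ennreal (pi / (2 * A ^ 3))"
proof -
  \<comment> \<open>An antiderivative. Only the arctan term survives at the two ends, where it tends
    to plus and minus pi / (4 A^3).\<close>
  define F where "F x = x / (2 * A\<^sup>2 * (A\<^sup>2 + x\<^sup>2)) + arctan (x / A) / (2 * A ^ 3)" for x
  have pos: "A\<^sup>2 + x\<^sup>2 > 0" for x using A by (simp add: add_pos_nonneg)
  have "(\<integral>\<^sup>+x. ennreal (1 / (A\<^sup>2 + x\<^sup>2)\<^sup>2) \<partial>lborel) = ennreal (pi / (4 * A^3) - (- pi / (4 * A^3)))"
  proof (rule nn_integral_FTC_UNIV)
    fix x
    have "(F has_real_derivative ((2 * A\<^sup>2 * (A\<^sup>2 + x\<^sup>2)) - x * (2 * A\<^sup>2 * (2 * x))) / (2 * A\<^sup>2 * (A\<^sup>2 + x\<^sup>2))\<^sup>2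
       + (1 / A) / (1 + (x / A)\<^sup>2) / (2 * A ^ 3)) (at x)"
    proof -
      have d1: "((\<lambda>x. x / (2 * A\<^sup>2 * (A\<^sup>2 + x\<^sup>2))) has_real_derivative
          (1 * (2 * A\<^sup>2 * (A\<^sup>2 + x\<^sup>2)) - x * (2 * A\<^sup>2 * (2 * x))) / ((2 * A\<^sup>2 * (A\<^sup>2 + x\<^sup>2)) * (2 * A\<^sup>2 * (A\<^sup>2 + x\<^sup>2)))) (at x)"
        by (rule DERIV_divide) (use pos[of x] A in \<open>auto intro!: derivative_eq_intros\<close>)
      have d2: "((\<lambda>x. arctan (x / A)) has_real_derivative inverse (1 + (x / A)\<^sup>2) * (1 / A)) (at x)"
        by (rule DERIV_chain2[OF DERIV_arctan]) (use A in \<open>auto intro!: derivative_eq_intros\<close>)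
      show ?thesis
        using DERIV_add[OF d1 DERIV_cdivide[OF d2, of "2 * A ^ 3"]] unfolding F_def
        by (simp add: power2_eq_square field_simps)
    qed
    also have "((2 * A\<^sup>2 * (A\<^sup>2 + x\<^sup>2)) - x * (2 * A\<^sup>2 * (2 * x))) / (2 * A\<^sup>2 * (A\<^sup>2 + x\<^sup>2))\<^sup>2
        = (A\<^sup>2 - x\<^sup>2) / (2 * A\<^sup>2 * (A\<^sup>2 + x\<^sup>2)\<^sup>2)"
      using pos[of x] A by (simp add: divide_simps) (simp add: algebra_simps power2_eq_square power4_eq_xxxx)
    also have "(1 / A) / (1 + (x / A)\<^sup>2) / (2 * A ^ 3) = (A\<^sup>2 + x\<^sup>2) / (2 * A\<^sup>2 * (A\<^sup>2 + x\<^sup>2)\<^sup>2)"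
      using pos[of x] A by (simp add: divide_simps) (simp add: algebra_simps power2_eq_square power3_eq_cube power4_eq_xxxx)
    also have "(A\<^sup>2 - x\<^sup>2) / (2 * A\<^sup>2 * (A\<^sup>2 + x\<^sup>2)\<^sup>2) + (A\<^sup>2 + x\<^sup>2) / (2 * A\<^sup>2 * (A\<^sup>2 + x\<^sup>2)\<^sup>2) = 1 / (A\<^sup>2 + x\<^sup>2)\<^sup>2"
      using pos[of x] A by (simp add: add_divide_distrib[symmetric])
    finally show "DERIV F x :> 1 / (A\<^sup>2 + x\<^sup>2)\<^sup>2" .
  next
    show "continuous_on UNIV (\<lambda>x. 1 / (A\<^sup>2 + x\<^sup>2)\<^sup>2)"
      using pos by (intro continuous_intros) (auto simp: less_imp_neq[symmetric])
    have 1: "((\<lambda>x. x / (2 * A\<^sup>2 * (A\<^sup>2 + x\<^sup>2))) \<longlongrightarrow> 0) at_infinity"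
    proof (rule Lim_null_comparison)
      show "\<forall>\<^sub>F x in at_infinity. norm (x / (2 * A\<^sup>2 * (A\<^sup>2 + x\<^sup>2))) \<le> norm (inverse (2 * A\<^sup>2)) * norm (inverse x)"
      proof (rule always_eventually, rule allI)
        fix x :: real
        have "\<bar>x\<bar> * \<bar>x\<bar> \<le> A\<^sup>2 + x\<^sup>2" by (simp add: power2_eq_square)
        thus "norm (x / (2 * A\<^sup>2 * (A\<^sup>2 + x\<^sup>2))) \<le> norm (inverse (2 * A\<^sup>2)) * norm (inverse x)"
          using pos[of x] A by (cases "x = 0") (auto simp: divide_simps abs_mult)
      qed
      show "((\<lambda>x::real. norm (inverse (2 * A\<^sup>2)) * norm (inverse x)) \<longlongrightarrow> 0) at_infinity"
        by (intro tendsto_mult_right_zero tendsto_norm_zero tendsto_inverse_0)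
    qed
    have 2: "(F \<longlongrightarrow> 0 + (pi/2) / (2 * A^3)) at_top" unfolding F_def
    proof (intro tendsto_intros)
      show "((\<lambda>x. x / (2 * A\<^sup>2 * (A\<^sup>2 + x\<^sup>2))) \<longlongrightarrow> 0) at_top"
        using 1 by (rule filterlim_mono[OF _ order_refl at_top_le_at_infinity])
      have "filterlim (\<lambda>x. (1/A) * x) at_top at_top"
        using A by (intro filterlim_tendsto_pos_mult_at_top[OF tendsto_const] filterlim_ident) auto
      from filterlim_compose[OF tendsto_arctan_at_top this]
      show "((\<lambda>x. arctan (x / A)) \<longlongrightarrow> pi / 2) at_top" by simp
    qed (use A in auto)
    have 3: "(F \<longlongrightarrow> 0 + (- (pi/2)) / (2 * A^3)) at_bot" unfolding F_def
    proof (intro tendsto_intros)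
      show "((\<lambda>x. x / (2 * A\<^sup>2 * (A\<^sup>2 + x\<^sup>2))) \<longlongrightarrow> 0) at_bot"
        using 1 by (rule filterlim_mono[OF _ order_refl at_bot_le_at_infinity])
      have "filterlim (\<lambda>x. (1/A) * x) at_bot at_bot"
        using A by (intro filterlim_tendsto_pos_mult_at_bot[OF tendsto_const] filterlim_ident) auto
      from filterlim_compose[OF tendsto_arctan_at_bot this]
      show "((\<lambda>x. arctan (x / A)) \<longlongrightarrow> - (pi / 2)) at_bot" by simp
    qed (use A in auto)
    show "(F \<longlongrightarrow> pi / (4 * A^3)) at_top" using 2 by (simp add: field_simps)
    show "(F \<longlongrightarrow> - pi / (4 * A^3)) at_bot" using 3 by (simp add: field_simps)
  qed auto
  thus ?thesis by (simp add: field_simps)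
qed

lemma nn_integral_inverse_sqrt_cubed:
  "(\<integral>\<^sup>+x. ennreal (pi / (2 * sqrt (1 + x\<^sup>2) ^ 3)) \<partial>lborel) = ennreal pi"
proof -
  define F where "F x = pi / 2 * (x / sqrt (1 + x\<^sup>2))" for x
  have pos: "1 + x\<^sup>2 > 0" for x :: real by (simp add: add_pos_nonneg)
  have "(\<integral>\<^sup>+x. ennreal (pi / (2 * sqrt (1 + x\<^sup>2) ^ 3)) \<partial>lborel) = ennreal (pi/2 * 1 - pi/2 * (-1))"
  proof (rule nn_integral_FTC_UNIV)
    fix x
    have "(F has_real_derivative pi / 2 * ((sqrt (1 + x\<^sup>2) - x * (x / sqrt (1 + x\<^sup>2))) / (sqrt (1 + x\<^sup>2))\<^sup>2)) (at x)"
    proof -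
      have ds: "((\<lambda>x. sqrt (1 + x\<^sup>2)) has_real_derivative x / sqrt (1 + x\<^sup>2)) (at x)"
        using pos[of x] by (auto intro!: derivative_eq_intros simp: field_simps)
      show ?thesis
        using DERIV_cmult[OF DERIV_divide[OF DERIV_ident ds], of "pi/2"] pos[of x] unfolding F_def
        by (simp add: power2_eq_square)
    qed
    also have "(sqrt (1 + x\<^sup>2) - x * (x / sqrt (1 + x\<^sup>2))) = 1 / sqrt (1 + x\<^sup>2)"
    proof -
      have "sqrt (1 + x\<^sup>2) * sqrt (1 + x\<^sup>2) = 1 + x * x" using pos[of x] by (simp add: power2_eq_square)
      thus ?thesis using pos[of x] by (simp add: field_simps)
    qed
    finally show "DERIV F x :> pi / (2 * sqrt (1 + x\<^sup>2) ^ 3)"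
      by (simp add: power2_eq_square power3_eq_cube mult.commute)
  next
    show "continuous_on UNIV (\<lambda>x. pi / (2 * sqrt (1 + x\<^sup>2) ^ 3))"
      using pos by (intro continuous_intros) (auto simp: less_imp_neq[symmetric])
    have "((\<lambda>x::real. 1 / sqrt (1 + (inverse x)\<^sup>2)) \<longlongrightarrow> 1 / sqrt (1 + 0\<^sup>2)) at_infinity"
      by (intro tendsto_intros tendsto_inverse_0) auto
    hence 1: "((\<lambda>x::real. 1 / sqrt (1 + (inverse x)\<^sup>2)) \<longlongrightarrow> 1) at_infinity" by simp
    have sq: "x / sqrt (1 + x\<^sup>2) = sgn x * (1 / sqrt (1 + (inverse x)\<^sup>2))" if "x \<noteq> 0" for x :: real
    proof -
      have "1 + x\<^sup>2 = x\<^sup>2 * (1 + (inverse x)\<^sup>2)" using that by (simp add: field_simps power2_eq_square)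
      hence "sqrt (1 + x\<^sup>2) = \<bar>x\<bar> * sqrt (1 + (inverse x)\<^sup>2)" by (simp add: real_sqrt_mult)
      thus ?thesis using that by (simp add: sgn_if field_simps)
    qed
    have "((\<lambda>x. x / sqrt (1 + x\<^sup>2)) \<longlongrightarrow> 1) at_top"
      by (rule Lim_transform_eventually[OF filterlim_mono[OF 1 order_refl at_top_le_at_infinity]])
         (use sq in \<open>auto intro: eventually_mono[OF eventually_gt_at_top[of 0]]\<close>)
    thus "(F \<longlongrightarrow> pi/2 * 1) at_top" unfolding F_def by (intro tendsto_intros)
    have "((\<lambda>x. x / sqrt (1 + x\<^sup>2)) \<longlongrightarrow> -1) at_bot"
      by (rule Lim_transform_eventually[OF tendsto_minus[OF filterlim_mono[OF 1 order_refl at_bot_le_at_infinity]]])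
         (use sq in \<open>auto intro: eventually_mono[OF eventually_gt_at_bot[of 0]]\<close>)
    thus "(F \<longlongrightarrow> pi/2 * (-1)) at_bot" unfolding F_def by (intro tendsto_intros)
  qed (auto intro!: divide_nonneg_nonneg)
  thus ?thesis by simp
qed

text \<open>This profile is, up to the factor 2, the rescaled Laplacian of the regularised
  logarithm, so its mass pi is the source of the constant 2 pi in the fundamental solution. In
  Cartesian coordinates the inner integral is \<open>nn_integral_inverse_square_quadratic\<close>
  with A = sqrt (1 + a^2).\<close>

lemma nn_integral_inverse_one_plus_norm_sq:
  "(\<integral>\<^sup>+x. ennreal (1 / (1 + (norm x)\<^sup>2)\<^sup>2) \<partial>(lborel :: (real^2) measure)) = ennreal pi"
proof -
  have "(\<integral>\<^sup>+x. ennreal (1 / (1 + (norm x)\<^sup>2)\<^sup>2) \<partial>(lborel :: (real^2) measure))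
    = (\<integral>\<^sup>+a. \<integral>\<^sup>+b. ennreal (1 / (1 + (norm (mk2 a b))\<^sup>2)\<^sup>2) \<partial>lborel \<partial>lborel)"
    by (rule nn_integral_plane) measurable
  also have "\<dots> = (\<integral>\<^sup>+a. \<integral>\<^sup>+b. ennreal (1 / ((sqrt (1 + a\<^sup>2))\<^sup>2 + b\<^sup>2)\<^sup>2) \<partial>lborel \<partial>lborel)"
    by (simp add: norm_mk2 add.assoc)
  also have "\<dots> = (\<integral>\<^sup>+a. ennreal (pi / (2 * sqrt (1 + a\<^sup>2) ^ 3)) \<partial>lborel)"
    by (subst nn_integral_inverse_square_quadratic) (auto simp: add_pos_nonneg)
  finally show ?thesis by (simp add: nn_integral_inverse_sqrt_cubed)
qed

lemma has_bochner_integral_inverse_one_plus_norm_sq: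
  "has_bochner_integral (lborel :: (real^2) measure) (\<lambda>x. 1 / (1 + (norm x)\<^sup>2)\<^sup>2) pi"
  by (rule has_bochner_integral_nn_integral) (auto simp: nn_integral_inverse_one_plus_norm_sq)

text \<open>Splitting at 0 leaves two copies of the integral of x^(-1/2) over [0, 1], each equal to
  2.\<close>

lemma nn_integral_abs_powr_neg_half:
  "(\<integral>\<^sup>+a. ennreal (\<bar>a\<bar> powr (-1/2) * indicator {-1..1} a) \<partial>lborel) < \<infinity>"
proof -
  define I where "I = (\<integral>\<^sup>+a. ennreal (a powr (-1/2) * indicator {0..1} a) \<partial>lborel)"
  have "((\<lambda>x::real. x powr (-1/2)) has_integral 2) {0..1}"
    using has_integral_powr_from_0[of "-1/2" 1] by simp
  hence "((\<lambda>x::real. x powr (-1/2) * indicator {0..1} x) has_integral 2) UNIV"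
    by (subst (asm) has_integral_restrict_UNIV[symmetric])
       (erule has_integral_eq[rotated], auto simp: indicator_def)
  hence I: "I = ennreal 2" unfolding I_def
    by (intro nn_integral_has_integral_lborel) auto
  have I': "(\<integral>\<^sup>+a. ennreal ((-a) powr (-1/2) * indicator {0..1} (-a)) \<partial>lborel) = I"
    unfolding I_def by (subst (2) nn_integral_real_affine[where c="-1" and t=0]) auto
  have "(\<integral>\<^sup>+a. ennreal (\<bar>a\<bar> powr (-1/2) * indicator {-1..1} a) \<partial>lborel)
    \<le> (\<integral>\<^sup>+a. ennreal (a powr (-1/2) * indicator {0..1} a) + ennreal ((-a) powr (-1/2) * indicator {0..1} (-a)) \<partial>lborel)"
    by (intro nn_integral_mono) (auto simp: indicator_def abs_if ennreal_plus[symmetric] simp del: ennreal_plus)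
  also have "\<dots> = I + I" by (subst nn_integral_add) (auto simp only: I_def[symmetric] I', auto)
  also have "\<dots> < \<infinity>" by (simp add: I)
  finally show ?thesis .
qed

text \<open>A product majorant takes the place of polar coordinates: |a| |b| <= a^2 + b^2 gives 1 /
  |x| <= |a|^(-1/2) |b|^(-1/2), and each factor is integrable on [-1, 1].\<close>

lemma nn_integral_inverse_norm_unit:
  "(\<integral>\<^sup>+x. ennreal (1 / norm x * indicator (cball 0 1) x) \<partial>(lborel :: (real^2) measure)) < \<infinity>"
proof -
  define J where "J = (\<integral>\<^sup>+a. ennreal (\<bar>a\<bar> powr (-1/2) * indicator {-1..1} a) \<partial>lborel)"
  have AE0: "AE a in lborel. a \<noteq> (0::real)" by (rule AE_lborel_singleton)
  have "(\<integral>\<^sup>+x. ennreal (1 / norm x * indicator (cball 0 1) x) \<partial>(lborel :: (real^2) measure))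
    = (\<integral>\<^sup>+a. \<integral>\<^sup>+b. ennreal (1 / norm (mk2 a b) * indicator (cball 0 1) (mk2 a b)) \<partial>lborel \<partial>lborel)"
    by (rule nn_integral_plane) (auto intro!: borel_measurable_divide borel_measurable_indicator measurable_compose[OF _ measurable_ennreal])
  also have "\<dots> \<le> (\<integral>\<^sup>+a. \<integral>\<^sup>+b. ennreal (\<bar>a\<bar> powr (-1/2) * indicator {-1..1} a) * ennreal (\<bar>b\<bar> powr (-1/2) * indicator {-1..1} b) \<partial>lborel \<partial>lborel)"
  proof (rule nn_integral_mono_AE, use AE0 in eventually_elim, rule nn_integral_mono_AE, use AE0 in eventually_elim)
    fix a b :: real assume ab: "a \<noteq> 0" "b \<noteq> 0"
    show "ennreal (1 / norm (mk2 a b) * indicator (cball 0 1) (mk2 a b))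
       \<le> ennreal (\<bar>a\<bar> powr (-1/2) * indicator {-1..1} a) * ennreal (\<bar>b\<bar> powr (-1/2) * indicator {-1..1} b)"
    proof (cases "norm (mk2 a b) \<le> 1")
      case True
      have "\<bar>mk2 a b $ 1\<bar> \<le> 1" "\<bar>mk2 a b $ 2\<bar> \<le> 1"
        using component_le_norm_cart[of "mk2 a b"] True order_trans by blast+
      hence i: "a \<in> {-1..1}" "b \<in> {-1..1}" by auto
      have "\<bar>a\<bar> * \<bar>b\<bar> \<le> a\<^sup>2 + b\<^sup>2"
        using sum_squares_bound[of "\<bar>a\<bar>" "\<bar>b\<bar>"] by (simp add: mult.assoc) (smt (verit) mult_nonneg_nonneg)
      hence "sqrt (\<bar>a\<bar> * \<bar>b\<bar>) \<le> norm (mk2 a b)" unfolding norm_mk2 by simp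
      hence "1 / norm (mk2 a b) \<le> 1 / sqrt (\<bar>a\<bar> * \<bar>b\<bar>)" using ab by (intro divide_left_mono mult_pos_pos) (auto simp: norm_mk2 sum_power2_gt_zero_iff)
      also have "\<dots> = \<bar>a\<bar> powr (-1/2) * \<bar>b\<bar> powr (-1/2)"
        using ab by (simp add: powr_minus_divide powr_half_sqrt real_sqrt_mult)
      finally show ?thesis using i True by (auto simp: ennreal_mult'[symmetric] intro: ennreal_leI)
    qed auto
  qed
  also have "\<dots> = J * J"
    by (simp add: nn_integral_cmult nn_integral_multc J_def)
  also have "\<dots> < \<infinity>" using nn_integral_abs_powr_neg_half
    by (auto simp: J_def ennreal_mult_less_top)
  finally show ?thesis .
qed

lemma integrable_inverse_norm_cball:
  "integrable (lborel :: (real^2) measure) (\<lambda>x. 1 / norm x * indicator (cball 0 R) x)"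
proof -
  have 1: "integrable (lborel :: (real^2) measure) (\<lambda>x. 1 / norm x * indicator (cball 0 1) x)"
    using nn_integral_inverse_norm_unit by (intro integrableI_bounded) (auto simp: abs_mult intro!: borel_measurable_divide borel_measurable_indicator)
  have 2: "integrable (lborel :: (real^2) measure) (\<lambda>x. indicator (cball 0 R) x :: real)"
    using emeasure_lborel_cball_finite[of "0::real^2" R] by (auto intro!: integrable_real_indicator)
  show ?thesis
  proof (rule Bochner_Integration.integrable_bound[OF Bochner_Integration.integrable_add[OF 1 2]])
    show "AE x in lborel. norm (1 / norm x * indicator (cball 0 R) x)
      \<le> norm (1 / norm x * indicator (cball 0 1) x + (indicator (cball 0 R) x :: real))"
      by (intro AE_I2) (auto simp: indicator_def divide_simps)
  qed (auto intro!: borel_measurable_divide borel_measurable_indicator)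
qed

subsection \<open>The fundamental solution\<close>

text \<open>The logarithm of sqrt (|x - y|^2 + e^2), a smooth version of ln |x - y|. Its Laplacian
  is a positive approximate identity of total mass 2 pi.\<close>

definition log_reg :: "real \<Rightarrow> real ^ 2 \<Rightarrow> real ^ 2 \<Rightarrow> real" where
  "log_reg e y x = ln ((norm (x - y))\<^sup>2 + e\<^sup>2) / 2"

lemma log_reg_deriv:
  assumes e: "e > 0"
  shows "log_reg e y differentiable_on UNIV"
    "partial_deriv i (log_reg e y) = (\<lambda>x. (x - y) $ i / ((norm (x - y))\<^sup>2 + e\<^sup>2))"
    "partial_deriv i (log_reg e y) differentiable_on UNIV"
    "partial_deriv i (partial_deriv i (log_reg e y)) =
       (\<lambda>x. 1 / ((norm (x - y))\<^sup>2 + e\<^sup>2) - 2 * ((x - y) $ i)\<^sup>2 / ((norm (x - y))\<^sup>2 + e\<^sup>2)\<^sup>2)"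
    "continuous_on UNIV (partial_deriv i (partial_deriv i (log_reg e y)))"
    "laplacian (log_reg e y) = (\<lambda>x. 2 * e\<^sup>2 / ((norm (x - y))\<^sup>2 + e\<^sup>2)\<^sup>2)"
proof -
  have pos: "(norm (x - y))\<^sup>2 + e\<^sup>2 > 0" for x using e by (simp add: add_nonneg_pos)
  show 1: "log_reg e y differentiable_on UNIV"
    unfolding differentiable_on_def differentiable_def log_reg_def[abs_def]
  proof (intro ballI exI)
    fix x
    have d: "DERIV (\<lambda>s. ln (s + e\<^sup>2) / 2) ((norm (x - y))\<^sup>2) :> 1 / ((norm (x - y))\<^sup>2 + e\<^sup>2) * 1 / 2"
      using pos[of x] by (intro DERIV_cdivide DERIV_chain2[OF DERIV_ln_divide]) (auto intro!: derivative_eq_intros)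
    show "((\<lambda>x. ln ((norm (x - y))\<^sup>2 + e\<^sup>2) / 2) has_derivative
       (\<lambda>h. 2 * ((x - y) \<bullet> h) * (1 / ((norm (x - y))\<^sup>2 + e\<^sup>2) * 1 / 2))) (at x)"
      by (rule DERIV_compose_FDERIV[OF d norm_sq_has_derivative])
  qed
  show 2: "partial_deriv i (log_reg e y) = (\<lambda>x. (x - y) $ i / ((norm (x - y))\<^sup>2 + e\<^sup>2))" for i
  proof (rule ext, rule partial_deriv_eqI)
    fix x
    have eqD: "(1 / D * (2 * c + 0)) / 2 = c / D" for c D :: real by simp
    have "((\<lambda>t. ln ((norm (x + t *\<^sub>R axis i 1 - y))\<^sup>2 + e\<^sup>2) / 2) has_real_derivative
      (1 / ((norm (x + 0 *\<^sub>R axis i 1 - y))\<^sup>2 + e\<^sup>2) * (2 * ((x - y) $ i) + 0)) / 2) (at 0)"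
      using pos by (intro DERIV_cdivide DERIV_chain2[OF DERIV_ln_divide] DERIV_add norm_sq_axis_deriv DERIV_const) (auto simp: pos)
    thus "((\<lambda>t. log_reg e y (x + t *\<^sub>R axis i 1)) has_real_derivative (x - y) $ i / ((norm (x - y))\<^sup>2 + e\<^sup>2)) (at 0)"
      unfolding eqD by (simp add: log_reg_def del: vector_minus_component)
  qed
  show "partial_deriv i (log_reg e y) differentiable_on UNIV"
    unfolding 2 differentiable_on_def
  proof
    fix x
    show "(\<lambda>x. (x - y) $ i / ((norm (x - y))\<^sup>2 + e\<^sup>2)) differentiable at x"
    proof (rule differentiable_divide)
      show "(\<lambda>x. (x - y) $ i) differentiable at x"
        unfolding differentiable_def
        by (rule exI, rule bounded_linear.has_derivative[OF bounded_linear_vec_nth])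
           (auto intro!: derivative_eq_intros)
      show "(\<lambda>x. (norm (x - y))\<^sup>2 + e\<^sup>2) differentiable at x"
        unfolding differentiable_def
        by (rule exI, rule has_derivative_add[OF norm_sq_has_derivative has_derivative_const])
    qed (use pos[of x] in auto)
  qed
  show 4: "partial_deriv i (partial_deriv i (log_reg e y)) =
       (\<lambda>x. 1 / ((norm (x - y))\<^sup>2 + e\<^sup>2) - 2 * ((x - y) $ i)\<^sup>2 / ((norm (x - y))\<^sup>2 + e\<^sup>2)\<^sup>2)" for i
  proof (rule ext, rule partial_deriv_eqI)
    fix x
    let ?D = "(norm (x - y))\<^sup>2 + e\<^sup>2"
    have "((\<lambda>t. (x + t *\<^sub>R axis i 1 - y) $ i / ((norm (x + t *\<^sub>R axis i 1 - y))\<^sup>2 + e\<^sup>2)) has_real_derivative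
      (1 * ((norm (x + 0 *\<^sub>R axis i 1 - y))\<^sup>2 + e\<^sup>2) - (x + 0 *\<^sub>R axis i 1 - y) $ i * (2 * ((x - y) $ i) + 0)) /
       (((norm (x + 0 *\<^sub>R axis i 1 - y))\<^sup>2 + e\<^sup>2) * ((norm (x + 0 *\<^sub>R axis i 1 - y))\<^sup>2 + e\<^sup>2))) (at 0)"
      using pos[of "x + 0 *\<^sub>R axis i 1"]
      by (intro DERIV_divide DERIV_add norm_sq_axis_deriv DERIV_const)
         (auto intro!: derivative_eq_intros)
    also have "(1 * ((norm (x + 0 *\<^sub>R axis i 1 - y))\<^sup>2 + e\<^sup>2) - (x + 0 *\<^sub>R axis i 1 - y) $ i * (2 * ((x - y) $ i) + 0)) /
       (((norm (x + 0 *\<^sub>R axis i 1 - y))\<^sup>2 + e\<^sup>2) * ((norm (x + 0 *\<^sub>R axis i 1 - y))\<^sup>2 + e\<^sup>2))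
       = 1 / ?D - 2 * ((x - y) $ i)\<^sup>2 / ?D\<^sup>2"
      using pos[of x] by (simp add: power2_eq_square diff_divide_distrib)
    finally show "((\<lambda>t. partial_deriv i (log_reg e y) (x + t *\<^sub>R axis i 1)) has_real_derivative
       1 / ?D - 2 * ((x - y) $ i)\<^sup>2 / ?D\<^sup>2) (at 0)" unfolding 2 .
  qed
  show "continuous_on UNIV (partial_deriv i (partial_deriv i (log_reg e y)))"
    unfolding 4 using e by (intro continuous_intros) auto
  \<comment> \<open>Here the dimension 2 enters: with D = |x - y|^2 + e^2 the second derivatives sum
    to 2 / D - 2 |x - y|^2 / D^2 = 2 e^2 / D^2.\<close>
  show "laplacian (log_reg e y) = (\<lambda>x. 2 * e\<^sup>2 / ((norm (x - y))\<^sup>2 + e\<^sup>2)\<^sup>2)"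
  proof
    fix x
    let ?D = "(norm (x - y))\<^sup>2 + e\<^sup>2"
    have n: "((x - y) $ 1)\<^sup>2 + ((x - y) $ 2)\<^sup>2 = (norm (x - y))\<^sup>2"
      by (simp add: norm_vec_def L2_set_def UNIV_2)
    have "laplacian (log_reg e y) x = 2 / ?D - 2 * (((x - y) $ 1)\<^sup>2 + ((x - y) $ 2)\<^sup>2) / ?D\<^sup>2"
      unfolding laplacian_def UNIV_2 4 by (simp add: add_divide_distrib distrib_left)
    also have "\<dots> = 2 * e\<^sup>2 / ?D\<^sup>2"
    proof -
      have "2 / D = 2 * D / D\<^sup>2" if "D > 0" for D :: real using that by (simp add: power2_eq_square)
      from this[OF pos[of x]] show ?thesis unfolding n by (simp add: diff_divide_distrib[symmetric])
    qed
    finally show "laplacian (log_reg e y) x = 2 * e\<^sup>2 / ?D\<^sup>2" .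
  qed
qed

lemma abs_ln_le:
  fixes r :: real assumes "r > 0" shows "\<bar>ln r\<bar> \<le> r + 1 / r"
proof -
  have "ln r \<le> r - 1" "ln (1/r) \<le> 1/r - 1" using assms by (auto intro: ln_le_minus_one)
  moreover have "ln (1/r) = - ln r" using assms by (simp add: ln_div)
  moreover have "1/r > 0" using assms by simp
  ultimately show ?thesis using assms by linarith
qed

text \<open>The right-hand side is free of e and locally integrable in the plane, so it serves as
  majorant when e tends to 0.\<close>

lemma abs_log_reg_le:
  assumes "0 < e" "e \<le> 1" "x \<noteq> y"
  shows "\<bar>log_reg e y x\<bar> \<le> 1 + norm (x - y) + 1 / norm (x - y)"
proof -
  let ?r = "norm (x - y)"
  have r: "?r > 0" using assms by simp
  have "ln (?r\<^sup>2 + e\<^sup>2) \<le> ln ((1 + ?r)\<^sup>2)"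
  proof (rule ln_mono)
    have "e\<^sup>2 \<le> 1" using assms by (simp add: power_le_one)
    thus "?r\<^sup>2 + e\<^sup>2 \<le> (1 + ?r)\<^sup>2" using norm_ge_zero[of "x - y"] by (simp add: power2_sum del: norm_ge_zero)
  qed (use r assms in \<open>auto simp: add_nonneg_pos\<close>)
  also have "ln ((1 + ?r)\<^sup>2) = 2 * ln (1 + ?r)" using r by (simp add: ln_realpow)
  also have "ln (1 + ?r) \<le> ?r" using r by (intro ln_add_one_self_le_self) auto
  finally have 1: "log_reg e y x \<le> ?r" by (simp add: log_reg_def)
  have "2 * ln ?r = ln (?r\<^sup>2)" using r by (simp add: ln_realpow)
  also have "\<dots> \<le> ln (?r\<^sup>2 + e\<^sup>2)" using r by (intro ln_mono) auto
  finally have "log_reg e y x \<ge> ln ?r" by (simp add: log_reg_def)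
  moreover have "- ln ?r \<le> ?r + 1 / ?r" using abs_ln_le[OF r] by linarith
  ultimately have 2: "log_reg e y x \<ge> - (?r + 1 / ?r)" by linarith
  have "1 / ?r > 0" using r by simp
  with 1 2 r show ?thesis by linarith
qed

text \<open>Integrate the regularised logarithm by parts and let e tend to 0. On one side the kernel
  converges under the uniform majorant; on the other the substitution x = y + e z leaves a fixed
  profile of mass 2 pi against phi (y + e z).\<close>

lemma fundamental_solution:
  fixes y :: "real ^ 2"
  assumes phi: "test_function \<phi>"
  shows "integrable lborel (\<lambda>x. ln (norm (x - y)) * laplacian \<phi> x)"
    "(\<integral>x. ln (norm (x - y)) * laplacian \<phi> x \<partial>lborel) = 2 * pi * \<phi> y"
proof -
  obtain R where R: "R > 0" "\<And>x. norm x > R \<Longrightarrow> \<phi> x = 0" "continuous_on UNIV \<phi>"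
    "continuous_on UNIV (laplacian \<phi>)" "\<And>x. norm x > R \<Longrightarrow> laplacian \<phi> x = 0"
    by (rule test_functionE[OF phi]) blast
  obtain C where C: "C \<ge> 0" "\<And>x. \<bar>laplacian \<phi> x\<bar> \<le> C"
    using continuous_cpt_supp_bounded[OF R(4,5)] by blast
  obtain C' where C': "C' \<ge> 0" "\<And>x. \<bar>\<phi> x\<bar> \<le> C'"
    using continuous_cpt_supp_bounded[OF R(3,2)] by blast
  have [measurable]: "laplacian \<phi> \<in> borel_measurable borel" "\<phi> \<in> borel_measurable borel"
    using R by (auto intro!: borel_measurable_continuous_onI)
  \<comment> \<open>The ball of radius R' about y contains the ball of radius R about 0, so the
    majorant can be centred at the singularity.\<close>
  define R' where "R' = R + norm y"
  define w where "w x = C * ((1 + R') * indicator (cball 0 R') (x + (- y)) + 1 / norm (x + (- y)) * indicator (cball 0 R') (x + (- y)))" for x :: "real^2"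
  have w_int: "integrable lborel w" unfolding w_def
    by (intro integrable_mult_right Bochner_Integration.integrable_add
         lborel_integrable_shift[of "\<lambda>x. 1 / norm x * indicator (cball 0 R') x"]
         lborel_integrable_shift[of "\<lambda>x. indicator (cball 0 R') x"] integrable_inverse_norm_cball)
       (use emeasure_lborel_cball_finite[of "0::real^2" R'] in \<open>auto intro!: integrable_real_indicator\<close>)
  have bnd: "\<bar>L * laplacian \<phi> x\<bar> \<le> w x" if "x \<noteq> y" "\<bar>L\<bar> \<le> 1 + norm (x - y) + 1 / norm (x - y)" for L x
  proof (cases "norm x > R")
    case True thus ?thesis using R(5)[of x] C(1) R(1) by (auto simp: w_def R'_def)
  next
    case False
    hence n: "norm (x - y) \<le> R'" unfolding R'_def using norm_triangle_ineq4[of x y] by linarith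
    have "\<bar>L * laplacian \<phi> x\<bar> \<le> (1 + norm (x - y) + 1 / norm (x - y)) * C"
      unfolding abs_mult using that C by (intro mult_mono) auto
    also have "\<dots> \<le> (1 + R' + 1 / norm (x - y)) * C" using n C(1) by (intro mult_right_mono) auto
    also have "\<dots> = w x" using n by (simp add: w_def algebra_simps)
    finally show ?thesis .
  qed
  have AEy: "AE x in lborel. x \<noteq> y" by (rule AE_lborel_singleton)
  show int: "integrable lborel (\<lambda>x. ln (norm (x - y)) * laplacian \<phi> x)"
  proof (rule Bochner_Integration.integrable_bound[OF w_int])
    show "AE x in lborel. norm (ln (norm (x - y)) * laplacian \<phi> x) \<le> norm (w x)"
      using AEy
    proof eventually_elim
      case (elim x)
      have "\<bar>ln (norm (x - y))\<bar> \<le> 1 + norm (x - y) + 1 / norm (x - y)"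
        using abs_ln_le[of "norm (x - y)"] elim by simp
      from bnd[OF elim this] show ?case by (simp add: abs_le_iff)
    qed
  qed measurable
  define e where "e n = 1 / (real n + 1)" for n
  have e: "e n > 0" "e n \<le> 1" for n by (auto simp: e_def)
  have e0: "e \<longlonglongrightarrow> 0" unfolding e_def[abs_def] using LIMSEQ_inverse_real_of_nat by (simp add: field_simps)
  have lim1: "(\<lambda>n. \<integral>x. log_reg (e n) y x * laplacian \<phi> x \<partial>lborel) \<longlonglongrightarrow> (\<integral>x. ln (norm (x - y)) * laplacian \<phi> x \<partial>lborel)"
  proof (rule integral_dominated_convergence[where w=w])
    show "AE x in lborel. (\<lambda>n. log_reg (e n) y x * laplacian \<phi> x) \<longlonglongrightarrow> ln (norm (x - y)) * laplacian \<phi> x"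
      using AEy
    proof eventually_elim
      case (elim x)
      have "(\<lambda>n. ln ((norm (x - y))\<^sup>2 + (e n)\<^sup>2) / 2) \<longlonglongrightarrow> ln ((norm (x - y))\<^sup>2 + 0\<^sup>2) / 2"
        using elim by (intro tendsto_intros e0) auto
      also have "ln ((norm (x - y))\<^sup>2 + 0\<^sup>2) / 2 = ln (norm (x - y))"
        using elim by (simp add: ln_realpow)
      finally show ?case unfolding log_reg_def by (intro tendsto_mult tendsto_const)
    qed
    show "AE x in lborel. norm (log_reg (e n) y x * laplacian \<phi> x) \<le> w x" for n
      using AEy by eventually_elim (simp only: real_norm_def, intro bnd abs_log_reg_le e, auto)
    show "integrable lborel w" by (rule w_int)
  qed (unfold log_reg_def, measurable)
  have eq: "(\<integral>x. log_reg (e n) y x * laplacian \<phi> x \<partial>lborel) = (\<integral>z. 2 * (1 / (1 + (norm z)\<^sup>2)\<^sup>2) * \<phi> (y + e n *\<^sub>R z) \<partial>lborel)" for n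
  proof -
    have "(\<integral>x. log_reg (e n) y x * laplacian \<phi> x \<partial>lborel) = (\<integral>x. 2 * (e n)\<^sup>2 / ((norm (x - y))\<^sup>2 + (e n)\<^sup>2)\<^sup>2 * \<phi> x \<partial>lborel)"
      using integral_laplacian_by_parts[OF phi log_reg_deriv(1,3,5)[OF e(1)]] by (simp add: log_reg_deriv(6)[OF e(1)])
    also have "\<dots> = \<bar>e n\<bar> ^ DIM(real^2) * (\<integral>z. 2 * (e n)\<^sup>2 / ((norm ((y + e n *\<^sub>R z) - y))\<^sup>2 + (e n)\<^sup>2)\<^sup>2 * \<phi> (y + e n *\<^sub>R z) \<partial>lborel)"
      using e(1)[of n] by (intro lborel_integral_affine) auto
    also have "\<dots> = (\<integral>z. \<bar>e n\<bar> ^ DIM(real^2) * (2 * (e n)\<^sup>2 / ((norm ((y + e n *\<^sub>R z) - y))\<^sup>2 + (e n)\<^sup>2)\<^sup>2 * \<phi> (y + e n *\<^sub>R z)) \<partial>lborel)"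
      by (simp only: integral_mult_right_zero)
    also have "\<dots> = (\<integral>z. 2 * (1 / (1 + (norm z)\<^sup>2)\<^sup>2) * \<phi> (y + e n *\<^sub>R z) \<partial>lborel)"
    proof (rule Bochner_Integration.integral_cong[OF refl])
      fix z :: "real^2"
      have "(norm ((y + e n *\<^sub>R z) - y))\<^sup>2 + (e n)\<^sup>2 = (e n)\<^sup>2 * (1 + (norm z)\<^sup>2)"
        by (simp add: power_mult_distrib algebra_simps)
      thus "\<bar>e n\<bar> ^ DIM(real^2) * (2 * (e n)\<^sup>2 / ((norm ((y + e n *\<^sub>R z) - y))\<^sup>2 + (e n)\<^sup>2)\<^sup>2 * \<phi> (y + e n *\<^sub>R z))
         = 2 * (1 / (1 + (norm z)\<^sup>2)\<^sup>2) * \<phi> (y + e n *\<^sub>R z)"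
        using e(1)[of n] by (simp add: power_mult_distrib) (simp add: power2_eq_square power4_eq_xxxx)
    qed
    finally show ?thesis .
  qed
  have hb: "has_bochner_integral (lborel :: (real^2) measure) (\<lambda>x. 1 / (1 + (norm x)\<^sup>2)\<^sup>2) pi"
    by (rule has_bochner_integral_inverse_one_plus_norm_sq)
  have lim2: "(\<lambda>n. \<integral>z. 2 * (1 / (1 + (norm z)\<^sup>2)\<^sup>2) * \<phi> (y + e n *\<^sub>R z) \<partial>lborel)
       \<longlonglongrightarrow> (\<integral>z. 2 * (1 / (1 + (norm z)\<^sup>2)\<^sup>2) * \<phi> y \<partial>(lborel :: (real^2) measure))"
  proof (rule integral_dominated_convergence[where w="\<lambda>z. 2 * C' * (1 / (1 + (norm z)\<^sup>2)\<^sup>2)"])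
    show "AE z in lborel. (\<lambda>n. 2 * (1 / (1 + (norm z)\<^sup>2)\<^sup>2) * \<phi> (y + e n *\<^sub>R z)) \<longlonglongrightarrow> 2 * (1 / (1 + (norm z)\<^sup>2)\<^sup>2) * \<phi> y"
    proof (rule AE_I2)
      fix z
      have "(\<lambda>n. y + e n *\<^sub>R z) \<longlonglongrightarrow> y + 0 *\<^sub>R z" by (intro tendsto_intros e0)
      hence "(\<lambda>n. \<phi> (y + e n *\<^sub>R z)) \<longlonglongrightarrow> \<phi> y"
        using R(3) isCont_tendsto_compose[of y \<phi>] by (simp add: continuous_on_eq_continuous_at)
      thus "(\<lambda>n. 2 * (1 / (1 + (norm z)\<^sup>2)\<^sup>2) * \<phi> (y + e n *\<^sub>R z)) \<longlonglongrightarrow> 2 * (1 / (1 + (norm z)\<^sup>2)\<^sup>2) * \<phi> y"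
        by (intro tendsto_mult tendsto_const)
    qed
    show "integrable lborel (\<lambda>z::real^2. 2 * C' * (1 / (1 + (norm z)\<^sup>2)\<^sup>2))"
      by (intro integrable_mult_right) (rule integrable.intros[OF hb])
    show "AE z in lborel. norm (2 * (1 / (1 + (norm z)\<^sup>2)\<^sup>2) * \<phi> (y + e n *\<^sub>R z)) \<le> 2 * C' * (1 / (1 + (norm z)\<^sup>2)\<^sup>2)" for n
    proof (rule AE_I2)
      fix z :: "real^2"
      have "norm (2 * (1 / (1 + (norm z)\<^sup>2)\<^sup>2) * \<phi> (y + e n *\<^sub>R z)) = 2 * (1 / (1 + (norm z)\<^sup>2)\<^sup>2) * \<bar>\<phi> (y + e n *\<^sub>R z)\<bar>"
        by (simp add: abs_mult)
      also have "\<dots> \<le> 2 * (1 / (1 + (norm z)\<^sup>2)\<^sup>2) * C'" by (intro mult_left_mono C') auto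
      finally show "norm (2 * (1 / (1 + (norm z)\<^sup>2)\<^sup>2) * \<phi> (y + e n *\<^sub>R z)) \<le> 2 * C' * (1 / (1 + (norm z)\<^sup>2)\<^sup>2)"
        by (simp add: mult_ac)
    qed
  qed measurable
  have "(\<integral>z. 2 * (1 / (1 + (norm z)\<^sup>2)\<^sup>2) * \<phi> y \<partial>(lborel :: (real^2) measure)) = 2 * pi * \<phi> y"
    by (simp only: integral_mult_left_zero integral_mult_right_zero has_bochner_integral_integral_eq[OF hb])
  with lim1 lim2 show "(\<integral>x. ln (norm (x - y)) * laplacian \<phi> x \<partial>lborel) = 2 * pi * \<phi> y"
    unfolding eq using LIMSEQ_unique by fastforce
qed

subsection \<open>Smooth bump functions\<close>

text \<open>Derivatives of exp (-1/s) produce powers of 1/s; carrying the exponent j as a parameter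
  makes the family closed under differentiation up to linear combinations. \<open>bump 0\<close> is
  the standard smooth function that vanishes for s <= 0.\<close>

definition bump :: "nat \<Rightarrow> real \<Rightarrow> real" where
  "bump j s = (if s > 0 then exp (- (1 / s)) / s ^ j else 0)"

lemma bump_nonneg: "bump j s \<ge> 0" by (simp add: bump_def)

lemma bump_tendsto_0: "(bump j \<longlongrightarrow> 0) (at 0)"
proof -
  have "((\<lambda>x::real. x ^ j / exp x) \<longlongrightarrow> 0) at_top" by (rule tendsto_power_div_exp_0)
  from filterlim_compose[OF this filterlim_inverse_at_top_right]
  have "((\<lambda>s::real. inverse s ^ j / exp (inverse s)) \<longlongrightarrow> 0) (at_right 0)" .
  hence "(bump j \<longlongrightarrow> 0) (at_right 0)"
    by (rule Lim_transform_eventually)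
       (auto simp: eventually_at_filter bump_def exp_minus field_simps)
  moreover have "(bump j \<longlongrightarrow> 0) (at_left 0)"
    by (rule Lim_transform_eventually[OF tendsto_const])
       (auto simp: eventually_at_filter bump_def)
  ultimately show ?thesis by (simp add: filterlim_at_split)
qed

lemma bump_DERIV: "DERIV (bump j) s :> bump (j + 2) s - real j * bump (j + 1) s"
proof -
  consider "s > 0" | "s < 0" | "s = 0" by linarith
  thus ?thesis
  proof cases
    case 1
    have "DERIV (\<lambda>s. exp (- (1 / s)) / s ^ j) s :>
       (exp (- (1 / s)) * (1 / s\<^sup>2) * s ^ j - exp (- (1 / s)) * (real j * s ^ (j - 1))) / (s ^ j * s ^ j)"
      using 1 by (auto intro!: derivative_eq_intros simp: power2_eq_square field_simps)
    also have "(exp (- (1 / s)) * (1 / s\<^sup>2) * s ^ j - exp (- (1 / s)) * (real j * s ^ (j - 1))) / (s ^ j * s ^ j)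
       = bump (j + 2) s - real j * bump (j + 1) s"
      using 1 by (cases j) (auto simp: bump_def field_simps power2_eq_square)
    finally have d: "DERIV (\<lambda>s. exp (- (1 / s)) / s ^ j) s :> bump (j + 2) s - real j * bump (j + 1) s" .
    have "\<forall>\<^sub>F x in nhds s. bump j x = exp (- (1 / x)) / x ^ j"
      using eventually_nhds_in_open[of "{0<..}" s] 1 by (auto elim!: eventually_mono simp: bump_def)
    with d show ?thesis by (subst DERIV_cong_ev[OF refl _ refl])
  next
    case 2
    have "\<forall>\<^sub>F x in nhds s. bump j x = 0"
      using eventually_nhds_in_open[of "{..<0}" s] 2 by (auto elim!: eventually_mono simp: bump_def)
    moreover have "DERIV (\<lambda>_. 0) s :> bump (j + 2) s - real j * bump (j + 1) s"
      using 2 by (simp add: bump_def)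
    ultimately show ?thesis by (subst DERIV_cong_ev[OF refl _ refl])
  next
    \<comment> \<open>At 0 the difference quotient of \<open>bump j\<close> is
      \<open>bump (j + 1)\<close>, which tends to 0.\<close>
    case 3
    have "((\<lambda>h. (bump j (0 + h) - bump j 0) / h) \<longlongrightarrow> 0) (at 0)"
      by (rule Lim_transform_eventually[OF bump_tendsto_0[of "j + 1"]])
         (auto simp: eventually_at_filter bump_def)
    thus ?thesis using 3 by (simp add: has_field_derivative_iff bump_def)
  qed
qed

lemma bump_2_DERIV: "DERIV (bump 2) s :> bump 4 s - 2 * bump 3 s"
  using bump_DERIV[of 2 s] by (simp add: eval_nat_numeral)

lemma continuous_on_bump: "continuous_on A (bump j)"
  using bump_DERIV by (meson DERIV_isCont continuous_at_imp_continuous_on)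

text \<open>Partial derivatives map this family into itself, so membership yields all orders of
  \<open>C_k\<close> by one induction. The coordinate factors come from the chain rule through |x -
  a|^2.\<close>

inductive_set bump_span :: "real ^ 'n::finite \<Rightarrow> real \<Rightarrow> (real ^ 'n \<Rightarrow> real) set"
  for a :: "real ^ 'n" and r :: real where
  base: "(\<lambda>x. bump j (1 - (norm (x - a))\<^sup>2 / r\<^sup>2)) \<in> bump_span a r"
| coord: "f \<in> bump_span a r \<Longrightarrow> (\<lambda>x. (x - a) $ i * f x) \<in> bump_span a r"
| scale: "f \<in> bump_span a r \<Longrightarrow> (\<lambda>x. c * f x) \<in> bump_span a r"
| add: "f \<in> bump_span a r \<Longrightarrow> g \<in> bump_span a r \<Longrightarrow> (\<lambda>x. f x + g x) \<in> bump_span a r"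

lemma radial_axis_deriv:
  "((\<lambda>t. 1 - (norm (x + t *\<^sub>R axis i 1 - a :: real^'n))\<^sup>2 / r\<^sup>2) has_real_derivative - (2 * ((x - a) $ i)) / r\<^sup>2) (at 0)"
  by (rule DERIV_cong[OF DERIV_diff[OF DERIV_const DERIV_cdivide[OF norm_sq_axis_deriv]]])
     (simp del: vector_minus_component)

lemma bump_span_closed:
  assumes "f \<in> bump_span a r"
  shows "f differentiable_on UNIV \<and> (\<forall>i. partial_deriv i f \<in> bump_span a r)"
  using assms
proof induction
  case (base j)
  let ?T = "\<lambda>x. 1 - (norm (x - a))\<^sup>2 / r\<^sup>2"
  have dT: "(?T has_derivative (\<lambda>h. - (2 * ((x - a) \<bullet> h) / r\<^sup>2))) (at x)" for x
    using has_derivative_diff[OF has_derivative_const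
        has_derivative_mult_left[OF norm_sq_has_derivative[where y = a and x = x], of "1 / r\<^sup>2"], of 1]
    by simp
  have 1: "(\<lambda>x. bump j (?T x)) differentiable_on UNIV"
    unfolding differentiable_on_def differentiable_def
    by (intro ballI exI) (rule DERIV_compose_FDERIV[OF bump_DERIV dT])
  have 2: "partial_deriv i (\<lambda>x. bump j (?T x)) =
     (\<lambda>x. (x - a) $ i * ((- 2 / r\<^sup>2) * bump (j + 2) (?T x) + (2 * real j / r\<^sup>2) * bump (j + 1) (?T x)))" for i
  proof (rule ext, rule partial_deriv_eqI)
    fix x
    have "((\<lambda>t. bump j (?T (x + t *\<^sub>R axis i 1))) has_real_derivative
      (bump (j + 2) (?T (x + 0 *\<^sub>R axis i 1)) - real j * bump (j + 1) (?T (x + 0 *\<^sub>R axis i 1))) * (- (2 * ((x - a) $ i)) / r\<^sup>2)) (at 0)"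
      by (rule DERIV_chain2[OF bump_DERIV radial_axis_deriv])
    also have "(bump (j + 2) (?T (x + 0 *\<^sub>R axis i 1)) - real j * bump (j + 1) (?T (x + 0 *\<^sub>R axis i 1))) * (- (2 * ((x - a) $ i)) / r\<^sup>2)
      = (x - a) $ i * ((- 2 / r\<^sup>2) * bump (j + 2) (?T x) + (2 * real j / r\<^sup>2) * bump (j + 1) (?T x))"
      by (cases "r = 0") (simp_all add: field_simps del: vector_minus_component)
    finally show "((\<lambda>t. bump j (?T (x + t *\<^sub>R axis i 1))) has_real_derivative
       (x - a) $ i * ((- 2 / r\<^sup>2) * bump (j + 2) (?T x) + (2 * real j / r\<^sup>2) * bump (j + 1) (?T x))) (at 0)" .
  qed
  show ?case unfolding 2
    by (intro conjI allI 1 bump_span.coord bump_span.add bump_span.scale bump_span.base)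
next
  case (coord f k)
  have df: "f differentiable at x" for x using coord by (auto simp: differentiable_on_def)
  have dc: "(\<lambda>x. (x - a) $ k) differentiable at x" for x
    unfolding differentiable_def
    by (rule exI, rule bounded_linear.has_derivative[OF bounded_linear_vec_nth])
       (auto intro!: derivative_eq_intros)
  have pc: "partial_deriv i (\<lambda>x. (x - a) $ k) x = (if i = k then 1 else 0)" for i x
    by (rule partial_deriv_eqI) (auto intro!: derivative_eq_intros simp: axis_def)
  have "partial_deriv i (\<lambda>x. (x - a) $ k * f x) = (\<lambda>x. (if i = k then 1 else 0) * f x + (x - a) $ k * partial_deriv i f x)" for i
    by (rule ext) (simp only: partial_deriv_mult[OF dc df] pc)
  moreover have "(\<lambda>x. (x - a) $ k * f x) differentiable_on UNIV"
    unfolding differentiable_on_def by (intro ballI differentiable_mult df dc)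
  moreover have "(\<lambda>x. (if i = k then 1 else 0) * f x + (x - a) $ k * partial_deriv i f x) \<in> bump_span a r" for i
    using coord by (intro bump_span.add bump_span.scale bump_span.coord) auto
  ultimately show ?case by (simp del: vector_minus_component)
next
  case (scale f c)
  have df: "f differentiable at x" for x using scale by (auto simp: differentiable_on_def)
  have "partial_deriv i (\<lambda>x. c * f x) = (\<lambda>x. c * partial_deriv i f x)" for i
    by (rule ext, rule partial_deriv_eqI, rule DERIV_cmult, rule partial_deriv_DERIV0, rule df)
  moreover have "(\<lambda>x. c * f x) differentiable_on UNIV"
    unfolding differentiable_on_def by (intro ballI differentiable_mult df differentiable_const)
  ultimately show ?case using scale by (auto intro!: bump_span.intros)
next
  case (add f g)
  have df: "f differentiable at x" "g differentiable at x" for x using add by (auto simp: differentiable_on_def)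
  have "partial_deriv i (\<lambda>x. f x + g x) = (\<lambda>x. partial_deriv i f x + partial_deriv i g x)" for i
    by (rule ext) (rule partial_deriv_add[OF df])
  moreover have "(\<lambda>x. f x + g x) differentiable_on UNIV"
    unfolding differentiable_on_def by (intro ballI differentiable_add df)
  ultimately show ?case using add by (auto intro!: bump_span.intros)
qed

lemma bump_span_C_k: "f \<in> bump_span a r \<Longrightarrow> C_k k f"
  by (induction k arbitrary: f)
     (use bump_span_closed in \<open>auto intro: differentiable_imp_continuous_on\<close>)

lemma test_function_bump:
  assumes r: "r > 0"
  shows "test_function (\<lambda>x. bump j (1 - (norm (x - a))\<^sup>2 / r\<^sup>2))"
  unfolding test_function_def
proof
  show "\<forall>k. C_k k (\<lambda>x. bump j (1 - (norm (x - a))\<^sup>2 / r\<^sup>2))"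
    using bump_span_C_k[OF bump_span.base] by blast
  have "norm (x - a) \<le> r" if "bump j (1 - (norm (x - a))\<^sup>2 / r\<^sup>2) \<noteq> 0" for x
  proof -
    have "(norm (x - a))\<^sup>2 < r\<^sup>2" using that r by (auto simp: bump_def field_simps split: if_splits)
    thus ?thesis using r by (simp add: power2_less_imp_less less_imp_le)
  qed
  hence "{x. bump j (1 - (norm (x - a))\<^sup>2 / r\<^sup>2) \<noteq> 0} \<subseteq> cball a r"
    by (auto simp: dist_norm norm_minus_commute)
  hence "closure {x. bump j (1 - (norm (x - a))\<^sup>2 / r\<^sup>2) \<noteq> 0} \<subseteq> cball a r"
    by (rule closure_minimal) auto
  thus "compact (closure {x. bump j (1 - (norm (x - a))\<^sup>2 / r\<^sup>2) \<noteq> 0})"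
    by (meson bounded_cball bounded_subset closed_closure compact_eq_bounded_closed)
qed

text \<open>The chain rule is applied with j = 0 and then j = 2. For j = 0 the term with factor j
  drops out, so only \<open>bump 2\<close>, \<open>bump 3\<close> and \<open>bump 4\<close> occur:
  the same three as in the derivative of the averaging kernel with respect to its radius.\<close>

lemma laplacian_bump:
  fixes a x :: "real ^ 2"
  assumes r: "r > 0"
  defines "T \<equiv> 1 - (norm (x - a))\<^sup>2 / r\<^sup>2"
  shows "laplacian (\<lambda>x. bump 0 (1 - (norm (x - a))\<^sup>2 / r\<^sup>2)) x =
    4 * (norm (x - a))\<^sup>2 / r ^ 4 * (bump 4 T - 2 * bump 3 T) - 4 / r\<^sup>2 * bump 2 T"
proof -
  let ?T = "\<lambda>x. 1 - (norm (x - a))\<^sup>2 / r\<^sup>2"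
  have 1: "partial_deriv i (\<lambda>x. bump 0 (?T x)) = (\<lambda>x. bump 2 (?T x) * (- (2 * ((x - a) $ i)) / r\<^sup>2))" for i
  proof (rule ext, rule partial_deriv_eqI)
    fix x
    have "((\<lambda>t. bump 0 (?T (x + t *\<^sub>R axis i 1))) has_real_derivative
      (bump (0 + 2) (?T (x + 0 *\<^sub>R axis i 1)) - real 0 * bump (0 + 1) (?T (x + 0 *\<^sub>R axis i 1))) * (- (2 * ((x - a) $ i)) / r\<^sup>2)) (at 0)"
      by (rule DERIV_chain2[OF bump_DERIV radial_axis_deriv])
    thus "((\<lambda>t. bump 0 (?T (x + t *\<^sub>R axis i 1))) has_real_derivative bump 2 (?T x) * (- (2 * ((x - a) $ i)) / r\<^sup>2)) (at 0)"
      by (simp add: numeral_2_eq_2 del: vector_minus_component)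
  qed
  have 2: "partial_deriv i (partial_deriv i (\<lambda>x. bump 0 (?T x))) x =
     4 * ((x - a) $ i)\<^sup>2 / r ^ 4 * (bump 4 T - 2 * bump 3 T) - 2 / r\<^sup>2 * bump 2 T" for i
  proof (rule partial_deriv_eqI)
    have d1: "((\<lambda>t. bump 2 (?T (x + t *\<^sub>R axis i 1))) has_real_derivative
      (bump 4 (?T (x + 0 *\<^sub>R axis i 1)) - 2 * bump 3 (?T (x + 0 *\<^sub>R axis i 1))) * (- (2 * ((x - a) $ i)) / r\<^sup>2)) (at 0)"
      by (rule DERIV_chain2[OF bump_2_DERIV radial_axis_deriv])
    have d2: "((\<lambda>t. - (2 * ((x + t *\<^sub>R axis i 1 - a) $ i)) / r\<^sup>2) has_real_derivative - 2 / r\<^sup>2) (at 0)"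
      using r by (auto intro!: derivative_eq_intros simp: axis_def power2_eq_square power4_eq_xxxx)
    show "((\<lambda>t. partial_deriv i (\<lambda>x. bump 0 (?T x)) (x + t *\<^sub>R axis i 1)) has_real_derivative
       4 * ((x - a) $ i)\<^sup>2 / r ^ 4 * (bump 4 T - 2 * bump 3 T) - 2 / r\<^sup>2 * bump 2 T) (at 0)"
      unfolding 1
      by (rule DERIV_cong[OF DERIV_mult[OF d1 d2]])
         (use r in \<open>simp add: T_def field_simps power2_eq_square power4_eq_xxxx del: vector_minus_component\<close>)
  qed
  have n: "(norm (x - a))\<^sup>2 = ((x - a) $ 1)\<^sup>2 + ((x - a) $ 2)\<^sup>2"
    by (simp add: norm_vec_def L2_set_def UNIV_2)
  show ?thesis
    unfolding laplacian_def UNIV_2 n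
    by (simp add: 2 add_divide_distrib distrib_left distrib_right algebra_simps del: vector_minus_component)
qed

subsection \<open>A Liouville theorem for weakly harmonic functions\<close>

lemma bump_bounded: "\<exists>L\<ge>0. \<forall>s\<le>1. bump j s \<le> L"
proof -
  have "compact (bump j ` {0..1})"
    by (intro compact_continuous_image continuous_on_bump) auto
  then obtain L where L: "\<forall>y\<in>bump j ` {0..1}. norm y \<le> L"
    using compact_imp_bounded bounded_iff by metis
  have "bump j s \<le> max L 0" if "s \<le> 1" for s
  proof (cases "s \<ge> 0")
    case True
    hence "norm (bump j s) \<le> L" using L that by auto
    thus ?thesis by auto
  qed (simp add: bump_def)
  thus ?thesis by (intro exI[of _ "max L 0"]) auto
qed

text \<open>The derivative \<open>bump 4 - 2 * bump 3\<close> is bounded for arguments at most 1, a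
  range that covers every 1 - |z|^2.\<close>

lemma bump_lipschitz: "\<exists>L\<ge>0. \<forall>s\<le>1. \<forall>t\<le>1. \<bar>bump 2 s - bump 2 t\<bar> \<le> L * \<bar>s - t\<bar>"
proof -
  obtain L4 where L4: "L4 \<ge> 0" "\<forall>s\<le>1. bump 4 s \<le> L4" using bump_bounded[of 4] by blast
  obtain L3 where L3: "L3 \<ge> 0" "\<forall>s\<le>1. bump 3 s \<le> L3" using bump_bounded[of 3] by blast
  have "\<bar>bump 2 s - bump 2 t\<bar> \<le> (L4 + 2 * L3) * \<bar>s - t\<bar>" if "s \<le> 1" "t \<le> 1" for s t
  proof -
    have "norm (bump 2 s - bump 2 t) \<le> (L4 + 2 * L3) * norm (s - t)"
    proof (rule field_differentiable_bound[of "{..1}" "bump 2" "\<lambda>x. bump 4 x - 2 * bump 3 x"])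
      show "(bump 2 has_field_derivative bump 4 x - 2 * bump 3 x) (at x within {..1})" for x
        using bump_2_DERIV[of x] by (simp add: has_field_derivative_at_within)
      show "norm (bump 4 x - 2 * bump 3 x) \<le> L4 + 2 * L3" if "x \<in> {..1}" for x
      proof -
        have "bump 4 x \<le> L4" "bump 3 x \<le> L3" using that L4 L3 by auto
        thus ?thesis using bump_nonneg[of 4 x] bump_nonneg[of 3 x] by (simp add: abs_le_iff)
      qed
    qed (use that in auto)
    thus ?thesis by simp
  qed
  thus ?thesis using L3 L4 by (intro exI[of _ "L4 + 2 * L3"]) auto
qed

text \<open>A zero integral would make the integrand vanish almost everywhere, yet it is positive on
  the open unit ball. This is the factor divided out at the end of the Liouville argument.\<close>

lemma integral_bump_pos: "(\<integral>z. bump 2 (1 - (norm z)\<^sup>2) \<partial>(lborel :: (real^2) measure)) > 0"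
proof -
  let ?f = "\<lambda>z::real^2. bump 2 (1 - (norm z)\<^sup>2)"
  have int: "integrable lborel ?f"
  proof (rule integrable_cpt_supp[where R=1])
    show "continuous_on UNIV ?f"
      by (intro continuous_on_compose2[OF continuous_on_bump[of UNIV]] continuous_intros) auto
    show "?f z = 0" if "norm z > 1" for z
      using that abs_square_less_1[of "norm z"] by (simp add: bump_def)
  qed
  have "(\<integral>z. ?f z \<partial>lborel) \<noteq> 0"
  proof
    assume "(\<integral>z. ?f z \<partial>lborel) = 0"
    hence "AE z in lborel. ?f z = 0"
      using integral_nonneg_eq_0_iff_AE[OF int] bump_nonneg by auto
    hence "AE z in lborel. z \<notin> ball (0::real^2) 1"
    proof eventually_elim
      case (elim z)
      have "\<not> (norm z)\<^sup>2 < 1" using elim by (auto simp: bump_def split: if_splits)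
      thus ?case by (metis abs_norm_cancel abs_square_less_1 mem_ball_0)
    qed
    hence "ball (0::real^2) 1 \<in> null_sets lborel" by (subst AE_iff_null_sets) auto
    hence "negligible (ball (0::real^2) 1)"
      by (simp add: negligible_iff_null_sets null_sets_completionI)
    thus False using open_not_negligible[of "ball (0::real^2) 1"] by simp
  qed
  moreover have "(\<integral>z. ?f z \<partial>lborel) \<ge> 0" by (intro Bochner_Integration.integral_nonneg bump_nonneg)
  ultimately show ?thesis by simp
qed

text \<open>The derivative in \<open>s\<close> of the averaging kernel is \<open>1 / (2 s)\<close> times the Laplacian of the test
  function \<open>bump 0 (1 - |x - a|\<^sup>2 / s\<^sup>2)\<close>.\<close>

lemma bump_mean_DERIV:
  fixes w :: "real ^ 2 \<Rightarrow> real"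
  assumes w: "continuous_on UNIV w"
    and harm: "\<And>\<phi>. test_function \<phi> \<Longrightarrow> (\<integral>x. w x * laplacian \<phi> x \<partial>lborel) = 0"
    and s: "s > 0"
  shows "DERIV (\<lambda>s. \<integral>x. w x * (bump 2 (1 - (norm (x - a))\<^sup>2 / s\<^sup>2) / s\<^sup>2) \<partial>lborel) s :> 0"
proof -
  \<comment> \<open>All radii below S share one box containing \<open>cball a S\<close>, so the
    derivative can be taken under an integral over a fixed domain.\<close>
  define S where "S = s + 1"
  define U where "U = {0<..<S}"
  obtain v where v: "cball a S \<subseteq> cbox (-v) v"
    using bounded_subset_cbox_symmetric[OF bounded_cball] by blast
  define f where "f s x = w x * (bump 2 (1 - (norm (x - a))\<^sup>2 / s\<^sup>2) / s\<^sup>2)" for s and x :: "real^2"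
  define f' where "f' s x = w x * (((bump 4 (1 - (norm (x - a))\<^sup>2 / s\<^sup>2) - 2 * bump 3 (1 - (norm (x - a))\<^sup>2 / s\<^sup>2)) * (2 * (norm (x - a))\<^sup>2 / s ^ 3)) / s\<^sup>2
     - 2 * bump 2 (1 - (norm (x - a))\<^sup>2 / s\<^sup>2) / s ^ 3)" for s and x :: "real^2"
  have cf: "continuous_on UNIV (f s)" if "s > 0" for s
    unfolding f_def using that
    by (intro continuous_intros w continuous_on_compose2[OF continuous_on_bump[of UNIV]]) auto
  have z: "bump j (1 - (norm (x - a))\<^sup>2 / s\<^sup>2) = 0" if "s \<in> U" "x \<notin> cbox (-v) v" for s x j
  proof -
    have "x \<notin> cball a S" using that v by blast
    hence "norm (x - a) > s" using that by (auto simp: U_def dist_norm norm_minus_commute)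
    hence "(norm (x - a))\<^sup>2 > s\<^sup>2" using that by (intro power_strict_mono) (auto simp: U_def)
    thus ?thesis using that by (simp add: bump_def U_def field_simps)
  qed
  have intbox: "integral (cbox (-v) v) g = (\<integral>x. g x \<partial>lborel)"
    if "continuous_on UNIV g" "\<And>x. x \<notin> cbox (-v) v \<Longrightarrow> g x = 0" for g :: "real^2 \<Rightarrow> real"
  proof -
    obtain R where R: "\<And>x. x \<in> cbox (-v) v \<Longrightarrow> norm x \<le> R" using bounded_cbox[of "-v" v] by (auto simp: bounded_iff)
    have "integrable lborel g"
      by (rule integrable_cpt_supp[OF that(1), of R]) (use that(2) R in force)
    hence "integral UNIV g = (\<integral>x. g x \<partial>lborel)" by (rule integral_lborel)
    moreover have "integral UNIV g = integral UNIV (\<lambda>x. if x \<in> cbox (-v) v then g x else 0)"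
      by (rule arg_cong[where f="integral UNIV"]) (use that(2) in auto)
    ultimately show ?thesis by (simp only: integral_restrict_UNIV)
  qed
  have cf': "continuous_on (U \<times> cbox (-v) v) (\<lambda>(s, x). f' s x)"
    unfolding f'_def split_beta
    by (intro continuous_intros continuous_on_compose2[OF w] continuous_on_compose2[OF continuous_on_bump[of UNIV]])
       (auto simp: U_def)
  have d: "DERIV (\<lambda>s. f s x) s :> f' s x" if "s > 0" for s x
  proof -
    have d1: "DERIV (\<lambda>s. 1 - (norm (x - a))\<^sup>2 / s\<^sup>2) s :> 2 * (norm (x - a))\<^sup>2 / s ^ 3"
      using that by (auto intro!: derivative_eq_intros simp: field_simps power2_eq_square power3_eq_cube)
    have d3: "DERIV (\<lambda>s. s\<^sup>2) s :> 2 * s" by (auto intro!: derivative_eq_intros)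
    have s2: "s\<^sup>2 \<noteq> 0" using that by simp
    have alg: "(A * s\<^sup>2 - B * (2 * s)) / (s\<^sup>2 * s\<^sup>2) = A / s\<^sup>2 - 2 * B / s ^ 3"
              "(A * s\<^sup>2 - 2 * s * B) / (s\<^sup>2 * s\<^sup>2) = A / s\<^sup>2 - 2 * B / s ^ 3" for A B :: real
      using that by (simp_all add: field_simps eval_nat_numeral)
    show ?thesis unfolding f_def f'_def
      by (rule DERIV_cong[OF DERIV_cmult[OF DERIV_divide[OF DERIV_chain2[OF bump_2_DERIV d1] d3 s2]]])
         (simp only: alg)
  qed
  have atU: "at s within U = at s" by (rule at_within_open) (use s in \<open>auto simp: U_def S_def\<close>)
  have "((\<lambda>s. integral (cbox (-v) v) (f s)) has_field_derivative integral (cbox (-v) v) (f' s)) (at s within U)"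
  proof (rule leibniz_rule_field_derivative[OF _ _ cf'])
    show "((\<lambda>s. f s x) has_field_derivative f' s x) (at s within U)" if "s \<in> U" for s x
      using d that by (auto simp: U_def intro: has_field_derivative_at_within)
    show "f s integrable_on cbox (-v) v" if "s \<in> U" for s
      using cf[of s] that by (intro integrable_continuous) (auto simp: U_def intro: continuous_on_subset)
  qed (use s in \<open>auto simp: U_def S_def\<close>)
  moreover have "integral (cbox (-v) v) (f' s) = 0"
  proof -
    have sU: "s \<in> U" using s by (simp add: U_def S_def)
    have "continuous_on UNIV (f' s)" unfolding f'_def using s
      by (intro continuous_intros w continuous_on_compose2[OF continuous_on_bump[of UNIV]]) auto
    hence "integral (cbox (-v) v) (f' s) = (\<integral>x. f' s x \<partial>lborel)"
      by (rule intbox) (simp add: f'_def z[OF sU])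
    also have "\<dots> = (\<integral>x. (1 / (2 * s)) * (w x * laplacian (\<lambda>x. bump 0 (1 - (norm (x - a))\<^sup>2 / s\<^sup>2)) x) \<partial>lborel)"
    proof -
      have alg: "W * (P * (2 * n / s ^ 3) / s\<^sup>2 - 2 * B / s ^ 3) = 1 / (2 * s) * (W * (4 * n / s ^ 4 * P - 4 / s\<^sup>2 * B))"
        for W P n B :: real
        using s by (simp add: field_simps eval_nat_numeral)
      show ?thesis unfolding laplacian_bump[OF s] f'_def by (simp only: alg)
    qed
    also have "\<dots> = 0"
      using harm[OF test_function_bump[OF s]] by (simp only: integral_mult_right_zero mult_zero_right)
    finally show ?thesis .
  qed
  ultimately have "((\<lambda>s. integral (cbox (-v) v) (f s)) has_field_derivative 0) (at s)"
    by (simp only: atU)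
  moreover have "\<forall>\<^sub>F r in nhds s. integral (cbox (-v) v) (f r) = (\<integral>x. f r x \<partial>lborel)"
  proof -
    have "\<forall>\<^sub>F r in nhds s. r \<in> U"
      using s by (intro eventually_nhds_in_open) (auto simp: U_def S_def)
    thus ?thesis
    proof eventually_elim
      case (elim r)
      show ?case using elim by (intro intbox cf) (auto simp: U_def[symmetric] f_def z, auto simp: U_def)
    qed
  qed
  ultimately have "((\<lambda>s. \<integral>x. f s x \<partial>lborel) has_field_derivative 0) (at s)"
    by (subst (asm) DERIV_cong_ev[OF refl _ refl]) auto
  thus ?thesis unfolding f_def .
qed

text \<open>The average of w against a rescaled bump does not depend on the radius. Small radii give
  a multiple of w a. At a large radius R the rescaled kernels centred at a and at 0 differ by O(1 /
  R), while |w| = O(sqrt R) on their supports, so the averages around a and 0 agree in the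
  limit.\<close>

theorem weak_Liouville:
  fixes w :: "real ^ 2 \<Rightarrow> real"
  assumes w: "continuous_on UNIV w"
    and harm: "\<And>\<phi>. test_function \<phi> \<Longrightarrow> (\<integral>x. w x * laplacian \<phi> x \<partial>lborel) = 0"
    and growth: "\<And>x. \<bar>w x\<bar> \<le> A * sqrt (1 + norm x)"
  shows "w a = w 0"
proof -
  have [measurable]: "w \<in> borel_measurable borel" "bump j \<in> borel_measurable borel" for j
    using w continuous_on_bump[of UNIV j] by (auto intro: borel_measurable_continuous_onI)
  define m where "m a s = (\<integral>x. w x * (bump 2 (1 - (norm (x - a))\<^sup>2 / s\<^sup>2) / s\<^sup>2) \<partial>lborel)" for a s
  define I where "I = (\<integral>z. bump 2 (1 - (norm z)\<^sup>2) \<partial>(lborel :: (real^2) measure))"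
  have mconst: "m a s = m a t" if "s > 0" "t > 0" for a s t
  proof -
    have "\<exists>c. \<forall>s\<in>{0<..}. m a s = c"
    proof (rule has_field_derivative_zero_constant)
      show "(m a has_field_derivative 0) (at s within {0<..})" if "s \<in> {0<..}" for s
        using bump_mean_DERIV[OF w harm, of s a] that unfolding m_def
        by (auto intro: has_field_derivative_at_within)
    qed auto
    thus ?thesis using that by auto
  qed
  have A0: "A \<ge> 0" using growth[of 0] by simp
  \<comment> \<open>The free centre c serves twice: c = a for the limit of small radii, c = 0 for
    comparing the averages around a and around 0 with w evaluated at the same points.\<close>
  have m_scale: "m a s = (\<integral>z. w (c + s *\<^sub>R z) * bump 2 (1 - (norm (z + (1/s) *\<^sub>R (c - a)))\<^sup>2) \<partial>lborel)" if "s > 0" for a s c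
  proof -
    have "m a s = \<bar>s\<bar> ^ DIM(real^2) * (\<integral>z. w (c + s *\<^sub>R z) * (bump 2 (1 - (norm ((c + s *\<^sub>R z) - a))\<^sup>2 / s\<^sup>2) / s\<^sup>2) \<partial>lborel)"
      unfolding m_def using that by (intro lborel_integral_affine) auto
    also have "\<dots> = (\<integral>z. \<bar>s\<bar> ^ DIM(real^2) * (w (c + s *\<^sub>R z) * (bump 2 (1 - (norm ((c + s *\<^sub>R z) - a))\<^sup>2 / s\<^sup>2) / s\<^sup>2)) \<partial>lborel)"
      by (simp only: integral_mult_right_zero)
    also have "\<dots> = (\<integral>z. w (c + s *\<^sub>R z) * bump 2 (1 - (norm (z + (1/s) *\<^sub>R (c - a)))\<^sup>2) \<partial>lborel)"
    proof (rule Bochner_Integration.integral_cong[OF refl])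
      fix z
      have "(c + s *\<^sub>R z) - a = s *\<^sub>R (z + (1/s) *\<^sub>R (c - a))" using that by (simp add: algebra_simps)
      hence "(norm ((c + s *\<^sub>R z) - a))\<^sup>2 / s\<^sup>2 = (norm (z + (1/s) *\<^sub>R (c - a)))\<^sup>2"
        using that by (simp only: norm_scaleR power_mult_distrib) simp
      thus "\<bar>s\<bar> ^ DIM(real^2) * (w (c + s *\<^sub>R z) * (bump 2 (1 - (norm ((c + s *\<^sub>R z) - a))\<^sup>2 / s\<^sup>2) / s\<^sup>2))
         = w (c + s *\<^sub>R z) * bump 2 (1 - (norm (z + (1/s) *\<^sub>R (c - a)))\<^sup>2)"
        using that by simp
    qed
    finally show ?thesis .
  qed
  have bsupp: "bump j (1 - (norm z)\<^sup>2) = 0" if "norm z \<ge> 1" for z :: "real^2" and j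
    using that abs_square_less_1[of "norm z"] by (simp add: bump_def)
  obtain B where B: "B \<ge> 0" "\<And>s. s \<le> 1 \<Longrightarrow> bump 2 s \<le> B" using bump_bounded[of 2] by blast
  \<comment> \<open>The averages over radii e n tend to w a times I, and independence of the radius
    identifies the limit with the average at radius 1.\<close>
  have wI: "w a * I = m a 1" for a
  proof -
    define e where "e n = 1 / (real n + 1)" for n
    have e: "e n > 0" "e n \<le> 1" for n by (auto simp: e_def)
    have e0: "e \<longlonglongrightarrow> 0" unfolding e_def[abs_def] using LIMSEQ_inverse_real_of_nat by (simp add: field_simps)
    have "(\<lambda>n. \<integral>z. w (a + e n *\<^sub>R z) * bump 2 (1 - (norm z)\<^sup>2) \<partial>lborel) \<longlonglongrightarrow> (\<integral>z. w a * bump 2 (1 - (norm z)\<^sup>2) \<partial>(lborel :: (real^2) measure))"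
    proof (rule integral_dominated_convergence[where w="\<lambda>z. A * sqrt (2 + norm a) * B * indicator (cball 0 1) z"])
      show "integrable lborel (\<lambda>z::real^2. A * sqrt (2 + norm a) * B * indicator (cball 0 1) z)"
        using emeasure_lborel_cball_finite[of "0::real^2" 1] by (intro integrable_mult_right integrable_real_indicator) auto
      show "AE z in lborel. (\<lambda>n. w (a + e n *\<^sub>R z) * bump 2 (1 - (norm z)\<^sup>2)) \<longlonglongrightarrow> w a * bump 2 (1 - (norm z)\<^sup>2)"
      proof (rule AE_I2)
        fix z
        have "(\<lambda>n. a + e n *\<^sub>R z) \<longlonglongrightarrow> a + 0 *\<^sub>R z" by (intro tendsto_intros e0)
        hence "(\<lambda>n. w (a + e n *\<^sub>R z)) \<longlonglongrightarrow> w a"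
          using w isCont_tendsto_compose[of a w] by (simp add: continuous_on_eq_continuous_at)
        thus "(\<lambda>n. w (a + e n *\<^sub>R z) * bump 2 (1 - (norm z)\<^sup>2)) \<longlonglongrightarrow> w a * bump 2 (1 - (norm z)\<^sup>2)"
          by (intro tendsto_mult tendsto_const)
      qed
      show "AE z in lborel. norm (w (a + e n *\<^sub>R z) * bump 2 (1 - (norm z)\<^sup>2)) \<le> A * sqrt (2 + norm a) * B * indicator (cball 0 1) z" for n
      proof (rule AE_I2)
        fix z :: "real^2"
        show "norm (w (a + e n *\<^sub>R z) * bump 2 (1 - (norm z)\<^sup>2)) \<le> A * sqrt (2 + norm a) * B * indicator (cball 0 1) z"
        proof (cases "norm z \<le> 1")
          case True
          have "norm (e n *\<^sub>R z) \<le> 1" using e[of n] True by (simp add: mult_le_one)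
          hence "norm (a + e n *\<^sub>R z) \<le> norm a + 1" using norm_triangle_ineq[of a "e n *\<^sub>R z"] by linarith
          hence "A * sqrt (1 + norm (a + e n *\<^sub>R z)) \<le> A * sqrt (2 + norm a)" by (intro mult_left_mono A0) auto
          hence "\<bar>w (a + e n *\<^sub>R z)\<bar> \<le> A * sqrt (2 + norm a)" using growth order_trans by blast
          moreover have "\<bar>bump 2 (1 - (norm z)\<^sup>2)\<bar> \<le> B" using B(2)[of "1 - (norm z)\<^sup>2"] bump_nonneg[of 2 "1 - (norm z)\<^sup>2"] by simp
          ultimately show ?thesis using True A0 by (auto simp: abs_mult intro!: mult_mono)
        next
          case False thus ?thesis using bsupp[of z 2] by simp
        qed
      qed
    qed measurable
    moreover have "(\<integral>z. w (a + e n *\<^sub>R z) * bump 2 (1 - (norm z)\<^sup>2) \<partial>lborel) = m a 1" for n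
      using m_scale[OF e(1), of a n a] mconst[of "e n" 1 a] e(1)[of n] by simp
    ultimately have "m a 1 = (\<integral>z. w a * bump 2 (1 - (norm z)\<^sup>2) \<partial>(lborel :: (real^2) measure))"
      by (simp add: LIMSEQ_const_iff)
    also have "\<dots> = w a * I" by (simp add: I_def)
    finally show ?thesis by simp
  qed
  obtain L where L: "L \<ge> 0" "\<And>s t. s \<le> 1 \<Longrightarrow> t \<le> 1 \<Longrightarrow> \<bar>bump 2 s - bump 2 t\<bar> \<le> L * \<bar>s - t\<bar>"
    using bump_lipschitz by blast
  define V where "V = measure lborel (cball (0::real^2) 2)"
  \<comment> \<open>After rescaling the centres are a / R and 0 with |a| / R <= 1, so both kernels
    vanish for |z| > 2. For |z| <= 2 the bound |R z| <= 2 R gives sqrt (1 + 2 R), and the 5 is |z| +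
    |z - a / R| <= 2 + 3 from the difference of squares.\<close>
  have est: "\<bar>m a R - m 0 R\<bar> \<le> A * sqrt (1 + 2 * R) * (L * (5 * norm a / R)) * V" if R: "R \<ge> 1" "R \<ge> norm a" for R
  proof -
    let ?b = "\<lambda>c z. bump 2 (1 - (norm (z - c))\<^sup>2)"
    have c: "norm ((1/R) *\<^sub>R a) = norm a / R" "norm a / R \<le> 1" using R by auto
    have pt: "\<bar>w (R *\<^sub>R z) * ?b ((1/R) *\<^sub>R a) z - w (R *\<^sub>R z) * ?b 0 z\<bar>
        \<le> A * sqrt (1 + 2 * R) * (L * (5 * norm a / R)) * indicator (cball 0 2) z" for z :: "real^2"
    proof (cases "norm z \<le> 2")
      case True
      have "norm (R *\<^sub>R z) \<le> 2 * R" using True R by simp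
      hence "A * sqrt (1 + norm (R *\<^sub>R z)) \<le> A * sqrt (1 + 2 * R)" by (intro mult_left_mono A0) auto
      hence 1: "\<bar>w (R *\<^sub>R z)\<bar> \<le> A * sqrt (1 + 2 * R)" using growth order_trans by blast
      have 3: "\<bar>?b ((1/R) *\<^sub>R a) z - ?b 0 z\<bar> \<le> L * \<bar>(1 - (norm (z - (1/R) *\<^sub>R a))\<^sup>2) - (1 - (norm (z - 0))\<^sup>2)\<bar>"
        by (rule L(2)) auto
      have "\<bar>(1 - (norm (z - (1/R) *\<^sub>R a))\<^sup>2) - (1 - (norm (z - 0))\<^sup>2)\<bar>
        = \<bar>norm z - norm (z - (1/R) *\<^sub>R a)\<bar> * \<bar>norm z + norm (z - (1/R) *\<^sub>R a)\<bar>"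
      proof -
        have "\<bar>(1 - q\<^sup>2) - (1 - p\<^sup>2)\<bar> = \<bar>p - q\<bar> * \<bar>p + q\<bar>" for p q :: real
          by (simp add: abs_mult[symmetric] power2_eq_square square_diff_square_factored mult.commute)
        from this[of "norm (z - (1/R) *\<^sub>R a)" "norm z"] show ?thesis by simp
      qed
      also have "\<dots> \<le> (norm a / R) * 5"
      proof (rule mult_mono)
        show "\<bar>norm z - norm (z - (1/R) *\<^sub>R a)\<bar> \<le> norm a / R"
        proof -
          have "z - (z - (1/R) *\<^sub>R a) = (1/R) *\<^sub>R a" by simp
          thus ?thesis using norm_triangle_ineq3[of z "z - (1/R) *\<^sub>R a"] c(1) by metis
        qed
        show "\<bar>norm z + norm (z - (1/R) *\<^sub>R a)\<bar> \<le> 5"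
        proof -
          have "norm z + norm (z - (1/R) *\<^sub>R a) \<le> 5"
            using norm_triangle_ineq4[of z "(1/R) *\<^sub>R a"] c True by linarith
          thus ?thesis by (simp only: abs_of_nonneg[OF add_nonneg_nonneg[OF norm_ge_zero norm_ge_zero]])
        qed
      qed (use R in auto)
      also have "(norm a / R) * 5 = 5 * norm a / R" by simp
      finally have "\<bar>(1 - (norm (z - (1/R) *\<^sub>R a))\<^sup>2) - (1 - (norm (z - 0))\<^sup>2)\<bar> \<le> 5 * norm a / R" .
      from order_trans[OF 3 mult_left_mono[OF this L(1)]]
      have 2: "\<bar>?b ((1/R) *\<^sub>R a) z - ?b 0 z\<bar> \<le> L * (5 * norm a / R)" .
      have "\<bar>w (R *\<^sub>R z) * ?b ((1/R) *\<^sub>R a) z - w (R *\<^sub>R z) * ?b 0 z\<bar> = \<bar>w (R *\<^sub>R z)\<bar> * \<bar>?b ((1/R) *\<^sub>R a) z - ?b 0 z\<bar>"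
        by (simp add: abs_mult[symmetric] algebra_simps)
      also have "\<dots> \<le> (A * sqrt (1 + 2 * R)) * (L * (5 * norm a / R))"
        using A0 R by (intro mult_mono 1 2) auto
      finally show ?thesis using True by simp
    next
      case False
      have "norm (z - (1/R) *\<^sub>R a) \<ge> 1" using norm_triangle_ineq2[of z "(1/R) *\<^sub>R a"] c False by linarith
      thus ?thesis using bsupp[of "z - (1/R) *\<^sub>R a" 2] bsupp[of z 2] False by simp
    qed
    have Ii: "integrable lborel (\<lambda>z::real^2. A * sqrt (1 + 2 * R) * (L * (5 * norm a / R)) * indicator (cball 0 2) z)"
      using emeasure_lborel_cball_finite[of "0::real^2" 2] by (intro integrable_mult_right integrable_real_indicator) auto
    have ci: "integrable lborel (\<lambda>z. w (R *\<^sub>R z) * ?b c z)" if "norm c \<le> 1" for c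
    proof (rule integrable_cpt_supp[where R=2])
      show "continuous_on UNIV (\<lambda>z. w (R *\<^sub>R z) * ?b c z)"
        by (intro continuous_intros continuous_on_compose2[OF w] continuous_on_compose2[OF continuous_on_bump[of UNIV]]) auto
      show "w (R *\<^sub>R z) * ?b c z = 0" if "norm z > 2" for z
        using bsupp[of "z - c" 2] norm_triangle_ineq2[of z c] that \<open>norm c \<le> 1\<close> by simp
    qed
    have "m a R - m 0 R = (\<integral>z. w (R *\<^sub>R z) * ?b ((1/R) *\<^sub>R a) z \<partial>lborel) - (\<integral>z. w (R *\<^sub>R z) * ?b 0 z \<partial>lborel)"
      using m_scale[of R a 0] m_scale[of R 0 0] R by simp
    also have "\<dots> = (\<integral>z. w (R *\<^sub>R z) * ?b ((1/R) *\<^sub>R a) z - w (R *\<^sub>R z) * ?b 0 z \<partial>lborel)"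
      using ci[of "(1/R) *\<^sub>R a"] ci[of 0] c by (intro Bochner_Integration.integral_diff[symmetric]) auto
    finally have "\<bar>m a R - m 0 R\<bar> \<le> (\<integral>z. A * sqrt (1 + 2 * R) * (L * (5 * norm a / R)) * indicator (cball 0 2) z \<partial>(lborel::(real^2) measure))"
      using Bochner_Integration.integral_abs_bound_integral[OF _ Ii, of "\<lambda>z. w (R *\<^sub>R z) * ?b ((1/R) *\<^sub>R a) z - w (R *\<^sub>R z) * ?b 0 z"]
        ci[of "(1/R) *\<^sub>R a"] ci[of 0] c pt by auto
    also have "\<dots> = A * sqrt (1 + 2 * R) * (L * (5 * norm a / R)) * V"
      by (subst integral_mult_right_zero) (simp add: V_def)
    finally show ?thesis .
  qed
  define K where "K = A * L * 5 * norm a * V"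
  have est2: "\<bar>w a * I - w 0 * I\<bar> \<le> K * (sqrt (1 + 2 * R) / R)" if "R \<ge> 1" "R \<ge> norm a" for R
  proof -
    have "w a * I - w 0 * I = m a R - m 0 R"
      using mconst[of R 1 a] mconst[of R 1 0] that by (simp add: wI)
    moreover have "A * sqrt (1 + 2 * R) * (L * (5 * norm a / R)) * V = K * (sqrt (1 + 2 * R) / R)"
      by (simp add: K_def)
    ultimately show ?thesis using est[OF that] by (simp only:)
  qed
  have "((\<lambda>R::real. K * sqrt (inverse R * inverse R + 2 * inverse R)) \<longlongrightarrow> K * sqrt (0 * 0 + 2 * 0)) at_top"
    by (intro tendsto_intros tendsto_inverse_0_at_top filterlim_ident)
  moreover have "\<forall>\<^sub>F R::real in at_top. \<bar>w a * I - w 0 * I\<bar> \<le> K * sqrt (inverse R * inverse R + 2 * inverse R)"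
    using eventually_ge_at_top[of "max 1 (norm a)"]
  proof eventually_elim
    case (elim R)
    have "sqrt (1 + 2 * R) / R = sqrt ((1 + 2 * R) / R\<^sup>2)" using elim by (simp add: real_sqrt_divide)
    also have "(1 + 2 * R) / R\<^sup>2 = inverse R * inverse R + 2 * inverse R"
      using elim by (simp add: field_simps power2_eq_square)
    finally show ?case using est2[of R] elim by simp
  qed
  ultimately have "\<bar>w a * I - w 0 * I\<bar> \<le> K * sqrt (0 * 0 + 2 * 0)"
    by (intro tendsto_lowerbound) auto
  hence "w a * I = w 0 * I" by simp
  thus ?thesis using integral_bump_pos by (simp add: I_def)
qed

subsection \<open>Logarithmic potentials\<close>

lemma ln_le_powr: "ln t \<le> t powr s / s" if "t > 0" "s > 0" for t s :: real
proof -
  have "s * ln t = ln (t powr s)" using that by (simp add: ln_powr)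
  also have "\<dots> \<le> t powr s - 1" using that by (intro ln_le_minus_one) simp
  finally show ?thesis using that by (simp add: field_simps)
qed

text \<open>Unlike the bound that \<open>ln_le_powr\<close> gives at 1 + t, this one vanishes at t =
  0. It rests on the subadditivity (1 + t)^g <= 1 + t^g for g <= 1.\<close>

lemma ln_add_one_le_powr: "ln (1 + t) \<le> t powr g / g" if t: "t \<ge> 0" and g: "0 < g" "g \<le> 1" for t g :: real
proof -
  have "(1 + t) powr g \<le> 1 + t powr g"
  proof (cases "t = 0")
    case False
    have "(1 + t) powr g = (1 + t) * (1 + t) powr (g - 1)"
      using t by (simp add: powr_mult_base)
    also have "\<dots> = (1 + t) powr (g - 1) + t * (1 + t) powr (g - 1)" by (simp add: distrib_right)
    finally have 1: "(1 + t) powr g = (1 + t) powr (g - 1) + t * (1 + t) powr (g - 1)" .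
    have 2: "(1 + t) powr (g - 1) \<le> 1 powr (g - 1)" using t g by (intro powr_mono2') auto
    have "t * (1 + t) powr (g - 1) \<le> t * t powr (g - 1)"
      using t g False by (intro mult_left_mono powr_mono2') auto
    also have "t * t powr (g - 1) = t powr g" using t False by (simp add: powr_diff)
    finally show ?thesis using 1 2 by simp
  qed (use g in simp)
  hence "ln ((1 + t) powr g) \<le> ln (1 + t powr g)" using t by (intro ln_mono) (auto simp: add_pos_nonneg)
  also have "\<dots> \<le> t powr g" by (rule ln_add_one_self_le_self) simp
  finally have "g * ln (1 + t) \<le> t powr g" using t by (simp add: ln_powr)
  thus ?thesis using g by (simp add: field_simps)
qed

text \<open>Young's inequality up to constants: if b <= a^(p-1) the product is at most a^p, and
  otherwise a <= b^(1/(p-1)) bounds it by b^(p/(p-1)).\<close>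

lemma Young_simple:
  fixes a b p :: real
  assumes "a \<ge> 0" "b \<ge> 0" "p > 1"
  shows "a * b \<le> a powr p + b powr (p / (p - 1))"
proof (cases "a = 0 \<or> b = 0")
  case True thus ?thesis by auto
next
  case False
  hence ab: "a > 0" "b > 0" using assms by auto
  show ?thesis
  proof (cases "b \<le> a powr (p - 1)")
    case True
    hence "a * b \<le> a * a powr (p - 1)" using ab by (intro mult_left_mono) auto
    also have "\<dots> = a powr p" using ab by (simp add: powr_diff)
    finally show ?thesis by (simp add: add_increasing2)
  next
    case F: False
    have "a = (a powr (p - 1)) powr (1 / (p - 1))" using ab assms by (simp add: powr_powr)
    also have "\<dots> \<le> b powr (1 / (p - 1))" using F ab assms by (intro powr_mono2) auto
    finally have "a * b \<le> b powr (1 / (p - 1)) * b" using ab by (intro mult_right_mono) auto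
    also have "\<dots> = b powr (1 / (p - 1) + 1)" using ab by (simp add: powr_add)
    also have "1 / (p - 1) + 1 = p / (p - 1)" using assms by (simp add: field_simps)
    finally show ?thesis by (simp add: add_increasing)
  qed
qed

text \<open>The two integrability conditions control the two ends of the logarithm: the moment of
  order g its growth at infinity, the weighted L^p bound its singularity. The sign of q is free, so
  the weight may decay.\<close>

locale log_density =
  fixes f :: "real ^ 2 \<Rightarrow> real" and g p q :: real
  assumes f_meas [measurable]: "f \<in> borel_measurable borel"
    and f_nonneg: "\<And>x. f x \<ge> 0"
    and g: "0 < g" "g \<le> 1" and p: "p > 1"
    and int_g: "integrable lborel (\<lambda>y. f y * (1 + norm y) powr g)"
    and int_p: "integrable lborel (\<lambda>y. f y powr p * (1 + norm y) powr q)"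
begin

text \<open>The reciprocal of the exponent conjugate to p. With this choice Young's inequality turns
  |x - y|^(-s) f into f^p plus |x - y|^(-1), and the latter is integrable near x in the
  plane.\<close>

definition s :: real where "s = (p - 1) / p"
definition near :: "real ^ 2 \<Rightarrow> real ^ 2 \<Rightarrow> real" where
  "near x y = norm (x - y) powr (- s) * indicator (cball 0 1) (x - y)"
definition mass :: real where "mass = (\<integral>y. f y \<partial>lborel)"
definition pot :: "real ^ 2 \<Rightarrow> real" where "pot x = (\<integral>y. ln (norm (x - y)) * f y \<partial>lborel)"

lemma s: "0 < s" "s < 1" using p by (auto simp: s_def field_simps)

lemma near_nonneg: "near x y \<ge> 0" by (simp add: near_def)

lemma near_meas [measurable]: "(\<lambda>y. near x y) \<in> borel_measurable borel"
proof -
  have eq: "(\<lambda>y. indicator (cball 0 1) (x - y) :: real) = indicator (cball x 1)"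
    by (auto simp: fun_eq_iff indicator_def dist_norm norm_minus_commute)
  show ?thesis unfolding near_def by (intro borel_measurable_times) (simp_all add: eq borel_measurable_indicator)
qed

lemma weight_ge_1: "(1 + norm (y :: real^2)) powr g \<ge> 1"
  using g by (intro ge_one_powr_ge_zero) auto

lemma int_f: "integrable lborel f"
proof (rule Bochner_Integration.integrable_bound[OF int_g])
  show "AE x in lborel. norm (f x) \<le> norm (f x * (1 + norm x) powr g)"
  proof (rule AE_I2)
    fix x
    have "f x * 1 \<le> f x * (1 + norm x) powr g" by (intro mult_left_mono weight_ge_1 f_nonneg)
    thus "norm (f x) \<le> norm (f x * (1 + norm x) powr g)" using f_nonneg[of x] by (simp add: abs_mult)
  qed
qed measurable

lemma mass_nonneg: "mass \<ge> 0"
  unfolding mass_def by (intro Bochner_Integration.integral_nonneg f_nonneg)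

text \<open>On |x - y| <= 1 the weight at y can be removed at the price of the factor (2 + |x|)^|q|.
  The resulting polynomial growth in x is later compensated by a small coefficient in front of
  \<open>near\<close>.\<close>

lemma near_int:
  "integrable lborel (\<lambda>y. near x y * f y)"
  "\<exists>C\<ge>0. \<forall>x. (\<integral>y. near x y * f y \<partial>lborel) \<le> C * (2 + norm x) powr \<bar>q\<bar>"
proof -
  define F where "F y = f y powr p * (1 + norm y) powr q" for y
  define G where "G z = 1 / norm z * indicator (cball 0 1) z" for z :: "real^2"
  have F0: "F y \<ge> 0" for y by (simp add: F_def)
  have iF: "integrable lborel F" unfolding F_def by (rule int_p)
  have iG: "integrable lborel G" unfolding G_def by (rule integrable_inverse_norm_cball)
  have iGx: "integrable lborel (\<lambda>y. G (y + (- x)))" for x by (rule lborel_integrable_shift[OF iG])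
  have bound: "near x y * f y \<le> (2 + norm x) powr \<bar>q\<bar> * F y + G (y + (- x))" for x y
  proof (cases "x - y \<in> cball 0 1 \<and> x \<noteq> y")
    case False
    have "(2 + norm x) powr \<bar>q\<bar> * F y \<ge> 0" by (intro mult_nonneg_nonneg F0) auto
    moreover have "G (y + (- x)) \<ge> 0" by (simp add: G_def)
    moreover have "near x y = 0" using False by (auto simp: near_def)
    ultimately show ?thesis by simp
  next
    case True
    let ?d = "norm (x - y)"
    have d: "?d > 0" "?d \<le> 1" using True by auto
    have "f y * ?d powr (- s) \<le> f y powr p + (?d powr (- s)) powr (p / (p - 1))"
      by (rule Young_simple[OF f_nonneg _ p]) simp
    also have "(?d powr (- s)) powr (p / (p - 1)) = ?d powr (-1)"
    proof -
      have "(- s) * (p / (p - 1)) = -1" using p by (simp add: s_def field_simps)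
      thus ?thesis by (simp only: powr_powr)
    qed
    also have "\<dots> = G (y + (- x))" using d by (simp add: G_def powr_minus_divide norm_minus_commute)
    finally have 1: "near x y * f y \<le> f y powr p + G (y + (- x))"
      using d by (simp add: near_def mult.commute)
    have "norm y \<le> norm x + norm (x - y)"
      using norm_triangle_ineq4[of x "x - y"] by simp
    hence "1 + norm y \<le> 2 + norm x" using d by simp
    hence "(1 + norm y) powr \<bar>q\<bar> \<le> (2 + norm x) powr \<bar>q\<bar>" by (intro powr_mono2) auto
    moreover have "(1 + norm y) powr (- q) \<le> (1 + norm y) powr \<bar>q\<bar>" by (intro powr_mono) auto
    ultimately have "F y * (1 + norm y) powr (- q) \<le> F y * (2 + norm x) powr \<bar>q\<bar>"
      by (intro mult_left_mono F0) simp
    moreover have "(1 + norm y) powr q * (1 + norm y) powr (- q) = 1"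
    proof -
      have "1 + norm y \<noteq> 0" using norm_ge_zero[of y] by linarith
      thus ?thesis by (simp add: powr_add[symmetric])
    qed
    hence "F y * (1 + norm y) powr (- q) = f y powr p"
      by (simp add: F_def mult.assoc)
    ultimately show ?thesis using 1 by (simp add: mult.commute)
  qed
  have iB: "integrable lborel (\<lambda>y. (2 + norm x) powr \<bar>q\<bar> * F y + G (y + (- x)))" for x
    by (intro Bochner_Integration.integrable_add integrable_mult_right iF iGx)
  have int: "integrable lborel (\<lambda>y. near x y * f y)" for x
  proof (rule Bochner_Integration.integrable_bound[OF iB[of x]])
    show "AE y in lborel. norm (near x y * f y) \<le> norm ((2 + norm x) powr \<bar>q\<bar> * F y + G (y + (- x)))"
    proof (rule AE_I2)
      fix y
      have "0 \<le> near x y * f y" by (intro mult_nonneg_nonneg near_nonneg f_nonneg)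
      thus "norm (near x y * f y) \<le> norm ((2 + norm x) powr \<bar>q\<bar> * F y + G (y + (- x)))"
        using bound[of x y] by simp
    qed
  qed measurable
  show "integrable lborel (\<lambda>y. near x y * f y)" by (rule int)
  define A where "A = (\<integral>y. F y \<partial>lborel)"
  define B where "B = (\<integral>y. G y \<partial>lborel)"
  have B0: "B \<ge> 0" unfolding B_def by (intro Bochner_Integration.integral_nonneg) (simp add: G_def)
  have A0: "A \<ge> 0" unfolding A_def by (intro Bochner_Integration.integral_nonneg F0)
  have "(\<integral>y. near x y * f y \<partial>lborel) \<le> (A + B) * (2 + norm x) powr \<bar>q\<bar>" for x
  proof -
    have [measurable]: "G \<in> borel_measurable borel" using iG by auto
    have "(\<integral>y. near x y * f y \<partial>lborel) \<le> (\<integral>y. (2 + norm x) powr \<bar>q\<bar> * F y + G (y + (- x)) \<partial>lborel)"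
      by (intro integral_mono int iB bound)
    also have "\<dots> = (2 + norm x) powr \<bar>q\<bar> * A + B"
      by (subst Bochner_Integration.integral_add, intro integrable_mult_right iF, rule iGx)
         (simp add: A_def B_def lborel_integral_shift[of G "- x", simplified])
    also have "B \<le> B * (2 + norm x) powr \<bar>q\<bar>"
      using B0 mult_left_mono[OF ge_one_powr_ge_zero[of "2 + norm x" "\<bar>q\<bar>"], of B] by simp
    finally show ?thesis by (simp add: algebra_simps)
  qed
  thus "\<exists>C\<ge>0. \<forall>x. (\<integral>y. near x y * f y \<partial>lborel) \<le> C * (2 + norm x) powr \<bar>q\<bar>"
    using A0 B0 by (intro exI[of _ "A + B"]) auto
qed

lemma neg_ln_le_near:
  assumes "x \<noteq> y" "norm (x - y) \<le> 1"
  shows "- ln (norm (x - y)) \<le> near x y / s"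
proof -
  have "- ln (norm (x - y)) = ln (1 / norm (x - y))" using assms by (simp add: ln_div)
  also have "\<dots> \<le> (1 / norm (x - y)) powr s / s" using assms s by (intro ln_le_powr) auto
  also have "(1 / norm (x - y)) powr s = norm (x - y) powr (- s)"
    by (simp add: powr_divide powr_minus_divide)
  finally show ?thesis using assms by (simp add: near_def)
qed

lemma abs_ln_kernel_le:
  "\<bar>ln (norm (x - y))\<bar> \<le> ln (1 + norm x) + (1 + norm y) powr g / g + near x y / s"
proof (cases "x = y")
  \<comment> \<open>On the diagonal the left-hand side vanishes because
    \<open>ln 0 = 0\<close>.\<close>
  case True
  have "0 \<le> (1 + norm y) powr g / g" using g by simp
  moreover have "0 \<le> ln (1 + norm x)" by simp
  moreover have "0 \<le> near x y / s" using near_nonneg s by simp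
  ultimately show ?thesis using True by simp
next
  case False
  let ?d = "norm (x - y)"
  have d: "?d > 0" using False by simp
  have n0: "0 \<le> ln (1 + norm x)" "0 \<le> (1 + norm y) powr g / g" "0 \<le> near x y / s"
    using g s near_nonneg by auto
  have "(1 + norm x) * (1 + norm y) = 1 + norm x + norm y + norm x * norm y" by (simp add: algebra_simps)
  hence "?d \<le> (1 + norm x) * (1 + norm y)"
    using norm_triangle_ineq4[of x y] mult_nonneg_nonneg[OF norm_ge_zero[of x] norm_ge_zero[of y]] by linarith
  hence "ln ?d \<le> ln ((1 + norm x) * (1 + norm y))" using d by (intro ln_mono) (auto intro!: mult_pos_pos simp: add_pos_nonneg)
  also have "\<dots> = ln (1 + norm x) + ln (1 + norm y)" by (rule ln_mult_pos) (auto simp: add_pos_nonneg)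
  also have "ln (1 + norm y) \<le> (1 + norm y) powr g / g" using g by (intro ln_le_powr) (auto simp: add_pos_nonneg)
  finally have 1: "ln ?d \<le> ln (1 + norm x) + (1 + norm y) powr g / g" by simp
  have 2: "- ln ?d \<le> near x y / s"
  proof (cases "?d \<le> 1")
    case True thus ?thesis using neg_ln_le_near False by blast
  next
    case F: False
    hence "ln ?d \<ge> 0" by simp
    thus ?thesis using n0(3) by linarith
  qed
  show ?thesis using 1 2 n0 by linarith
qed

lemma pot_integrable: "integrable lborel (\<lambda>y. ln (norm (x - y)) * f y)"
proof -
  define V where "V y = ln (1 + norm x) * f y + (1 / g) * (f y * (1 + norm y) powr g) + (1 / s) * (near x y * f y)" for y
  have iV: "integrable lborel V" unfolding V_def
    by (intro Bochner_Integration.integrable_add integrable_mult_right int_f int_g near_int)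
  have b: "\<bar>ln (norm (x - y))\<bar> * f y \<le> V y" for y
    using mult_right_mono[OF abs_ln_kernel_le[of x y] f_nonneg[of y]] by (simp add: V_def algebra_simps)
  have V0: "V y \<ge> 0" for y
    using order_trans[OF mult_nonneg_nonneg[OF abs_ge_zero f_nonneg] b[of y]] .
  show ?thesis
    by (rule Bochner_Integration.integrable_bound[OF iV])
       (use b f_nonneg V0 in \<open>auto intro!: AE_I2 simp: abs_mult\<close>)
qed

text \<open>The singularity of the kernel moves with x, which obstructs domination. Potentials of
  kernels smoothed by e are continuous by domination, and they converge to \<open>pot\<close>
  uniformly on balls.\<close>

lemma pot_continuous: "continuous_on UNIV pot"
proof -
  obtain C where C: "C \<ge> 0" "\<And>x. (\<integral>y. near x y * f y \<partial>lborel) \<le> C * (2 + norm x) powr \<bar>q\<bar>"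
    using near_int(2) by blast
  define e where "e n = 1 / (real n + 1)" for n
  have e: "e n > 0" "e n \<le> 1" for n by (auto simp: e_def)
  have e0: "e \<longlonglongrightarrow> 0" unfolding e_def[abs_def] using LIMSEQ_inverse_real_of_nat by (simp add: field_simps)
  define L where "L n x y = ln ((norm (x - y))\<^sup>2 + (e n)\<^sup>2) / 2" for n and x y :: "real^2"
  define U where "U n x = (\<integral>y. L n x y * f y \<partial>lborel)" for n x
  have posL: "(norm (x - y))\<^sup>2 + (e n)\<^sup>2 > 0" for x y :: "real^2" and n
    using e[of n] by (simp add: add_nonneg_pos)
  \<comment> \<open>For x in a ball the smoothed kernel is bounded below by ln e and above by a
    constant plus a multiple of the weight (1 + |y|)^g: a majorant independent of x.\<close>
  have Lb: "\<bar>L n x y\<bar> \<le> \<bar>ln (e n)\<bar> + ln (2 + r) + (1 + norm y) powr g / g" if "norm x \<le> r" for n r and x y :: "real^2"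
  proof -
    have r: "r \<ge> 0" using that norm_ge_zero[of x] by linarith
    have "2 * ln (e n) = ln ((e n)\<^sup>2)" using e[of n] by (simp add: ln_realpow)
    also have "\<dots> \<le> ln ((norm (x - y))\<^sup>2 + (e n)\<^sup>2)" using e[of n] by (intro ln_mono) (auto simp: add_nonneg_pos)
    finally have 1: "ln (e n) \<le> L n x y" by (simp add: L_def)
    have e2: "(e n)\<^sup>2 \<le> 1" using e[of n] by (simp add: power_le_one)
    have "norm (x - y) \<le> r + norm y" using norm_triangle_ineq4[of x y] that by linarith
    hence "(norm (x - y))\<^sup>2 \<le> (r + norm y)\<^sup>2" by (intro power_mono) auto
    hence "(norm (x - y))\<^sup>2 + (e n)\<^sup>2 \<le> (1 + (r + norm y))\<^sup>2"
      using e2 r norm_ge_zero[of y] by (simp add: power2_sum del: norm_ge_zero)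
    also have "\<dots> \<le> ((2 + r) * (1 + norm y))\<^sup>2"
      using r mult_nonneg_nonneg[OF r norm_ge_zero[of y]] by (intro power_mono) (auto simp: algebra_simps)
    finally have "ln ((norm (x - y))\<^sup>2 + (e n)\<^sup>2) \<le> ln (((2 + r) * (1 + norm y))\<^sup>2)"
      by (intro ln_mono posL)
    also have "\<dots> = 2 * (ln (2 + r) + ln (1 + norm y))"
      using r by (simp add: ln_realpow ln_mult_pos add_pos_nonneg)
    finally have "L n x y \<le> ln (2 + r) + ln (1 + norm y)" by (simp add: L_def)
    also have "ln (1 + norm y) \<le> (1 + norm y) powr g / g" using g by (intro ln_le_powr) (auto simp: add_pos_nonneg)
    finally have 2: "L n x y \<le> ln (2 + r) + (1 + norm y) powr g / g" by simp
    have "ln (2 + r) \<ge> 0" "(1 + norm y) powr g / g \<ge> 0" using r g by auto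
    with 1 2 show ?thesis by linarith
  qed
  define W where "W n r y = (\<bar>ln (e n)\<bar> + ln (2 + r)) * f y + (1 / g) * (f y * (1 + norm y) powr g)" for n r y
  have iW: "integrable lborel (W n r)" for n r unfolding W_def
    by (intro Bochner_Integration.integrable_add integrable_mult_right int_f int_g)
  have LW: "norm (L n x y * f y) \<le> W n r y" if "norm x \<le> r" for n r x y
    using mult_right_mono[OF Lb[OF that, of n y] f_nonneg[of y]] f_nonneg[of y]
    by (simp add: W_def abs_mult algebra_simps)
  have [measurable]: "(\<lambda>y. L n x y) \<in> borel_measurable borel" for n x unfolding L_def by measurable
  have iL: "integrable lborel (\<lambda>y. L n x y * f y)" for n x
  proof (rule Bochner_Integration.integrable_bound[OF iW[of n "norm x"]])
    show "AE y in lborel. norm (L n x y * f y) \<le> norm (W n (norm x) y)"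
      using LW[OF order_refl] by (intro AE_I2) (metis abs_ge_self order_trans real_norm_def)
  qed measurable
  have cU: "continuous_on UNIV (U n)" for n
    unfolding continuous_on_sequentially comp_def
  proof (intro allI ballI impI)
    fix X :: "nat \<Rightarrow> real^2" and x assume X: "(\<forall>k. X k \<in> UNIV) \<and> X \<longlonglongrightarrow> x"
    then obtain r where r: "\<And>k. norm (X k) \<le> r"
      using convergent_imp_Bseq[of X] by (auto simp: convergent_def Bseq_def)
    show "(\<lambda>k. U n (X k)) \<longlonglongrightarrow> U n x" unfolding U_def
    proof (rule integral_dominated_convergence[OF _ _ iW])
      show "AE y in lborel. (\<lambda>k. L n (X k) y * f y) \<longlonglongrightarrow> L n x y * f y"
        unfolding L_def using X e(1)[of n] by (intro AE_I2 tendsto_intros) auto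
      show "AE y in lborel. norm (L n (X k) y * f y) \<le> W n r y" for k by (intro AE_I2 LW r)
    qed measurable
  qed
  \<comment> \<open>With d = |x - y| the difference is ln (1 + (e/d)^2) / 2. For d <= 1 the exponent
    s / 2 in \<open>ln_add_one_le_powr\<close> produces exactly (e/d)^s, a multiple of
    \<open>near\<close>; for d > 1 the difference is at most e^2.\<close>
  have diff: "\<bar>L n x y - ln (norm (x - y))\<bar> \<le> e n powr s * near x y / s + (e n)\<^sup>2" if "x \<noteq> y" for n x y
  proof -
    let ?d = "norm (x - y)"
    have d: "?d > 0" using that by simp
    have "ln (?d\<^sup>2 + (e n)\<^sup>2) = ln (?d\<^sup>2 * (1 + (e n / ?d)\<^sup>2))"
      using d by (intro arg_cong[where f=ln]) (simp add: field_simps power_divide)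
    also have "\<dots> = 2 * ln ?d + ln (1 + (e n / ?d)\<^sup>2)"
      using d by (subst ln_mult_pos) (auto simp: ln_realpow add_pos_nonneg)
    finally have eq: "L n x y - ln ?d = ln (1 + (e n / ?d)\<^sup>2) / 2" unfolding L_def by linarith
    have 0: "ln (1 + (e n / ?d)\<^sup>2) \<ge> 0" by simp
    have "ln (1 + (e n / ?d)\<^sup>2) / 2 \<le> e n powr s * near x y / s + (e n)\<^sup>2"
    proof (cases "?d \<le> 1")
      case True
      have "ln (1 + (e n / ?d)\<^sup>2) \<le> ((e n / ?d)\<^sup>2) powr (s / 2) / (s / 2)"
        using s by (intro ln_add_one_le_powr) auto
      also have "((e n / ?d)\<^sup>2) powr (s / 2) = (e n / ?d) powr s"
      proof -
        have "(e n / ?d)\<^sup>2 = (e n / ?d) powr 2" using d e[of n] by simp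
        thus ?thesis by (simp add: powr_powr)
      qed
      also have "\<dots> = e n powr s * near x y"
        using True e[of n] by (simp add: near_def powr_divide powr_minus_divide)
      finally have "ln (1 + (e n / ?d)\<^sup>2) / 2 \<le> e n powr s * near x y / s" using s by (simp add: field_simps)
      thus ?thesis by (simp add: add_increasing2)
    next
      case False
      have "ln (1 + (e n / ?d)\<^sup>2) \<le> (e n / ?d)\<^sup>2" by (rule ln_add_one_self_le_self) simp
      also have "\<dots> \<le> (e n)\<^sup>2" using False d e[of n] by (intro power_mono) (auto simp: field_simps mult_le_cancel_left1)
      finally have "ln (1 + (e n / ?d)\<^sup>2) / 2 \<le> (e n)\<^sup>2" using 0 zero_le_power2[of "e n"] by linarith
      moreover have "e n powr s * near x y / s \<ge> 0" using s near_nonneg by simp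
      ultimately show ?thesis by linarith
    qed
    thus ?thesis unfolding eq using 0 by linarith
  qed
  have Udiff: "\<bar>U n x - pot x\<bar> \<le> e n powr s * (C * (2 + norm x) powr \<bar>q\<bar>) / s + (e n)\<^sup>2 * mass" for n x
  proof -
    have ii: "integrable lborel (\<lambda>y. (e n powr s / s) * (near x y * f y) + (e n)\<^sup>2 * f y)"
      by (intro Bochner_Integration.integrable_add integrable_mult_right int_f near_int)
    have "\<bar>U n x - pot x\<bar> = \<bar>\<integral>y. L n x y * f y - ln (norm (x - y)) * f y \<partial>lborel\<bar>"
      unfolding U_def pot_def by (subst Bochner_Integration.integral_diff) (auto intro: iL pot_integrable)
    also have "\<dots> \<le> (\<integral>y. \<bar>L n x y * f y - ln (norm (x - y)) * f y\<bar> \<partial>lborel)" by (rule integral_abs_bound)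
    also have "\<dots> \<le> (\<integral>y. (e n powr s / s) * (near x y * f y) + (e n)\<^sup>2 * f y \<partial>lborel)"
    proof (rule integral_mono_AE[OF _ ii])
      show "integrable lborel (\<lambda>y. \<bar>L n x y * f y - ln (norm (x - y)) * f y\<bar>)"
        by (intro integrable_abs Bochner_Integration.integrable_diff iL pot_integrable)
      have "AE y in lborel. y \<noteq> x" by (rule AE_lborel_singleton)
      thus "AE y in lborel. \<bar>L n x y * f y - ln (norm (x - y)) * f y\<bar> \<le> (e n powr s / s) * (near x y * f y) + (e n)\<^sup>2 * f y"
      proof eventually_elim
        case (elim y)
        have "\<bar>L n x y * f y - ln (norm (x - y)) * f y\<bar> = \<bar>L n x y - ln (norm (x - y))\<bar> * f y"
          using f_nonneg[of y] by (simp add: left_diff_distrib[symmetric] abs_mult)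
        also have "\<dots> \<le> (e n powr s * near x y / s + (e n)\<^sup>2) * f y"
          using elim by (intro mult_right_mono diff f_nonneg) auto
        finally show ?case by (simp add: algebra_simps)
      qed
    qed
    also have "\<dots> = (e n powr s / s) * (\<integral>y. near x y * f y \<partial>lborel) + (e n)\<^sup>2 * mass"
      by (subst Bochner_Integration.integral_add, (intro integrable_mult_right near_int int_f)+) (simp add: mass_def)
    also have "\<dots> \<le> (e n powr s / s) * (C * (2 + norm x) powr \<bar>q\<bar>) + (e n)\<^sup>2 * mass"
      using s by (intro add_right_mono mult_left_mono C) auto
    finally show ?thesis by simp
  qed
  have "continuous_on (ball 0 r) pot" for r
  proof (rule uniform_limit_theorem[where F = sequentially and f = U])
    show "\<forall>\<^sub>F n in sequentially. continuous_on (ball 0 r) (U n)"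
      by (intro always_eventually allI continuous_on_subset[OF cU]) simp
    show "uniform_limit (ball 0 r) U pot sequentially"
    proof (rule uniform_limitI)
      fix \<epsilon> :: real assume eps: "\<epsilon> > 0"
      have "(\<lambda>n. e n powr s * (C * (2 + \<bar>r\<bar>) powr \<bar>q\<bar>) / s + (e n)\<^sup>2 * mass)
         \<longlonglongrightarrow> 0 powr s * (C * (2 + \<bar>r\<bar>) powr \<bar>q\<bar>) / s + 0\<^sup>2 * mass"
        by (intro tendsto_intros e0 tendsto_powr2) (use s in \<open>auto intro!: always_eventually less_imp_le e\<close>)
      hence "(\<lambda>n. e n powr s * (C * (2 + \<bar>r\<bar>) powr \<bar>q\<bar>) / s + (e n)\<^sup>2 * mass) \<longlonglongrightarrow> 0" using s by simp
      hence "\<forall>\<^sub>F n in sequentially. e n powr s * (C * (2 + \<bar>r\<bar>) powr \<bar>q\<bar>) / s + (e n)\<^sup>2 * mass < \<epsilon>"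
        using eps by (rule order_tendstoD)
      thus "\<forall>\<^sub>F n in sequentially. \<forall>x\<in>ball 0 r. dist (U n x) (pot x) < \<epsilon>"
      proof eventually_elim
        case (elim n)
        show ?case
        proof
          fix x :: "real^2" assume "x \<in> ball 0 r"
          hence "norm x \<le> \<bar>r\<bar>" by simp
          hence "(2 + norm x) powr \<bar>q\<bar> \<le> (2 + \<bar>r\<bar>) powr \<bar>q\<bar>" by (intro powr_mono2) auto
          hence "e n powr s * (C * (2 + norm x) powr \<bar>q\<bar>) / s \<le> e n powr s * (C * (2 + \<bar>r\<bar>) powr \<bar>q\<bar>) / s"
            using s C by (intro divide_right_mono mult_left_mono) auto
          thus "dist (U n x) (pot x) < \<epsilon>" using Udiff[of n x] elim by (simp add: dist_real_def)
        qed
      qed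
    qed
  qed simp
  hence "continuous_on (\<Union>r\<in>UNIV. ball 0 r) pot" by (intro continuous_on_open_UN) auto
  moreover have "(\<Union>r\<in>UNIV. ball 0 r) = (UNIV :: (real^2) set)"
    by (auto intro: gt_ex)
  ultimately show ?thesis by simp
qed

text \<open>If |x - y| >= |x| / 2, the ratio |x - y| / |x| is at least 1/2 and its logarithm is
  controlled by (|y|/|x|)^g. Otherwise |y| >= |x| / 2, so 2 (|y|/|x|)^g >= 1 can absorb any multiple
  of ln |x|: writing - ln |x - y| as N ln |x| + ln (|x|^(-N) / |x - y|) shrinks the coefficient of
  \<open>near\<close> to |x|^(-N s).\<close>

lemma ln_ratio_le:
  fixes x y :: "real ^ 2"
  assumes n: "norm x \<ge> 2" and N: "N \<ge> 0"
  shows "\<bar>ln (norm (x - y)) - ln (norm x)\<bar> \<le>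
    (2 / g + 2 * (N + 1) * ln (norm x)) * (norm y / norm x) powr g + norm x powr (- (N * s)) * near x y / s"
proof -
  let ?d = "norm (x - y)" and ?n = "norm x" and ?T = "norm y / norm x"
  have n0: "?n > 0" and ln0: "ln ?n \<ge> 0" using n by auto
  have T0: "?T \<ge> 0" by simp
  have c0: "2 * (N + 1) * ln ?n * ?T powr g \<ge> 0" using N ln0 by simp
  have c1: "?n powr (- (N * s)) * near x y / s \<ge> 0" using near_nonneg s by simp
  have c2: "2 / g * ?T powr g \<ge> 0" using g by simp
  show ?thesis
  proof (cases "?d \<ge> ?n / 2")
    case True
    define r where "r = ?d / ?n"
    have r: "r \<ge> 1 / 2" using True n0 by (simp add: r_def field_simps)
    have d0: "?d > 0" using True n0 by linarith
    have lr: "ln ?d - ln ?n = ln r" using d0 n0 by (simp add: r_def ln_div)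
    have rT: "r \<le> 1 + ?T" "1 - r \<le> ?T"
    proof -
      have "?d \<le> ?n + norm y" "?n - norm y \<le> ?d" using norm_triangle_ineq4[of x y] norm_triangle_ineq2[of x y] by auto
      hence "?d / ?n \<le> (?n + norm y) / ?n" "(?n - ?d) / ?n \<le> norm y / ?n"
        by (intro divide_right_mono; simp)+
      thus "r \<le> 1 + ?T" "1 - r \<le> ?T" using n0 by (simp_all add: r_def add_divide_distrib diff_divide_distrib)
    qed
    have "\<bar>ln r\<bar> \<le> 2 / g * ?T powr g"
    proof (cases "r \<ge> 1")
      case True
      have "ln r \<le> ln (1 + ?T)" using r rT by (intro ln_mono) auto
      also have "\<dots> \<le> ?T powr g / g" by (rule ln_add_one_le_powr[OF T0 g])
      also have "\<dots> \<le> 2 / g * ?T powr g" using g by (simp add: field_simps)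
      finally show ?thesis using True by simp
    next
      case False
      have "- ln r = ln (1 / r)" using r by (simp add: ln_div)
      also have "\<dots> \<le> 1 / r - 1" using r by (intro ln_le_minus_one) auto
      also have "\<dots> = (1 - r) / r" using r by (simp add: field_simps)
      also have "\<dots> \<le> (1 - r) / (1 / 2)" using r False by (intro divide_left_mono) auto
      also have "\<dots> = 2 * (1 - r)" by simp
      also have "1 - r \<le> ?T powr g"
      proof (cases "?T \<le> 1")
        case True
        have "?T powr 1 \<le> ?T powr g" using True g T0 by (intro powr_mono') auto
        thus ?thesis using rT by simp
      next
        case False
        have "1 \<le> ?T powr g" using False g by (intro ge_one_powr_ge_zero) auto
        thus ?thesis using r by linarith
      qed
      also have "2 * ?T powr g \<le> 2 / g * ?T powr g" using g by (intro mult_right_mono) (auto simp: field_simps)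
      finally show ?thesis using False r by simp
    qed
    thus ?thesis unfolding lr using c0 c1 by (simp add: distrib_right)
  next
    case False
    have "norm y \<ge> ?n / 2" using False norm_triangle_ineq2[of x y] by linarith
    hence T2: "2 * ?T \<ge> 1" using n0 by (simp add: field_simps)
    have "1 \<le> (2 * ?T) powr g" using T2 g by (intro ge_one_powr_ge_zero) auto
    also have "\<dots> = 2 powr g * ?T powr g" by (rule powr_mult)
    also have "\<dots> \<le> 2 powr 1 * ?T powr g" using g by (intro mult_right_mono powr_mono) auto
    finally have T1: "1 \<le> 2 * ?T powr g" by simp
    have lnN: "(N + 1) * ln ?n \<le> 2 * (N + 1) * ln ?n * ?T powr g"
    proof -
      have "(N + 1) * ln ?n * 1 \<le> (N + 1) * ln ?n * (2 * ?T powr g)"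
        using N ln0 by (intro mult_left_mono T1) auto
      also have "\<dots> = 2 * (N + 1) * ln ?n * ?T powr g" by (simp only: mult_ac)
      finally show ?thesis by simp
    qed
    have "\<bar>ln ?d - ln ?n\<bar> \<le> (N + 1) * ln ?n + ?n powr (- (N * s)) * near x y / s"
    proof (cases "x = y")
      case True thus ?thesis using ln0 N c1 by (simp add: distrib_right)
    next
      case neq: False
      hence d0: "?d > 0" by simp
      have "ln ?d \<le> ln ?n" using False d0 n0 by (intro ln_mono) linarith+
      moreover have "- ln ?d \<le> N * ln ?n + ?n powr (- (N * s)) * near x y / s"
      proof (cases "?d \<le> 1")
        case True
        have "- ln ?d - N * ln ?n = ln (?n powr (- N) / ?d)" using d0 n0 by (simp add: ln_div ln_powr)
        also have "\<dots> \<le> (?n powr (- N) / ?d) powr s / s" using d0 n0 s by (intro ln_le_powr) auto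
        also have "(?n powr (- N) / ?d) powr s = ?n powr (- (N * s)) * near x y"
          using True by (simp add: near_def powr_divide powr_powr powr_minus_divide[of ?d])
        finally show ?thesis by simp
      next
        case False
        hence "ln ?d \<ge> 0" by simp
        moreover have "N * ln ?n \<ge> 0" using N ln0 by simp
        ultimately show ?thesis using c1 by linarith
      qed
      ultimately show ?thesis using c1 N ln0 by (simp add: distrib_right)
    qed
    thus ?thesis using lnN c2 by (simp add: distrib_right)
  qed
qed

lemma pot_asymp:
  "\<exists>C\<ge>0. \<forall>x. norm x \<ge> 2 \<longrightarrow> \<bar>pot x - mass * ln (norm x)\<bar> \<le> C * (1 + ln (norm x)) * norm x powr (- g)"
proof -
  obtain C where C: "C \<ge> 0" "\<And>x. (\<integral>y. near x y * f y \<partial>lborel) \<le> C * (2 + norm x) powr \<bar>q\<bar>"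
    using near_int(2) by blast
  \<comment> \<open>This makes N s = |q| + 1: the coefficient |x|^(-N s) beats the growth |x|^|q| of
    the near part and leaves |x|^(-1), which is at most |x|^(-g) since g <= 1.\<close>
  define N where "N = (\<bar>q\<bar> + 1) / s"
  have N: "N \<ge> 0" "N * s = \<bar>q\<bar> + 1" using s by (auto simp: N_def)
  define G where "G = (\<integral>y. f y * (1 + norm y) powr g \<partial>lborel)"
  have G0: "G \<ge> 0" unfolding G_def by (intro Bochner_Integration.integral_nonneg mult_nonneg_nonneg f_nonneg) auto
  define C' where "C' = (2 / g + 2 * (N + 1)) * G + C * 2 powr \<bar>q\<bar> / s"
  have C'0: "C' \<ge> 0" unfolding C'_def using g N G0 C s by auto
  have "\<bar>pot x - mass * ln (norm x)\<bar> \<le> C' * (1 + ln (norm x)) * norm x powr (- g)" if n: "norm x \<ge> 2" for x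
  proof -
    have ln0: "ln (norm x) \<ge> 0" and n0: "norm x > 0" using n by auto
    define K where "K = (2 / g + 2 * (N + 1) * ln (norm x)) * norm x powr (- g)"
    define K' where "K' = norm x powr (- (N * s)) / s"
    have K: "K \<ge> 0" "K' \<ge> 0" using g N ln0 s by (auto simp: K_def K'_def)
    have pt: "\<bar>ln (norm (x - y)) * f y - ln (norm x) * f y\<bar> \<le> K * (f y * (1 + norm y) powr g) + K' * (near x y * f y)" for y
    proof -
      have "(norm y / norm x) powr g \<le> ((1 + norm y) / norm x) powr g"
        using n0 g by (intro powr_mono2 divide_right_mono) auto
      also have "\<dots> = (1 + norm y) powr g * norm x powr (- g)"
        by (simp add: powr_divide powr_minus_divide)
      finally have t: "(norm y / norm x) powr g \<le> (1 + norm y) powr g * norm x powr (- g)" .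
      have "\<bar>ln (norm (x - y)) * f y - ln (norm x) * f y\<bar> = \<bar>ln (norm (x - y)) - ln (norm x)\<bar> * f y"
        using f_nonneg[of y] by (simp add: left_diff_distrib[symmetric] abs_mult)
      also have "\<dots> \<le> ((2 / g + 2 * (N + 1) * ln (norm x)) * (norm y / norm x) powr g + norm x powr (- (N * s)) * near x y / s) * f y"
        by (intro mult_right_mono ln_ratio_le n N f_nonneg)
      also have "\<dots> \<le> ((2 / g + 2 * (N + 1) * ln (norm x)) * ((1 + norm y) powr g * norm x powr (- g)) + norm x powr (- (N * s)) * near x y / s) * f y"
        using g N ln0 by (intro mult_right_mono add_right_mono mult_left_mono t f_nonneg) auto
      finally show ?thesis by (simp add: K_def K'_def algebra_simps)
    qed
    have i1: "integrable lborel (\<lambda>y. K * (f y * (1 + norm y) powr g) + K' * (near x y * f y))"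
      by (intro Bochner_Integration.integrable_add integrable_mult_right int_g near_int)
    have "\<bar>pot x - mass * ln (norm x)\<bar> = \<bar>\<integral>y. ln (norm (x - y)) * f y - ln (norm x) * f y \<partial>lborel\<bar>"
      by (subst Bochner_Integration.integral_diff, intro pot_integrable, intro integrable_mult_right int_f)
         (simp add: pot_def mass_def mult.commute[of _ "ln (norm x)"])
    also have "\<dots> \<le> (\<integral>y. \<bar>ln (norm (x - y)) * f y - ln (norm x) * f y\<bar> \<partial>lborel)" by (rule integral_abs_bound)
    also have "\<dots> \<le> (\<integral>y. K * (f y * (1 + norm y) powr g) + K' * (near x y * f y) \<partial>lborel)"
      by (intro integral_mono i1 pt integrable_abs Bochner_Integration.integrable_diff pot_integrable integrable_mult_right int_f)
    also have "\<dots> = K * G + K' * (\<integral>y. near x y * f y \<partial>lborel)"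
      by (subst Bochner_Integration.integral_add, (intro integrable_mult_right near_int int_g)+) (simp add: G_def)
    also have "\<dots> \<le> K * G + K' * (C * (2 + norm x) powr \<bar>q\<bar>)"
      by (intro add_left_mono mult_left_mono C K)
    also have "K * G \<le> (2 / g + 2 * (N + 1)) * G * (1 + ln (norm x)) * norm x powr (- g)"
    proof -
      have "2 / g + 2 * (N + 1) * ln (norm x) \<le> (2 / g + 2 * (N + 1)) * (1 + ln (norm x))"
        using g N ln0 by (simp add: distrib_left distrib_right)
      from mult_right_mono[OF this, of "norm x powr (- g) * G"] show ?thesis using G0 by (simp add: K_def mult_ac)
    qed
    also have "K' * (C * (2 + norm x) powr \<bar>q\<bar>) \<le> C * 2 powr \<bar>q\<bar> / s * (1 + ln (norm x)) * norm x powr (- g)"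
    proof -
      have "(2 + norm x) powr \<bar>q\<bar> \<le> (2 * norm x) powr \<bar>q\<bar>" using n by (intro powr_mono2) auto
      also have "\<dots> = 2 powr \<bar>q\<bar> * norm x powr \<bar>q\<bar>" by (rule powr_mult)
      finally have "K' * (C * (2 + norm x) powr \<bar>q\<bar>) \<le> K' * (C * (2 powr \<bar>q\<bar> * norm x powr \<bar>q\<bar>))"
        by (intro mult_left_mono K C)
      also have "\<dots> = C * 2 powr \<bar>q\<bar> / s * (norm x powr (- (N * s)) * norm x powr \<bar>q\<bar>)"
        by (simp add: K'_def mult_ac)
      also have "norm x powr (- (N * s)) * norm x powr \<bar>q\<bar> = norm x powr (-1)"
        using N by (simp add: powr_add[symmetric])
      also have "C * 2 powr \<bar>q\<bar> / s * norm x powr (-1) \<le> C * 2 powr \<bar>q\<bar> / s * ((1 + ln (norm x)) * norm x powr (- g))"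
      proof (rule mult_left_mono)
        have "norm x powr (-1) \<le> norm x powr (- g)" using n g by (intro powr_mono) auto
        also have "\<dots> \<le> (1 + ln (norm x)) * norm x powr (- g)"
          using mult_right_mono[of 1 "1 + ln (norm x)" "norm x powr (- g)"] ln0 by simp
        finally show "norm x powr (-1) \<le> (1 + ln (norm x)) * norm x powr (- g)" .
      qed (use C s in auto)
      finally show ?thesis by (simp add: mult_ac)
    qed
    finally show ?thesis by (simp add: C'_def algebra_simps)
  qed
  thus ?thesis using C'0 by blast
qed

end

subsection \<open>The logarithmic energy of a neutral density\<close>

text \<open>Frullani's integral makes \<open>ln |x - y|\<close> a mixture of Gaussian kernels and constants; the latter
  are invisible to neutral densities.\<close>

definition frullani :: "real \<Rightarrow> real \<Rightarrow> real" where
  "frullani R t = (if 0 < t \<and> 0 < R then (exp (- t) - exp (- (t * R))) / t else 0)"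

text \<open>Write the quotient as the integral of exp (- t s) over s in [a, b] and exchange the
  order; the integral over t is 1 / s.\<close>

lemma nn_integral_frullani:
  assumes ab: "0 < a" "a \<le> b"
  shows "(\<integral>\<^sup>+t. ennreal ((exp (- (t * a)) - exp (- (t * b))) / t * indicator {0<..} t) \<partial>lborel) = ennreal (ln b - ln a)"
proof -
  have 1: "(\<integral>\<^sup>+s. ennreal (exp (- (t * s))) * indicator {a..b} s * indicator {0<..} t \<partial>lborel)
     = ennreal ((exp (- (t * a)) - exp (- (t * b))) / t * indicator {0<..} t)" for t
  proof (cases "t > 0")
    case True
    have "(\<integral>\<^sup>+s. ennreal (exp (- (t * s))) * indicator {a..b} s \<partial>lborel)
      = ennreal (- exp (- (t * b)) / t - (- exp (- (t * a)) / t))"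
      using True ab by (intro nn_integral_FTC_Icc) (auto intro!: derivative_eq_intros)
    thus ?thesis using True by (simp add: diff_divide_distrib)
  qed simp
  have 2: "(\<integral>\<^sup>+t. ennreal (exp (- (t * s))) * indicator {a..b} s * indicator {0<..} t \<partial>lborel)
     = ennreal (1 / s) * indicator {a..b} s" for s
  proof (cases "s \<in> {a..b}")
    case True
    hence s: "s > 0" using ab by auto
    have "filterlim (\<lambda>t::real. t * s) at_top at_top"
      using s by (rule filterlim_at_top_mult_tendsto_pos[OF tendsto_const _ filterlim_ident])
    hence "((\<lambda>t. - exp (- (t * s)) / s) \<longlongrightarrow> - 0 / s) at_top"
      using s by (intro tendsto_intros filterlim_compose[OF exp_at_bot] filterlim_compose[OF filterlim_uminus_at_bot_at_top]) auto
    hence lim: "((\<lambda>t. - exp (- (t * s)) / s) \<longlongrightarrow> 0) at_top" by simp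
    have "(\<integral>\<^sup>+t. ennreal (exp (- (t * s))) * indicator {0..} t \<partial>lborel) = ennreal (0 - (- exp (- (0 * s)) / s))"
      by (rule nn_integral_FTC_atLeast[OF _ _ _ lim]) (use s in \<open>auto intro!: derivative_eq_intros\<close>)
    also have "(\<integral>\<^sup>+t. ennreal (exp (- (t * s))) * indicator {0..} t \<partial>lborel)
       = (\<integral>\<^sup>+t. ennreal (exp (- (t * s))) * indicator {0<..} t \<partial>lborel)"
      using AE_lborel_singleton[of "0::real"]
      by (intro nn_integral_cong_AE) (auto elim!: eventually_mono simp: indicator_def)
    finally show ?thesis using True by simp
  qed simp
  have "(\<integral>\<^sup>+t. ennreal ((exp (- (t * a)) - exp (- (t * b))) / t * indicator {0<..} t) \<partial>lborel)
    = (\<integral>\<^sup>+t. \<integral>\<^sup>+s. ennreal (exp (- (t * s))) * indicator {a..b} s * indicator {0<..} t \<partial>lborel \<partial>lborel)"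
    by (simp only: 1)
  also have "\<dots> = (\<integral>\<^sup>+s. \<integral>\<^sup>+t. ennreal (exp (- (t * s))) * indicator {a..b} s * indicator {0<..} t \<partial>lborel \<partial>lborel)"
    by (rule lborel_pair.Fubini') measurable
  also have "\<dots> = (\<integral>\<^sup>+s. ennreal (1 / s) * indicator {a..b} s \<partial>lborel)" by (simp only: 2)
  also have "\<dots> = ennreal (ln b - ln a)"
    using ab by (intro nn_integral_FTC_Icc) (auto intro!: derivative_eq_intros)
  finally show ?thesis .
qed

text \<open>For fixed R the integrand keeps one sign, so its absolute value integrates to |ln R|.
  The absolute form is what justifies Fubini for the energy.\<close>

lemma has_bochner_integral_frullani:
  assumes R: "R \<ge> 0"
  shows "has_bochner_integral lborel (frullani R) (ln R)"
    "has_bochner_integral lborel (\<lambda>t. \<bar>frullani R t\<bar>) \<bar>ln R\<bar>"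
proof -
  have [measurable]: "frullani R \<in> borel_measurable borel" unfolding frullani_def[abs_def] by measurable
  consider "R = 0" | "R \<ge> 1" | "0 < R" "R < 1" using R by linarith
  hence "has_bochner_integral lborel (frullani R) (ln R) \<and> has_bochner_integral lborel (\<lambda>t. \<bar>frullani R t\<bar>) \<bar>ln R\<bar>"
  proof cases
    \<comment> \<open>The conventions agree here: \<open>frullani 0\<close> is identically 0 and
      \<open>ln 0 = 0\<close>.\<close>
    case 1
    have "frullani R = (\<lambda>_. 0)" by (auto simp: frullani_def 1)
    thus ?thesis using 1 by (simp add: has_bochner_integral_zero)
  next
    case 2
    have nn: "frullani R t \<ge> 0" for t using 2 by (auto simp: frullani_def)
    have eq: "frullani R t = (exp (- (t * 1)) - exp (- (t * R))) / t * indicator {0<..} t" for t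
      using 2 by (simp add: frullani_def)
    have int: "(\<integral>\<^sup>+t. ennreal (frullani R t) \<partial>lborel) = ennreal (ln R)"
      by (simp only: eq nn_integral_frullani[OF zero_less_one 2] ln_one diff_0_right)
    have "has_bochner_integral lborel (frullani R) (ln R)"
      by (rule has_bochner_integral_nn_integral)
         (use nn int 2 in auto)
    thus ?thesis using nn 2 by simp
  next
    case 3
    have nn: "- frullani R t \<ge> 0" for t using 3 by (auto simp: frullani_def divide_le_0_iff)
    have eq: "- frullani R t = (exp (- (t * R)) - exp (- (t * 1))) / t * indicator {0<..} t" for t
      using 3 by (simp add: frullani_def diff_divide_distrib)
    have int: "(\<integral>\<^sup>+t. ennreal (- frullani R t) \<partial>lborel) = ennreal (- ln R)"
      by (simp only: eq nn_integral_frullani[OF 3(1) less_imp_le[OF 3(2)]] ln_one diff_0)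
    have "has_bochner_integral lborel (\<lambda>t. - frullani R t) (- ln R)"
      by (rule has_bochner_integral_nn_integral)
         (use nn int 3 in auto)
    moreover have "\<bar>frullani R t\<bar> = - frullani R t" for t using nn[of t] by simp
    moreover have "\<bar>ln R\<bar> = - ln R" using 3 by simp
    ultimately show ?thesis using has_bochner_integral_minus[of lborel "\<lambda>t. - frullani R t" "- ln R"] by simp
  qed
  thus "has_bochner_integral lborel (frullani R) (ln R)"
    "has_bochner_integral lborel (\<lambda>t. \<bar>frullani R t\<bar>) \<bar>ln R\<bar>" by auto
qed

lemma (in pair_sigma_finite) integrable_tensor:
  fixes f :: "'a \<Rightarrow> real" and g :: "'b \<Rightarrow> real"
  assumes f: "integrable M1 f" and g: "integrable M2 g"
  shows "integrable (M1 \<Otimes>\<^sub>M M2) (\<lambda>p. f (fst p) * g (snd p))"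
    "(\<integral>p. f (fst p) * g (snd p) \<partial>(M1 \<Otimes>\<^sub>M M2)) = (\<integral>x. f x \<partial>M1) * (\<integral>y. g y \<partial>M2)"
proof -
  have [measurable]: "f \<in> borel_measurable M1" "g \<in> borel_measurable M2" using f g by auto
  show int: "integrable (M1 \<Otimes>\<^sub>M M2) (\<lambda>p. f (fst p) * g (snd p))"
  proof (rule Fubini_integrable)
    show "integrable M1 (\<lambda>x. \<integral>y. norm (f (fst (x, y)) * g (snd (x, y))) \<partial>M2)"
      using f g by (simp add: abs_mult)
    show "AE x in M1. integrable M2 (\<lambda>y. f (fst (x, y)) * g (snd (x, y)))"
      using g by simp
  qed measurable
  show "(\<integral>p. f (fst p) * g (snd p) \<partial>(M1 \<Otimes>\<^sub>M M2)) = (\<integral>x. f x \<partial>M1) * (\<integral>y. g y \<partial>M2)"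
    by (subst integral_fst'[symmetric, OF int]) simp
qed

text \<open>Completing the square about the midpoint of x and y separates the product of two
  Gaussians into one in x - y and one in z.\<close>

lemma parallelogram_gauss:
  fixes x y z :: "'a::real_inner"
  shows "2 * (norm (x - z))\<^sup>2 + 2 * (norm (y - z))\<^sup>2 = (norm (x - y))\<^sup>2 + 4 * (norm (z + (-1/2) *\<^sub>R (x + y)))\<^sup>2"
  by (simp add: power2_norm_eq_inner inner_diff_left inner_diff_right inner_add_left inner_add_right inner_commute algebra_simps)

text \<open>With u = t |z|^2 this dominates the Gaussian by the rational profile whose integral is
  already known.\<close>

lemma exp_le_inverse_square: "exp (- u) \<le> 4 / (1 + u)\<^sup>2" if "u \<ge> 0" for u :: real
proof -
  have "1 + u / 2 \<le> exp (u / 2)" using exp_ge_add_one_self[of "u / 2"] by simp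
  hence "(1 + u / 2)\<^sup>2 \<le> (exp (u / 2))\<^sup>2" using that by (intro power_mono) auto
  also have "(exp (u / 2))\<^sup>2 = exp u" by (simp add: exp_double[symmetric])
  finally have "(1 + u)\<^sup>2 / 4 \<le> exp u" using that by (simp add: power2_eq_square field_simps)
  thus ?thesis using that by (simp add: exp_minus field_simps)
qed

lemma gauss_integrable:
  assumes t: "t > 0"
  shows "integrable (lborel :: (real^2) measure) (\<lambda>z. exp (- (t * (norm z)\<^sup>2)))"
    "(\<integral>z. exp (- (t * (norm z)\<^sup>2)) \<partial>(lborel :: (real^2) measure)) > 0"
proof -
  have i1: "integrable (lborel :: (real^2) measure) (\<lambda>x. 1 / (1 + (norm x)\<^sup>2)\<^sup>2)"
    using has_bochner_integral_inverse_one_plus_norm_sq by (rule integrable.intros)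
  have "integrable (lborel :: (real^2) measure) (\<lambda>z. (\<lambda>x. 4 * (1 / (1 + (norm x)\<^sup>2)\<^sup>2)) (0 + sqrt t *\<^sub>R z))"
    using t by (intro lborel_integrable_affine integrable_mult_right i1) auto
  hence i2: "integrable (lborel :: (real^2) measure) (\<lambda>z. 4 / (1 + t * (norm z)\<^sup>2)\<^sup>2)"
    using t by (simp add: power_mult_distrib)
  show i3: "integrable (lborel :: (real^2) measure) (\<lambda>z. exp (- (t * (norm z)\<^sup>2)))"
    by (rule Bochner_Integration.integrable_bound[OF i2])
       (use exp_le_inverse_square t in \<open>auto intro!: AE_I2\<close>)
  have "(\<integral>z. exp (- (t * (norm z)\<^sup>2)) \<partial>(lborel :: (real^2) measure)) \<noteq> 0"
  proof
    assume "(\<integral>z. exp (- (t * (norm z)\<^sup>2)) \<partial>(lborel :: (real^2) measure)) = 0"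
    hence "AE z in (lborel :: (real^2) measure). exp (- (t * (norm z)\<^sup>2)) = 0"
      using integral_nonneg_eq_0_iff_AE[OF i3] by auto
    hence "(UNIV :: (real^2) set) \<in> null_sets lborel" by (subst AE_iff_null_sets) auto
    thus False by (simp add: null_sets_def)
  qed
  moreover have "(\<integral>z. exp (- (t * (norm z)\<^sup>2)) \<partial>(lborel :: (real^2) measure)) \<ge> 0"
    by (intro Bochner_Integration.integral_nonneg) simp
  ultimately show "(\<integral>z. exp (- (t * (norm z)\<^sup>2)) \<partial>(lborel :: (real^2) measure)) > 0"
    by (metis less_eq_real_def)
qed

text \<open>A Gaussian is, up to a constant, the convolution square of a narrower Gaussian.\<close>

lemma gauss_kernel_psd:
  fixes \<rho> :: "real ^ 2 \<Rightarrow> real"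
  assumes rho: "integrable lborel \<rho>" and t: "t > 0"
  shows "integrable (lborel \<Otimes>\<^sub>M lborel) (\<lambda>p. \<rho> (fst p) * \<rho> (snd p) * exp (- (t * (norm (fst p - snd p))\<^sup>2)))"
    "(\<integral>p. \<rho> (fst p) * \<rho> (snd p) * exp (- (t * (norm (fst p - snd p))\<^sup>2)) \<partial>(lborel \<Otimes>\<^sub>M lborel)) \<ge> 0"
proof -
  have [measurable]: "\<rho> \<in> borel_measurable borel" using rho by auto
  define P where "P = (lborel :: (real^2) measure) \<Otimes>\<^sub>M (lborel :: (real^2) measure)"
  interpret P: sigma_finite_measure P unfolding P_def lborel_prod by (rule sigma_finite_lborel)
  interpret Q: pair_sigma_finite P "lborel :: (real^2) measure" ..
  have [measurable_cong]: "sets P = sets (borel \<Otimes>\<^sub>M borel)" unfolding P_def by (intro sets_pair_measure_cong) auto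
  define E where "E p = exp (- (t * (norm (fst p - snd p))\<^sup>2))" for p :: "(real^2) \<times> (real^2)"
  have rr: "integrable P (\<lambda>p. \<rho> (fst p) * \<rho> (snd p))"
    unfolding P_def by (rule lborel_pair.integrable_tensor[OF rho rho])
  have E01: "0 \<le> E p" "E p \<le> 1" for p using t by (auto simp: E_def)
  have [measurable]: "E \<in> borel_measurable P" unfolding E_def[abs_def] P_def lborel_prod
    by (simp, intro borel_measurable_continuous_onI continuous_intros)
  show iE: "integrable (lborel \<Otimes>\<^sub>M lborel) (\<lambda>p. \<rho> (fst p) * \<rho> (snd p) * exp (- (t * (norm (fst p - snd p))\<^sup>2)))"
    unfolding E_def[symmetric] P_def[symmetric]
  proof (rule Bochner_Integration.integrable_bound[OF rr])
    show "AE p in P. norm (\<rho> (fst p) * \<rho> (snd p) * E p) \<le> norm (\<rho> (fst p) * \<rho> (snd p))"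
      using E01 by (intro AE_I2) (auto simp: abs_mult intro!: mult_left_le)
  qed measurable
  define c where "c = (\<integral>z. exp (- (4 * t * (norm z)\<^sup>2)) \<partial>(lborel :: (real^2) measure))"
  have c: "c > 0" and ci: "integrable (lborel :: (real^2) measure) (\<lambda>z. exp (- (4 * t * (norm z)\<^sup>2)))"
    using gauss_integrable[of "4 * t"] t by (auto simp: c_def)
  define G where "G x z = exp (- (2 * t * (norm (x - z))\<^sup>2))" for x z :: "real^2"
  have GG: "G x z * G y z = E (x, y) * exp (- (4 * t * (norm (z + (-1/2) *\<^sub>R (x + y)))\<^sup>2))" for x y z
  proof -
    have "G x z * G y z = exp (- (t * (2 * (norm (x - z))\<^sup>2 + 2 * (norm (y - z))\<^sup>2)))"
      by (simp add: G_def exp_add[symmetric] algebra_simps)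
    also have "\<dots> = exp (- (t * (norm (x - y))\<^sup>2)) * exp (- (4 * t * (norm (z + (-1/2) *\<^sub>R (x + y)))\<^sup>2))"
      unfolding parallelogram_gauss exp_add[symmetric] by (simp add: algebra_simps)
    finally show ?thesis by (simp add: E_def)
  qed
  have iG: "integrable lborel (\<lambda>z. G x z * G y z)" for x y
    unfolding GG by (intro integrable_mult_right lborel_integrable_shift[OF ci])
  have intG: "(\<integral>z. G x z * G y z \<partial>lborel) = E (x, y) * c" for x y
    unfolding GG c_def by (subst integral_mult_right_zero, subst lborel_integral_shift) auto
  \<comment> \<open>The same triple integral is read twice: over z first it is c times the Gaussian
    form, over the pair first it is the integral of a square.\<close>
  define H where "H p z = \<rho> (fst p) * \<rho> (snd p) * (G (fst p) z * G (snd p) z)" for p z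
  have G0: "G x z \<ge> 0" for x z by (simp add: G_def)
  have mG: "(\<lambda>u. G (fst u) (snd u)) \<in> borel_measurable (borel \<Otimes>\<^sub>M borel)"
    unfolding G_def borel_prod by (intro borel_measurable_continuous_onI continuous_intros)
  have [measurable]: "(\<lambda>p. G (fst (fst p)) (snd p)) \<in> borel_measurable (P \<Otimes>\<^sub>M lborel)"
     "(\<lambda>p. G (snd (fst p)) (snd p)) \<in> borel_measurable (P \<Otimes>\<^sub>M lborel)"
    using measurable_compose[OF _ mG, of "\<lambda>p. (fst (fst p), snd p)" "P \<Otimes>\<^sub>M lborel"]
      measurable_compose[OF _ mG, of "\<lambda>p. (snd (fst p), snd p)" "P \<Otimes>\<^sub>M lborel"] by simp_all
  have mH: "(\<lambda>(p, z). H p z) \<in> borel_measurable (P \<Otimes>\<^sub>M lborel)"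
    unfolding H_def split_beta by measurable
  have iH: "integrable (P \<Otimes>\<^sub>M lborel) (\<lambda>(p, z). H p z)"
  proof (rule Q.Fubini_integrable[OF mH])
    have "(\<lambda>p. \<integral>z. norm (case (p, z) of (p, z) \<Rightarrow> H p z) \<partial>lborel) = (\<lambda>p. c * norm (\<rho> (fst p) * \<rho> (snd p) * E p))"
    proof
      fix p
      have "norm (H p z) = norm (\<rho> (fst p) * \<rho> (snd p)) * (G (fst p) z * G (snd p) z)" for z
        using G0 by (simp add: H_def abs_mult)
      thus "(\<integral>z. norm (case (p, z) of (p, z) \<Rightarrow> H p z) \<partial>lborel) = c * norm (\<rho> (fst p) * \<rho> (snd p) * E p)"
        using E01(1)[of p] by (simp add: intG abs_mult)
    qed
    thus "integrable P (\<lambda>p. \<integral>z. norm (case (p, z) of (p, z) \<Rightarrow> H p z) \<partial>lborel)"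
      using iE unfolding E_def[symmetric] P_def[symmetric] by simp
    show "AE p in P. integrable lborel (\<lambda>z. case (p, z) of (p, z) \<Rightarrow> H p z)"
      by (intro AE_I2) (simp add: H_def iG)
  qed
  have "c * (\<integral>p. \<rho> (fst p) * \<rho> (snd p) * E p \<partial>P) = (\<integral>p. \<integral>z. H p z \<partial>lborel \<partial>P)"
    by (simp add: H_def intG) (simp add: mult_ac)
  also have "\<dots> = (\<integral>z. \<integral>p. H p z \<partial>P \<partial>lborel)"
    using Q.Fubini_integral[OF iH] by simp
  also have "\<dots> \<ge> 0"
  proof (rule Bochner_Integration.integral_nonneg)
    fix z
    have [measurable]: "(\<lambda>x. G x z) \<in> borel_measurable borel" unfolding G_def by measurable
    have i: "integrable lborel (\<lambda>x. \<rho> x * G x z)"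
    proof (rule Bochner_Integration.integrable_bound[OF rho])
      show "AE x in lborel. norm (\<rho> x * G x z) \<le> norm (\<rho> x)"
        using t by (intro AE_I2) (auto simp: G_def abs_mult intro!: mult_left_le)
    qed measurable
    have "(\<integral>p. H p z \<partial>P) = (\<integral>p. (\<rho> (fst p) * G (fst p) z) * (\<rho> (snd p) * G (snd p) z) \<partial>P)"
      by (simp add: H_def mult_ac)
    also have "\<dots> = (\<integral>x. \<rho> x * G x z \<partial>lborel) * (\<integral>x. \<rho> x * G x z \<partial>lborel)"
      unfolding P_def by (rule lborel_pair.integrable_tensor(2)[OF i i])
    finally show "(\<integral>p. H p z \<partial>P) \<ge> 0" by simp
  qed
  finally show "(\<integral>p. \<rho> (fst p) * \<rho> (snd p) * exp (- (t * (norm (fst p - snd p))\<^sup>2)) \<partial>(lborel \<Otimes>\<^sub>M lborel)) \<ge> 0"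
    using c by (simp add: E_def P_def zero_le_mult_iff)
qed

text \<open>Frullani's integral for |x - y|^2 represents twice the logarithm. At each t > 0 the
  constant part contributes a multiple of the square of the total mass, which is 0, and the Gaussian
  form enters with a minus sign.\<close>

theorem log_energy_nonpos:
  fixes \<rho> :: "real ^ 2 \<Rightarrow> real"
  assumes rho: "integrable lborel \<rho>" and neutral: "(\<integral>x. \<rho> x \<partial>lborel) = 0"
    and int: "integrable (lborel \<Otimes>\<^sub>M lborel) (\<lambda>p. ln (norm (fst p - snd p)) * (\<rho> (fst p) * \<rho> (snd p)))"
  shows "(\<integral>p. ln (norm (fst p - snd p)) * (\<rho> (fst p) * \<rho> (snd p)) \<partial>(lborel \<Otimes>\<^sub>M lborel)) \<le> 0"
proof -
  have [measurable]: "\<rho> \<in> borel_measurable borel" using rho by auto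
  define P where "P = (lborel :: (real^2) measure) \<Otimes>\<^sub>M (lborel :: (real^2) measure)"
  interpret P: sigma_finite_measure P unfolding P_def lborel_prod by (rule sigma_finite_lborel)
  interpret Q: pair_sigma_finite P "lborel :: real measure" ..
  have [measurable_cong]: "sets P = sets (borel \<Otimes>\<^sub>M borel)" unfolding P_def by (intro sets_pair_measure_cong) auto
  define r where "r p = (norm (fst p - snd p))\<^sup>2" for p :: "(real^2) \<times> (real^2)"
  have [measurable]: "r \<in> borel_measurable P" unfolding r_def[abs_def] P_def lborel_prod
    by (simp, intro borel_measurable_continuous_onI continuous_intros)
  have r0: "r p \<ge> 0" for p by (simp add: r_def)
  have lnr: "ln (r p) = 2 * ln (norm (fst p - snd p))" for p
    by (cases "fst p = snd p") (auto simp: r_def ln_realpow)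
  define H where "H p t = \<rho> (fst p) * \<rho> (snd p) * frullani (r p) t" for p t
  have mH: "(\<lambda>(p, t). H p t) \<in> borel_measurable (P \<Otimes>\<^sub>M lborel)"
    unfolding H_def frullani_def split_beta by measurable
  have iH: "integrable (P \<Otimes>\<^sub>M lborel) (\<lambda>(p, t). H p t)"
  proof (rule Q.Fubini_integrable[OF mH])
    have "(\<integral>t. norm (H p t) \<partial>lborel) = 2 * norm (ln (norm (fst p - snd p)) * (\<rho> (fst p) * \<rho> (snd p)))" for p
      using has_bochner_integral_integral_eq[OF has_bochner_integral_frullani(2)[OF r0[of p]]]
      by (simp add: H_def abs_mult lnr)
    thus "integrable P (\<lambda>p. \<integral>t. norm (case (p, t) of (p, t) \<Rightarrow> H p t) \<partial>lborel)"
      using int unfolding P_def[symmetric] by simp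
    show "AE p in P. integrable lborel (\<lambda>t. case (p, t) of (p, t) \<Rightarrow> H p t)"
      using has_bochner_integral_frullani(1)[OF r0] by (intro AE_I2) (auto simp: H_def intro: integrable.intros)
  qed
  have "2 * (\<integral>p. ln (norm (fst p - snd p)) * (\<rho> (fst p) * \<rho> (snd p)) \<partial>P) = (\<integral>p. \<integral>t. H p t \<partial>lborel \<partial>P)"
    by (simp add: H_def has_bochner_integral_integral_eq[OF has_bochner_integral_frullani(1)[OF r0]] lnr mult_ac)
  also have "\<dots> = (\<integral>t. \<integral>p. H p t \<partial>P \<partial>lborel)"
    using Q.Fubini_integral[OF iH] by simp
  finally have eq: "2 * (\<integral>p. ln (norm (fst p - snd p)) * (\<rho> (fst p) * \<rho> (snd p)) \<partial>P)
    = - (\<integral>t. - (\<integral>p. H p t \<partial>P) \<partial>lborel)" by simp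
  have "(\<integral>t. - (\<integral>p. H p t \<partial>P) \<partial>lborel) \<ge> 0"
  proof (rule Bochner_Integration.integral_nonneg)
    fix t :: real
    show "- (\<integral>p. H p t \<partial>P) \<ge> 0"
    proof (cases "t > 0")
      case False
      thus ?thesis by (simp add: H_def frullani_def)
    next
      case True
      \<comment> \<open>\<open>frullani\<close> is set to 0 at R = 0, where the exponential quotient
        is not; the diagonal is a null set, so the quotient may be used in the integral.\<close>
      have "AE p in P. fst p \<noteq> snd p"
        unfolding P_def
      proof (rule lborel_pair.AE_pair_measure)
        show "AE x in (lborel :: (real^2) measure). AE y in lborel. fst (x, y) \<noteq> snd (x, y)"
        proof (rule AE_I2)
          fix x :: "real^2"
          show "AE y in lborel. fst (x, y) \<noteq> snd (x, y)"
            using AE_lborel_singleton[of x] by (auto elim!: eventually_mono)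
        qed
      qed measurable
      hence "AE p in P. H p t = (1 / t) * (exp (- t) * (\<rho> (fst p) * \<rho> (snd p)) - \<rho> (fst p) * \<rho> (snd p) * exp (- (t * r p)))"
        by eventually_elim
          (use True in \<open>simp add: H_def frullani_def r_def right_diff_distrib diff_divide_distrib mult_ac\<close>)
      hence "(\<integral>p. H p t \<partial>P) = (\<integral>p. (1 / t) * (exp (- t) * (\<rho> (fst p) * \<rho> (snd p)) - \<rho> (fst p) * \<rho> (snd p) * exp (- (t * r p))) \<partial>P)"
        unfolding H_def frullani_def by (intro integral_cong_AE) measurable
      also have "\<dots> = (1 / t) * (exp (- t) * (\<integral>p. \<rho> (fst p) * \<rho> (snd p) \<partial>P) - (\<integral>p. \<rho> (fst p) * \<rho> (snd p) * exp (- (t * r p)) \<partial>P))"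
        unfolding P_def r_def
        by (subst integral_mult_right_zero, subst Bochner_Integration.integral_diff)
           (auto intro!: integrable_mult_right lborel_pair.integrable_tensor[OF rho rho] gauss_kernel_psd(1)[OF rho True])
      also have "(\<integral>p. \<rho> (fst p) * \<rho> (snd p) \<partial>P) = 0"
        unfolding P_def lborel_pair.integrable_tensor(2)[OF rho rho] by (simp add: neutral)
      finally show ?thesis
        using gauss_kernel_psd(2)[OF rho True] True by (simp add: P_def r_def)
    qed
  qed
  thus ?thesis using eq unfolding P_def by linarith
qed

subsection \<open>A nonlinear integral equation with a nonnegative kernel\<close>

lemma ln_chord:
  fixes a b s :: real
  assumes "0 < a" "a < b" "a \<le> s" "s \<le> b"
  shows "ln a + (s - a) / (b - a) * (ln b - ln a) \<le> ln s"
proof -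
  define u where "u = (s - a) / (b - a)"
  have u: "0 \<le> u" "u \<le> 1" using assms by (auto simp: u_def)
  have "concave_on {0<..} ln" by (rule ln_concave)
  hence "(1 - u) * ln a + u * ln b \<le> ln ((1 - u) *\<^sub>R a + u *\<^sub>R b)"
    using u assms by (intro concave_onD) auto
  also have "(1 - u) *\<^sub>R a + u *\<^sub>R b = a + u * (b - a)" by (simp add: algebra_simps)
  also have "\<dots> = s" using assms by (simp add: u_def)
  finally show ?thesis by (simp add: u_def[symmetric] algebra_simps)
qed

text \<open>Both follow from ln r <= r - 1 applied to a quotient and to its inverse. They give the
  strong monotonicity and the Lipschitz constant of ln that decide the contraction rate.\<close>

lemma ln_diff_bounds:
  fixes a b u v :: real
  assumes "0 < a" "a \<le> u" "u \<le> b" "a \<le> v" "v \<le> b"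
  shows "(u - v)\<^sup>2 / b \<le> (u - v) * (ln u - ln v)" "\<bar>ln u - ln v\<bar> \<le> \<bar>u - v\<bar> / a"
proof -
  have *: "(y - x) / b \<le> ln y - ln x \<and> ln y - ln x \<le> (y - x) / a" if "a \<le> x" "x \<le> y" "y \<le> b" for x y
  proof
    have xy: "x > 0" "y > 0" using that assms by auto
    have "ln y - ln x = ln (y / x)" using xy by (simp add: ln_div)
    also have "\<dots> \<le> y / x - 1" using xy by (intro ln_le_minus_one) auto
    also have "\<dots> = (y - x) / x" using xy by (simp add: field_simps)
    also have "\<dots> \<le> (y - x) / a" using that assms by (intro divide_left_mono) auto
    finally show "ln y - ln x \<le> (y - x) / a" .
    have "ln x - ln y = ln (x / y)" using xy by (simp add: ln_div)
    also have "\<dots> \<le> x / y - 1" using xy by (intro ln_le_minus_one) auto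
    also have "\<dots> = - ((y - x) / y)" using xy by (simp add: field_simps)
    finally have "(y - x) / y \<le> ln y - ln x" by simp
    moreover have "(y - x) / b \<le> (y - x) / y" using that xy by (intro divide_left_mono) auto
    ultimately show "(y - x) / b \<le> ln y - ln x" by simp
  qed
  consider "v \<le> u" | "u \<le> v" by linarith
  thus "(u - v)\<^sup>2 / b \<le> (u - v) * (ln u - ln v)"
  proof cases
    case 1
    have "(u - v) * ((u - v) / b) \<le> (u - v) * (ln u - ln v)"
      using *[of v u] assms 1 by (intro mult_left_mono) auto
    thus ?thesis by (simp add: power2_eq_square)
  next
    case 2
    have "(v - u) * ((v - u) / b) \<le> (v - u) * (ln v - ln u)"
      using *[of u v] assms 2 by (intro mult_left_mono) auto
    thus ?thesis by (simp add: power2_eq_square algebra_simps)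
  qed
  show "\<bar>ln u - ln v\<bar> \<le> \<bar>u - v\<bar> / a"
  proof (cases "v \<le> u")
    case True
    have "ln v \<le> ln u" using True assms by (intro ln_mono) auto
    thus ?thesis using *[of v u] assms True by simp
  next
    case False
    have "ln u \<le> ln v" using False assms by (intro ln_mono) auto
    thus ?thesis using *[of u v] assms False by simp
  qed
qed

text \<open>Symmetry and a uniform bound on the row integrals are the hypotheses of Schur's test.
  Positivity is asked for on mean-zero functions, which is what the energy of a neutral density
  provides.\<close>

locale positive_kernel = finite_measure \<mu> for \<mu> :: "'a measure" +
  fixes \<kappa> :: "'a \<Rightarrow> 'a \<Rightarrow> real" and B :: real
  assumes kernel_meas [measurable]: "(\<lambda>(x, y). \<kappa> x y) \<in> borel_measurable (\<mu> \<Otimes>\<^sub>M \<mu>)"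
    and kernel_nonneg: "\<And>x y. x \<in> space \<mu> \<Longrightarrow> y \<in> space \<mu> \<Longrightarrow> \<kappa> x y \<ge> 0"
    and kernel_sym: "\<And>x y. x \<in> space \<mu> \<Longrightarrow> y \<in> space \<mu> \<Longrightarrow> \<kappa> x y = \<kappa> y x"
    and kernel_int: "\<And>x. x \<in> space \<mu> \<Longrightarrow> integrable \<mu> (\<kappa> x)"
    and kernel_bound: "\<And>x. x \<in> space \<mu> \<Longrightarrow> (\<integral>y. \<kappa> x y \<partial>\<mu>) \<le> B"
    and B_pos: "B > 0"
    and mass_pos: "measure \<mu> (space \<mu>) > 0"
    and neutral_psd: "\<And>d C. d \<in> borel_measurable \<mu> \<Longrightarrow> (\<And>x. x \<in> space \<mu> \<Longrightarrow> \<bar>d x\<bar> \<le> C) \<Longrightarrow> (\<integral>x. d x \<partial>\<mu>) = 0 \<Longrightarrow>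
      (\<integral>x. d x * (\<integral>y. \<kappa> x y * d y \<partial>\<mu>) \<partial>\<mu>) \<ge> 0"
begin

sublocale pair: pair_sigma_finite \<mu> \<mu> ..

definition m :: real where "m = measure \<mu> (space \<mu>)"
definition G :: "('a \<Rightarrow> real) \<Rightarrow> 'a \<Rightarrow> real" where "G d x = (\<integral>y. \<kappa> x y * d y \<partial>\<mu>)"

lemma m_pos: "m > 0" using mass_pos by (simp add: m_def)

lemma int_bounded:
  fixes d :: "'a \<Rightarrow> real"
  assumes "d \<in> borel_measurable \<mu>" "\<And>x. x \<in> space \<mu> \<Longrightarrow> \<bar>d x\<bar> \<le> C"
  shows "integrable \<mu> d"
  by (rule integrable_const_bound[of _ C]) (use assms in \<open>auto intro!: AE_I2\<close>)

lemma kernel_meas2 [measurable]: "x \<in> space \<mu> \<Longrightarrow> (\<lambda>y. \<kappa> x y) \<in> borel_measurable \<mu>"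
  using kernel_int by auto

lemma kernel_int_bounded:
  assumes d [measurable]: "d \<in> borel_measurable \<mu>" and C: "\<And>x. x \<in> space \<mu> \<Longrightarrow> \<bar>d x\<bar> \<le> C" and x: "x \<in> space \<mu>"
  shows "integrable \<mu> (\<lambda>y. \<kappa> x y * d y)"
proof (rule Bochner_Integration.integrable_bound[where f="\<lambda>y. C * \<kappa> x y"])
  show "integrable \<mu> (\<lambda>y. C * \<kappa> x y)" using kernel_int[OF x] by simp
  show "AE y in \<mu>. norm (\<kappa> x y * d y) \<le> norm (C * \<kappa> x y)"
    using C kernel_nonneg[OF x] by (intro AE_I2) (auto simp: abs_mult mult.commute intro!: mult_right_mono order_trans[OF C])
  show "(\<lambda>y. \<kappa> x y * d y) \<in> borel_measurable \<mu>" using x by measurable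
qed

lemma G_meas [measurable]:
  assumes [measurable]: "d \<in> borel_measurable \<mu>"
  shows "G d \<in> borel_measurable \<mu>"
  unfolding G_def[abs_def] by measurable

lemma G_bound:
  assumes d: "d \<in> borel_measurable \<mu>" and C: "\<And>x. x \<in> space \<mu> \<Longrightarrow> \<bar>d x\<bar> \<le> C" and x: "x \<in> space \<mu>"
  shows "\<bar>G d x\<bar> \<le> C * B"
proof -
  have C0: "C \<ge> 0" using C[OF x] by linarith
  have "\<bar>G d x\<bar> \<le> (\<integral>y. \<bar>\<kappa> x y * d y\<bar> \<partial>\<mu>)" unfolding G_def by (rule integral_abs_bound)
  also have "\<dots> \<le> (\<integral>y. C * \<kappa> x y \<partial>\<mu>)"
    using kernel_int[OF x] C kernel_nonneg[OF x]
    by (intro integral_mono integrable_abs kernel_int_bounded[OF d C x])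
       (auto simp: abs_mult mult.commute intro!: mult_right_mono)
  also have "\<dots> \<le> C * B" using kernel_bound[OF x] C0 by (simp add: mult_left_mono)
  finally show ?thesis .
qed

lemma G_nonneg:
  assumes "\<And>y. y \<in> space \<mu> \<Longrightarrow> d y \<ge> 0" "x \<in> space \<mu>" shows "G d x \<ge> 0"
  unfolding G_def using assms kernel_nonneg by (intro Bochner_Integration.integral_nonneg_AE AE_I2) auto

lemma kernel_pair_int:
  assumes d [measurable]: "d \<in> borel_measurable \<mu>" and C: "\<And>x. x \<in> space \<mu> \<Longrightarrow> \<bar>d x\<bar> \<le> C"
  shows "integrable (\<mu> \<Otimes>\<^sub>M \<mu>) (\<lambda>(x, y). \<kappa> x y * d y)"
proof (rule pair.Fubini_integrable)
  show "(\<lambda>(x, y). \<kappa> x y * d y) \<in> borel_measurable (\<mu> \<Otimes>\<^sub>M \<mu>)"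
    using kernel_meas unfolding split_beta by measurable
  have "integrable \<mu> (\<lambda>x. G (\<lambda>y. \<bar>d y\<bar>) x)"
    by (rule int_bounded[where C="C * B"]) (auto intro!: G_bound C)
  also have "integrable \<mu> (\<lambda>x. G (\<lambda>y. \<bar>d y\<bar>) x) = integrable \<mu> (\<lambda>x. \<integral>y. norm (case (x, y) of (x, y) \<Rightarrow> \<kappa> x y * d y) \<partial>\<mu>)"
    unfolding G_def by (intro Bochner_Integration.integrable_cong refl Bochner_Integration.integral_cong)
       (use kernel_nonneg in \<open>auto simp: abs_mult\<close>)
  finally show "integrable \<mu> (\<lambda>x. \<integral>y. norm (case (x, y) of (x, y) \<Rightarrow> \<kappa> x y * d y) \<partial>\<mu>)" .
  show "AE x in \<mu>. integrable \<mu> (\<lambda>y. case (x, y) of (x, y) \<Rightarrow> \<kappa> x y * d y)"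
    by (intro AE_I2) (simp add: kernel_int_bounded[OF d C])
qed

text \<open>Fubini and symmetry turn the column integrals of the kernel into row integrals.\<close>

lemma integral_G_le:
  assumes d [measurable]: "d \<in> borel_measurable \<mu>" and C: "\<And>x. x \<in> space \<mu> \<Longrightarrow> \<bar>d x\<bar> \<le> C"
    and d0: "\<And>x. x \<in> space \<mu> \<Longrightarrow> d x \<ge> 0"
  shows "(\<integral>x. G d x \<partial>\<mu>) \<le> B * (\<integral>x. d x \<partial>\<mu>)"
proof -
  have "(\<integral>x. G d x \<partial>\<mu>) = (\<integral>y. (\<integral>x. \<kappa> x y * d y \<partial>\<mu>) \<partial>\<mu>)"
    unfolding G_def using pair.Fubini_integral[OF kernel_pair_int[OF d C]] by simp
  also have "\<dots> = (\<integral>y. (\<integral>x. \<kappa> y x \<partial>\<mu>) * d y \<partial>\<mu>)"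
    by (intro Bochner_Integration.integral_cong refl) (simp add: kernel_sym cong: Bochner_Integration.integral_cong)
  also have "\<dots> \<le> (\<integral>y. B * d y \<partial>\<mu>)"
  proof (rule integral_mono)
    show iB: "integrable \<mu> (\<lambda>y. B * d y)" using int_bounded[OF d C] by simp
    show "integrable \<mu> (\<lambda>y. (\<integral>x. \<kappa> y x \<partial>\<mu>) * d y)"
    proof (rule Bochner_Integration.integrable_bound[OF iB])
      have "(\<lambda>y. (\<integral>x. \<kappa> y x \<partial>\<mu>)) \<in> borel_measurable \<mu>" using G_meas[of "\<lambda>_. 1"] by (simp add: G_def[abs_def])
      thus "(\<lambda>y. (\<integral>x. \<kappa> y x \<partial>\<mu>) * d y) \<in> borel_measurable \<mu>" by measurable
      show "AE y in \<mu>. norm ((\<integral>x. \<kappa> y x \<partial>\<mu>) * d y) \<le> norm (B * d y)"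
      proof (rule AE_I2)
        fix y assume y: "y \<in> space \<mu>"
        have "0 \<le> (\<integral>x. \<kappa> y x \<partial>\<mu>)" using G_nonneg[of "\<lambda>_. 1" y] y by (simp add: G_def)
        thus "norm ((\<integral>x. \<kappa> y x \<partial>\<mu>) * d y) \<le> norm (B * d y)"
          using kernel_bound[OF y] d0[OF y] B_pos by (simp add: abs_mult mult_right_mono)
      qed
    qed
  qed (use kernel_bound d0 in \<open>auto intro!: mult_right_mono\<close>)
  finally show ?thesis by simp
qed

text \<open>Schur's test. The pointwise inequality (G d)^2 <= B G (d^2) comes from expanding the
  nonnegative integral of the kernel against (d - G d x / B)^2; integrating it and applying
  \<open>integral_G_le\<close> yields the second factor B.\<close>

lemma G_L2:
  assumes d [measurable]: "d \<in> borel_measurable \<mu>" and C: "\<And>x. x \<in> space \<mu> \<Longrightarrow> \<bar>d x\<bar> \<le> C"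
  shows "(\<integral>x. (G d x)\<^sup>2 \<partial>\<mu>) \<le> B\<^sup>2 * (\<integral>x. (d x)\<^sup>2 \<partial>\<mu>)"
proof -
  have C2: "\<bar>(d x)\<^sup>2\<bar> \<le> C\<^sup>2" if "x \<in> space \<mu>" for x
    using power_mono[OF C[OF that], of 2] by simp
  have pt: "(G d x)\<^sup>2 \<le> B * G (\<lambda>y. (d y)\<^sup>2) x" if x: "x \<in> space \<mu>" for x
  proof -
    define s where "s = G d x"
    have i1: "integrable \<mu> (\<lambda>y. \<kappa> x y * d y)" by (rule kernel_int_bounded[OF d C x])
    have i2: "integrable \<mu> (\<lambda>y. \<kappa> x y * (d y)\<^sup>2)" by (rule kernel_int_bounded[OF _ C2 x]) auto
    have "0 \<le> (\<integral>y. \<kappa> x y * (d y - s / B)\<^sup>2 \<partial>\<mu>)"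
      using kernel_nonneg[OF x] by (intro integral_nonneg_AE AE_I2) auto
    also have "(\<lambda>y. \<kappa> x y * (d y - s / B)\<^sup>2) = (\<lambda>y. \<kappa> x y * (d y)\<^sup>2 - (2 * s / B) * (\<kappa> x y * d y) + (s / B)\<^sup>2 * \<kappa> x y)"
      by (simp add: fun_eq_iff power2_diff algebra_simps)
    also have "(\<integral>y. \<kappa> x y * (d y)\<^sup>2 - (2 * s / B) * (\<kappa> x y * d y) + (s / B)\<^sup>2 * \<kappa> x y \<partial>\<mu>)
      = G (\<lambda>y. (d y)\<^sup>2) x - (2 * s / B) * s + (s / B)\<^sup>2 * (\<integral>y. \<kappa> x y \<partial>\<mu>)"
      using i1 i2 kernel_int[OF x] by (simp add: G_def s_def)
    also have "\<dots> \<le> G (\<lambda>y. (d y)\<^sup>2) x - (2 * s / B) * s + (s / B)\<^sup>2 * B"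
      by (intro add_left_mono mult_left_mono kernel_bound x) simp
    also have "\<dots> = G (\<lambda>y. (d y)\<^sup>2) x - s\<^sup>2 / B"
      using B_pos by (simp add: field_simps power2_eq_square)
    finally show ?thesis using B_pos by (simp add: s_def field_simps)
  qed
  have m2: "(\<lambda>y. (d y)\<^sup>2) \<in> borel_measurable \<mu>" by measurable
  have "(\<integral>x. (G d x)\<^sup>2 \<partial>\<mu>) \<le> (\<integral>x. B * G (\<lambda>y. (d y)\<^sup>2) x \<partial>\<mu>)"
  proof (rule integral_mono[OF _ _ pt])
    show "integrable \<mu> (\<lambda>x. (G d x)\<^sup>2)"
    proof (rule int_bounded[where C="(C * B)\<^sup>2"])
      show "\<bar>(G d x)\<^sup>2\<bar> \<le> (C * B)\<^sup>2" if "x \<in> space \<mu>" for x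
        using power_mono[OF G_bound[OF d C that], of 2] by simp
    qed measurable
    show "integrable \<mu> (\<lambda>x. B * G (\<lambda>y. (d y)\<^sup>2) x)"
      by (intro integrable_mult_right int_bounded[where C="C\<^sup>2 * B"] G_bound[OF m2 C2]) measurable
  qed
  also have "\<dots> \<le> B * (B * (\<integral>x. (d x)\<^sup>2 \<partial>\<mu>))"
    using B_pos by (simp add: mult_left_mono integral_G_le[OF m2 C2])
  finally show ?thesis by (simp add: power2_eq_square)
qed

text \<open>The iteration \<open>\<rho> \<mapsto> \<rho> - t (ln \<rho> / 2 + G \<rho> - c)\<close> with \<open>c\<close> the mean of \<open>ln \<rho> / 2 + G \<rho>\<close>
  preserves the mass. Since \<open>G\<close> is nonnegative it also preserves the pointwise bounds, so that no
  truncation of the logarithm is needed, and it contracts in \<open>L\<^sup>2\<close> because \<open>ln\<close> is strongly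
  monotone on bounded intervals and \<open>G\<close> is positive semidefinite on neutral densities.\<close>

definition Phi :: "('a \<Rightarrow> real) \<Rightarrow> 'a \<Rightarrow> real" where "Phi \<rho> x = ln (\<rho> x) / 2 + G \<rho> x"
definition mean :: "('a \<Rightarrow> real) \<Rightarrow> real" where "mean u = (\<integral>x. u x \<partial>\<mu>) / m"
definition step :: "real \<Rightarrow> ('a \<Rightarrow> real) \<Rightarrow> 'a \<Rightarrow> real" where
  "step t \<rho> x = \<rho> x - t * (Phi \<rho> x - mean (Phi \<rho>))"
definition box :: "real \<Rightarrow> real \<Rightarrow> real \<Rightarrow> ('a \<Rightarrow> real) set" where
  "box a b M = {\<rho> \<in> borel_measurable \<mu>. (\<forall>x\<in>space \<mu>. a \<le> \<rho> x \<and> \<rho> x \<le> b) \<and> (\<integral>x. \<rho> x \<partial>\<mu>) = M}"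

section \<open>Pointwise bounds preserved by the iteration\<close>

lemma Phi_bound:
  assumes "0 < a" "\<rho> \<in> box a b M"
  shows "Phi \<rho> \<in> borel_measurable \<mu>" "integrable \<mu> (Phi \<rho>)" "integrable \<mu> \<rho>" "integrable \<mu> (\<lambda>x. ln (\<rho> x))" "integrable \<mu> (G \<rho>)"
proof -
  have r [measurable]: "\<rho> \<in> borel_measurable \<mu>" and b: "\<And>x. x \<in> space \<mu> \<Longrightarrow> a \<le> \<rho> x" "\<And>x. x \<in> space \<mu> \<Longrightarrow> \<rho> x \<le> b"
    using assms by (auto simp: box_def)
  have ab: "\<bar>\<rho> x\<bar> \<le> b" if "x \<in> space \<mu>" for x using b[OF that] assms(1) by simp
  show Pm: "Phi \<rho> \<in> borel_measurable \<mu>" unfolding Phi_def[abs_def] by measurable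
  show "integrable \<mu> \<rho>" by (rule int_bounded[OF r ab])
  show l: "integrable \<mu> (\<lambda>x. ln (\<rho> x))"
  proof (rule int_bounded[where C="\<bar>ln a\<bar> + \<bar>ln b\<bar>"])
    show "\<bar>ln (\<rho> x)\<bar> \<le> \<bar>ln a\<bar> + \<bar>ln b\<bar>" if "x \<in> space \<mu>" for x
    proof -
      have "ln a \<le> ln (\<rho> x)" "ln (\<rho> x) \<le> ln b" using b[OF that] assms(1) by (auto intro!: ln_mono)
      thus ?thesis by linarith
    qed
  qed measurable
  show g: "integrable \<mu> (G \<rho>)" by (rule int_bounded[where C="b * B"]) (auto intro: G_bound[OF r ab])
  show "integrable \<mu> (Phi \<rho>)" unfolding Phi_def[abs_def] using l g by auto
qed

lemma step_mass:
  assumes "0 < a" "\<rho> \<in> box a b M"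
  shows "(\<integral>x. step t \<rho> x \<partial>\<mu>) = M"
proof -
  have "(\<integral>x. step t \<rho> x \<partial>\<mu>) = (\<integral>x. \<rho> x \<partial>\<mu>) - t * ((\<integral>x. Phi \<rho> x \<partial>\<mu>) - mean (Phi \<rho>) * m)"
    unfolding step_def using Phi_bound[OF assms] by (simp add: m_def)
  also have "mean (Phi \<rho>) * m = (\<integral>x. Phi \<rho> x \<partial>\<mu>)" using m_pos by (simp add: mean_def)
  finally show ?thesis using assms(2) by (simp add: box_def)
qed

text \<open>Chosen so that ln (upper M) / 2 = ln (M / m) / 2 + B M / m, the bound on the mean of
  \<open>Phi\<close> that Jensen's inequality and \<open>integral_G_le\<close> give.\<close>

definition upper :: "real \<Rightarrow> real" where "upper M = (M / m) * exp (2 * B * M / m)"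
text \<open>The first entry keeps the bound at most half the mean density M / m. The second makes ln
  (upper / lower) so large that the mean of \<open>Phi\<close> exceeds ln (lower M) / 2 by at least
  upper M * B, the largest possible value of G.\<close>

definition lower :: "real \<Rightarrow> real" where
  "lower M = min (M / (2 * m)) (upper M * exp (- (2 * upper M * B / (M / (2 * m) / upper M))))"

lemma lower_upper:
  assumes M: "M > 0"
  shows "0 < lower M" "lower M < M / m" "M / m < upper M" "lower M < upper M" "0 < upper M"
proof -
  have u: "upper M > 0" using M m_pos by (simp add: upper_def)
  show "0 < upper M" by (rule u)
  show "0 < lower M" using M m_pos u by (simp add: lower_def)
  have "lower M \<le> M / (2 * m)" by (simp add: lower_def)
  also have "\<dots> < M / m" using M m_pos by (simp add: field_simps)
  finally show 1: "lower M < M / m" .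
  have "exp (2 * B * M / m) > 1" using B_pos M m_pos by simp
  hence "(M / m) * 1 < (M / m) * exp (2 * B * M / m)" using M m_pos by (intro mult_strict_left_mono) auto
  thus 2: "M / m < upper M" unfolding upper_def by simp
  show "lower M < upper M" using 1 2 by simp
qed

lemma mean_Phi_upper:
  assumes M: "M > 0" and rho: "\<rho> \<in> box (lower M) (upper M) M"
  shows "mean (Phi \<rho>) \<le> ln (upper M) / 2"
proof -
  note lu = lower_upper[OF M]
  have r [measurable]: "\<rho> \<in> borel_measurable \<mu>" and b: "\<And>x. x \<in> space \<mu> \<Longrightarrow> lower M \<le> \<rho> x" "\<And>x. x \<in> space \<mu> \<Longrightarrow> \<rho> x \<le> upper M"
    and rM: "(\<integral>x. \<rho> x \<partial>\<mu>) = M"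
    using rho by (auto simp: box_def)
  note P = Phi_bound[OF lu(1) rho]
  \<comment> \<open>Jensen's inequality for ln is obtained from the tangent at the mean density
    s0.\<close>
  define s0 where "s0 = M / m"
  have s0: "s0 > 0" using M m_pos by (simp add: s0_def)
  have "(\<integral>x. ln (\<rho> x) \<partial>\<mu>) \<le> (\<integral>x. ln s0 + (\<rho> x - s0) / s0 \<partial>\<mu>)"
  proof (rule integral_mono)
    fix x assume x: "x \<in> space \<mu>"
    have rx: "\<rho> x > 0" using b(1)[OF x] lu(1) by linarith
    have "ln (\<rho> x / s0) \<le> \<rho> x / s0 - 1" using rx s0 by (intro ln_le_minus_one) auto
    thus "ln (\<rho> x) \<le> ln s0 + (\<rho> x - s0) / s0" using rx s0 by (simp add: ln_div diff_divide_distrib)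
  qed (use P in auto)
  also have "\<dots> = ln s0 * m + (M - s0 * m) / s0"
    using P by (simp add: m_def rM mult.commute)
  also have "s0 * m = M" using m_pos by (simp add: s0_def)
  finally have 1: "(\<integral>x. ln (\<rho> x) \<partial>\<mu>) \<le> ln s0 * m" by simp
  have 2: "(\<integral>x. G \<rho> x \<partial>\<mu>) \<le> B * M"
    using integral_G_le[OF r, of "upper M"] b lu(1) rM by force
  have "(\<integral>x. Phi \<rho> x \<partial>\<mu>) \<le> ln s0 * m / 2 + B * M"
    unfolding Phi_def using P 1 2 by simp
  hence "mean (Phi \<rho>) \<le> (ln s0 * m / 2 + B * M) / m"
    unfolding mean_def using m_pos by (intro divide_right_mono) auto
  also have "\<dots> = ln s0 / 2 + B * M / m" using m_pos by (simp add: field_simps)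
  also have "\<dots> = ln (upper M) / 2" unfolding upper_def s0_def[symmetric] using s0 by (simp add: ln_mult_pos)
  finally show ?thesis .
qed

text \<open>The chord of ln over [a, b] bounds the mean of ln \<rho> below by ln a plus a fraction
  of ln b - ln a. Lowering a with b fixed enlarges the gap while the fraction stays above \<theta>,
  so their product can be made to reach 2 b B.\<close>

lemma mean_Phi_lower:
  assumes M: "M > 0" and rho: "\<rho> \<in> box (lower M) (upper M) M"
  shows "ln (lower M) / 2 + upper M * B \<le> mean (Phi \<rho>)"
proof -
  note lu = lower_upper[OF M]
  define a where "a = lower M"
  define b where "b = upper M"
  have r [measurable]: "\<rho> \<in> borel_measurable \<mu>" and bd: "\<And>x. x \<in> space \<mu> \<Longrightarrow> a \<le> \<rho> x" "\<And>x. x \<in> space \<mu> \<Longrightarrow> \<rho> x \<le> b"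
    and rM: "(\<integral>x. \<rho> x \<partial>\<mu>) = M"
    using rho by (auto simp: box_def a_def b_def)
  have ab: "0 < a" "a < b" using lu by (auto simp: a_def b_def)
  note P = Phi_bound[OF lu(1) rho]
  define L where "L = ln b - ln a"
  have L0: "L > 0" using ab by (simp add: L_def)
  have "(\<integral>x. ln a + (\<rho> x - a) / (b - a) * L \<partial>\<mu>) \<le> (\<integral>x. ln (\<rho> x) \<partial>\<mu>)"
  proof (rule integral_mono)
    show "ln a + (\<rho> x - a) / (b - a) * L \<le> ln (\<rho> x)" if "x \<in> space \<mu>" for x
      unfolding L_def by (rule ln_chord[OF ab bd[OF that]])
  qed (use P in auto)
  also have "(\<integral>x. ln a + (\<rho> x - a) / (b - a) * L \<partial>\<mu>) = ln a * m + (M - a * m) / (b - a) * L"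
    using P by (simp add: m_def rM mult.commute)
  finally have "(ln a * m + (M - a * m) / (b - a) * L) / 2 \<le> (\<integral>x. ln (\<rho> x) \<partial>\<mu>) / 2"
    by (rule divide_right_mono) simp
  also have "\<dots> \<le> (\<integral>x. ln (\<rho> x) \<partial>\<mu>) / 2 + (\<integral>x. G \<rho> x \<partial>\<mu>)"
  proof -
    have "(\<integral>x. G \<rho> x \<partial>\<mu>) \<ge> 0"
      by (intro integral_nonneg_AE AE_I2 G_nonneg) (use bd ab in force)+
    thus ?thesis by simp
  qed
  also have "\<dots> = (\<integral>x. Phi \<rho> x \<partial>\<mu>)" unfolding Phi_def using P by simp
  also have "\<dots> = mean (Phi \<rho>) * m" using m_pos by (simp add: mean_def)
  finally have "(ln a * m + (M - a * m) / (b - a) * L) / 2 / m \<le> mean (Phi \<rho>)"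
    using m_pos by (simp add: field_simps)
  moreover have "(ln a * m + (M - a * m) / (b - a) * L) / 2 / m = ln a / 2 + (M / m - a) / (b - a) * L / 2"
  proof -
    have eq: "M - a * m = m * (M / m - a)" using m_pos by (simp add: right_diff_distrib)
    have "(ln a * m + m * e / (b - a) * L) / 2 / m = ln a / 2 + e / (b - a) * L / 2" for e
      using m_pos by (simp add: add_divide_distrib)
    thus ?thesis unfolding eq .
  qed
  ultimately have 1: "ln a / 2 + (M / m - a) / (b - a) * L / 2 \<le> mean (Phi \<rho>)" by simp
  define \<theta> where "\<theta> = M / (2 * m) / b"
  have th: "\<theta> > 0" using M m_pos ab by (simp add: \<theta>_def)
  have "\<theta> \<le> (M / m - a) / (b - a)"
    unfolding \<theta>_def
  proof (rule frac_le)
    have "a \<le> M / (2 * m)" by (simp add: a_def lower_def)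
    moreover have "M / m = M / (2 * m) + M / (2 * m)" by (simp add: field_simps)
    ultimately show "M / (2 * m) \<le> M / m - a" "0 \<le> M / m - a" using M m_pos lu(2) by (auto simp: a_def)
  qed (use ab in auto)
  moreover have "L \<ge> 2 * b * B / \<theta>"
  proof -
    have "a \<le> b * exp (- (2 * b * B / \<theta>))" by (simp add: a_def b_def lower_def \<theta>_def)
    hence "ln a \<le> ln (b * exp (- (2 * b * B / \<theta>)))" using ab by (intro ln_mono) auto
    also have "\<dots> = ln b - 2 * b * B / \<theta>" using ab by (simp add: ln_mult_pos)
    finally show ?thesis by (simp add: L_def)
  qed
  ultimately have "\<theta> * (2 * b * B / \<theta>) \<le> (M / m - a) / (b - a) * L"
    using th ab B_pos by (intro mult_mono) auto
  moreover have "\<theta> * (2 * b * B / \<theta>) = 2 * b * B" using th by simp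
  ultimately have "2 * b * B \<le> (M / m - a) / (b - a) * L" by (simp only:)
  hence "2 * b * B / 2 \<le> (M / m - a) / (b - a) * L / 2" by (rule divide_right_mono) simp
  hence "b * B \<le> (M / m - a) / (b - a) * L / 2" by simp
  thus ?thesis using 1 by (simp add: a_def b_def)
qed

text \<open>For t <= lower M the map u - t ln u / 2 increases above lower M, so its extreme values
  sit at the two bounds. There the estimates close: G >= 0 against the upper bound for the mean of
  \<open>Phi\<close>, and G <= upper M * B against the lower one.\<close>

lemma step_box:
  assumes M: "M > 0" and rho: "\<rho> \<in> box (lower M) (upper M) M" and t: "0 < t" "t \<le> lower M"
  shows "step t \<rho> \<in> box (lower M) (upper M) M"
proof -
  note lu = lower_upper[OF M]
  have r [measurable]: "\<rho> \<in> borel_measurable \<mu>" and b: "\<And>x. x \<in> space \<mu> \<Longrightarrow> lower M \<le> \<rho> x" "\<And>x. x \<in> space \<mu> \<Longrightarrow> \<rho> x \<le> upper M"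
    using rho by (auto simp: box_def)
  note P = Phi_bound[OF lu(1) rho]
  have ab: "\<bar>\<rho> x\<bar> \<le> upper M" if "x \<in> space \<mu>" for x using b[OF that] lu(1) by simp
  have mono: "u - t * (ln u / 2) \<le> v - t * (ln v / 2)" if "lower M \<le> u" "u \<le> v" for u v
  proof -
    have u: "u > 0" using that lu(1) by linarith
    have "ln v - ln u = ln (v / u)" using u that by (simp add: ln_div)
    also have "\<dots> \<le> v / u - 1" using u that by (intro ln_le_minus_one) auto
    also have "\<dots> = (v - u) / u" using u by (simp add: field_simps)
    finally have "t * (ln v - ln u) \<le> t * ((v - u) / u)" using t by (intro mult_left_mono) auto
    also have "\<dots> = (t / u) * (v - u)" by simp
    also have "\<dots> \<le> 1 * (v - u)" using t that u by (intro mult_right_mono) auto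
    finally have "t * ln v - t * ln u \<le> v - u" by (simp add: right_diff_distrib)
    thus ?thesis using that by simp
  qed
  have "lower M \<le> step t \<rho> x \<and> step t \<rho> x \<le> upper M" if x: "x \<in> space \<mu>" for x
  proof
    have G0: "G \<rho> x \<ge> 0" by (rule G_nonneg[OF _ x]) (use b lu in force)
    have GB: "G \<rho> x \<le> upper M * B" using G_bound[OF r ab x] by simp
    have eq: "step t \<rho> x = (\<rho> x - t * (ln (\<rho> x) / 2)) + t * (mean (Phi \<rho>) - G \<rho> x)"
      by (simp add: step_def Phi_def algebra_simps)
    have "step t \<rho> x \<le> (upper M - t * (ln (upper M) / 2)) + t * (ln (upper M) / 2)"
      unfolding eq using mean_Phi_upper[OF M rho] G0 t b[OF x]
      by (intro add_mono mono mult_left_mono) auto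
    thus "step t \<rho> x \<le> upper M" by simp
    have "(lower M - t * (ln (lower M) / 2)) + t * (ln (lower M) / 2) \<le> step t \<rho> x"
      unfolding eq using mean_Phi_lower[OF M rho] GB t b[OF x]
      by (intro add_mono mono mult_left_mono) auto
    thus "lower M \<le> step t \<rho> x" by simp
  qed
  moreover have "step t \<rho> \<in> borel_measurable \<mu>" unfolding step_def[abs_def] using P(1) by measurable
  ultimately show ?thesis using step_mass[OF lu(1) rho] by (simp add: box_def)
qed

text \<open>Expand the square. The term linear in d vanishes because the masses agree, and
  subtracting the mean only lowers the term in t^2. Strong monotonicity of ln and positivity of G
  give the gain t / b. The Lipschitz constant 1 / a of ln and Schur's test bound the term in t^2
  through (l / 2 + G d)^2 <= l^2 / 2 + 2 (G d)^2.\<close>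

lemma step_contraction:
  assumes a: "0 < a" and rho: "\<rho> \<in> box a b M" and sig: "\<sigma> \<in> box a b M" and t: "t > 0"
  shows "(\<integral>x. (step t \<rho> x - step t \<sigma> x)\<^sup>2 \<partial>\<mu>)
    \<le> (1 - t / b + t\<^sup>2 * (1 / (2 * a\<^sup>2) + 2 * B\<^sup>2)) * (\<integral>x. (\<rho> x - \<sigma> x)\<^sup>2 \<partial>\<mu>)"
proof -
  note P = Phi_bound[OF a rho] and S = Phi_bound[OF a sig]
  have r [measurable]: "\<rho> \<in> borel_measurable \<mu>" and br: "\<And>x. x \<in> space \<mu> \<Longrightarrow> a \<le> \<rho> x" "\<And>x. x \<in> space \<mu> \<Longrightarrow> \<rho> x \<le> b"
    and rM: "(\<integral>x. \<rho> x \<partial>\<mu>) = M" using rho by (auto simp: box_def)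
  have s [measurable]: "\<sigma> \<in> borel_measurable \<mu>" and bs: "\<And>x. x \<in> space \<mu> \<Longrightarrow> a \<le> \<sigma> x" "\<And>x. x \<in> space \<mu> \<Longrightarrow> \<sigma> x \<le> b"
    and sM: "(\<integral>x. \<sigma> x \<partial>\<mu>) = M" using sig by (auto simp: box_def)
  define d where "d x = \<rho> x - \<sigma> x" for x
  define l where "l x = ln (\<rho> x) - ln (\<sigma> x)" for x
  define g where "g x = l x / 2 + G d x" for x
  have d [measurable]: "d \<in> borel_measurable \<mu>" unfolding d_def[abs_def] by measurable
  have l [measurable]: "l \<in> borel_measurable \<mu>" unfolding l_def[abs_def] by measurable
  have dC: "\<bar>d x\<bar> \<le> b" if "x \<in> space \<mu>" for x using br[OF that] bs[OF that] a unfolding d_def by linarith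
  have la: "\<bar>l x\<bar> \<le> \<bar>d x\<bar> / a" "(d x)\<^sup>2 / b \<le> d x * l x" if "x \<in> space \<mu>" for x
    using ln_diff_bounds[OF a br[OF that] bs[OF that]] by (auto simp: l_def d_def)
  have lC: "\<bar>l x\<bar> \<le> b / a" if "x \<in> space \<mu>" for x
    using la(1)[OF that] divide_right_mono[OF dC[OF that], of a] a by linarith
  have gC: "\<bar>g x\<bar> \<le> b / a / 2 + b * B" if "x \<in> space \<mu>" for x
  proof -
    have "\<bar>G d x\<bar> \<le> b * B" by (rule G_bound[OF d _ that]) (rule dC)
    moreover define c where "c = b / a"
    have "\<bar>l x\<bar> \<le> c" using lC[OF that] by (simp add: c_def)
    ultimately show ?thesis unfolding g_def c_def[symmetric] by linarith
  qed
  have g [measurable]: "g \<in> borel_measurable \<mu>" unfolding g_def[abs_def] by measurable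
  have id: "integrable \<mu> d" by (rule int_bounded[OF d dC])
  have ig: "integrable \<mu> g" by (rule int_bounded[OF g gC])
  have prod: "integrable \<mu> (\<lambda>x. u x * v x)"
    if "u \<in> borel_measurable \<mu>" "v \<in> borel_measurable \<mu>" "\<And>x. x \<in> space \<mu> \<Longrightarrow> \<bar>u x\<bar> \<le> U" "\<And>x. x \<in> space \<mu> \<Longrightarrow> \<bar>v x\<bar> \<le> V"
    for u v :: "'a \<Rightarrow> real" and U V
    by (rule int_bounded[where C="U * V"]) (use that in \<open>auto simp: abs_mult intro!: mult_mono order_trans[OF abs_ge_zero that(3)]\<close>)
  have gphi: "Phi \<rho> x - Phi \<sigma> x = g x" if x: "x \<in> space \<mu>" for x
  proof -
    have rC: "\<bar>\<rho> y\<bar> \<le> b" "\<bar>\<sigma> y\<bar> \<le> b" if "y \<in> space \<mu>" for y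
      using br[OF that] bs[OF that] a by auto
    have "integrable \<mu> (\<lambda>y. \<kappa> x y * \<rho> y)" "integrable \<mu> (\<lambda>y. \<kappa> x y * \<sigma> y)"
      by (rule kernel_int_bounded[OF r rC(1) x] kernel_int_bounded[OF s rC(2) x]; assumption)+
    hence "G d x = G \<rho> x - G \<sigma> x" unfolding G_def d_def by (simp add: right_diff_distrib)
    thus ?thesis by (simp add: Phi_def g_def l_def diff_divide_distrib)
  qed
  define gm where "gm = mean g"
  have gm: "mean (Phi \<rho>) - mean (Phi \<sigma>) = gm"
  proof -
    have "(\<integral>x. g x \<partial>\<mu>) = (\<integral>x. Phi \<rho> x - Phi \<sigma> x \<partial>\<mu>)"
      by (intro Bochner_Integration.integral_cong refl) (simp add: gphi)
    also have "\<dots> = (\<integral>x. Phi \<rho> x \<partial>\<mu>) - (\<integral>x. Phi \<sigma> x \<partial>\<mu>)" using P S by simp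
    finally show ?thesis by (simp add: gm_def mean_def diff_divide_distrib)
  qed
  have gmm: "(\<integral>x. g x \<partial>\<mu>) = gm * m" using m_pos by (simp add: gm_def mean_def)
  have d0: "(\<integral>x. d x \<partial>\<mu>) = 0" using P S rM sM by (simp add: d_def)
  define D where "D = (\<integral>x. (d x)\<^sup>2 \<partial>\<mu>)"
  have id2: "integrable \<mu> (\<lambda>x. (d x)\<^sup>2)" using prod[OF d d dC dC] by (simp add: power2_eq_square)
  have ig2: "integrable \<mu> (\<lambda>x. (g x)\<^sup>2)" using prod[OF g g gC gC] by (simp add: power2_eq_square)
  have il2: "integrable \<mu> (\<lambda>x. (l x)\<^sup>2)" using prod[OF l l lC lC] by (simp add: power2_eq_square)
  have idg: "integrable \<mu> (\<lambda>x. d x * g x)" by (rule prod[OF d g dC gC])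
  have idl: "integrable \<mu> (\<lambda>x. d x * l x)" by (rule prod[OF d l dC lC])
  have idG: "integrable \<mu> (\<lambda>x. d x * G d x)" by (rule prod[OF d G_meas[OF d] dC G_bound[OF d dC]])
  have iG2: "integrable \<mu> (\<lambda>x. (G d x)\<^sup>2)"
    using prod[OF G_meas[OF d] G_meas[OF d] G_bound[OF d dC] G_bound[OF d dC]] by (simp add: power2_eq_square)
  have alg: "(e - t * (u - h))\<^sup>2 = (e\<^sup>2 - (2 * t) * (e * u)) + (2 * t * h) * e + (t\<^sup>2 * u\<^sup>2 - (2 * t\<^sup>2 * h) * u + t\<^sup>2 * h\<^sup>2)"
    for e u h :: real by algebra
  have "(\<integral>x. (step t \<rho> x - step t \<sigma> x)\<^sup>2 \<partial>\<mu>) = (\<integral>x. ((d x)\<^sup>2 - (2 * t) * (d x * g x)) + (2 * t * gm) * d x + (t\<^sup>2 * (g x)\<^sup>2 - (2 * t\<^sup>2 * gm) * g x + t\<^sup>2 * gm\<^sup>2) \<partial>\<mu>)"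
  proof (intro Bochner_Integration.integral_cong refl)
    fix x assume x: "x \<in> space \<mu>"
    have "step t \<rho> x - step t \<sigma> x = d x - t * (g x - gm)"
      unfolding gphi[OF x, symmetric] gm[symmetric] step_def d_def by algebra
    thus "(step t \<rho> x - step t \<sigma> x)\<^sup>2 = ((d x)\<^sup>2 - (2 * t) * (d x * g x)) + (2 * t * gm) * d x + (t\<^sup>2 * (g x)\<^sup>2 - (2 * t\<^sup>2 * gm) * g x + t\<^sup>2 * gm\<^sup>2)"
      using alg by (simp only:)
  qed
  also have "\<dots> = D - (2 * t) * (\<integral>x. d x * g x \<partial>\<mu>) + (2 * t * gm) * 0 + (t\<^sup>2 * (\<integral>x. (g x)\<^sup>2 \<partial>\<mu>) - (2 * t\<^sup>2 * gm) * (gm * m) + t\<^sup>2 * gm\<^sup>2 * m)"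
  proof -
    have i1: "integrable \<mu> (\<lambda>x. (d x)\<^sup>2 - (2 * t) * (d x * g x))" using id2 idg by simp
    have i2: "integrable \<mu> (\<lambda>x. (2 * t * gm) * d x)" using id by simp
    have i3: "integrable \<mu> (\<lambda>x. t\<^sup>2 * (g x)\<^sup>2 - (2 * t\<^sup>2 * gm) * g x + t\<^sup>2 * gm\<^sup>2)" using ig ig2 by simp
    have e1: "(\<integral>x. (d x)\<^sup>2 - (2 * t) * (d x * g x) \<partial>\<mu>) = D - (2 * t) * (\<integral>x. d x * g x \<partial>\<mu>)"
      using id2 idg by (simp add: D_def)
    have e2: "(\<integral>x. (2 * t * gm) * d x \<partial>\<mu>) = (2 * t * gm) * 0"
      by (simp only: integral_mult_right_zero d0)
    have c: "(\<integral>x. t\<^sup>2 * gm\<^sup>2 \<partial>\<mu>) = t\<^sup>2 * gm\<^sup>2 * m" by (simp add: m_def)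
    have e3: "(\<integral>x. t\<^sup>2 * (g x)\<^sup>2 - (2 * t\<^sup>2 * gm) * g x + t\<^sup>2 * gm\<^sup>2 \<partial>\<mu>)
      = t\<^sup>2 * (\<integral>x. (g x)\<^sup>2 \<partial>\<mu>) - (2 * t\<^sup>2 * gm) * (gm * m) + t\<^sup>2 * gm\<^sup>2 * m"
      unfolding c[symmetric] gmm[symmetric] using ig ig2 by simp
    show ?thesis
      unfolding Bochner_Integration.integral_add[OF Bochner_Integration.integrable_add[OF i1 i2] i3]
        Bochner_Integration.integral_add[OF i1 i2] e1 e2 e3 ..
  qed
  also have "\<dots> = D - (2 * t) * (\<integral>x. d x * g x \<partial>\<mu>) + t\<^sup>2 * (\<integral>x. (g x)\<^sup>2 \<partial>\<mu>) - t\<^sup>2 * gm\<^sup>2 * m"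
    by (simp add: power2_eq_square algebra_simps)
  also have "\<dots> \<le> D - (2 * t) * (\<integral>x. d x * g x \<partial>\<mu>) + t\<^sup>2 * (\<integral>x. (g x)\<^sup>2 \<partial>\<mu>)"
    using m_pos by simp
  also have "\<dots> \<le> D - (2 * t) * (D / b / 2) + t\<^sup>2 * ((1 / (2 * a\<^sup>2) + 2 * B\<^sup>2) * D)"
  proof (intro add_mono diff_mono order_refl mult_left_mono)
    have "(\<integral>x. (d x)\<^sup>2 / b \<partial>\<mu>) \<le> (\<integral>x. d x * l x \<partial>\<mu>)"
      using id2 idl la(2) by (intro integral_mono) auto
    hence "D / b \<le> (\<integral>x. d x * l x \<partial>\<mu>)" by (simp add: D_def)
    moreover have "(\<integral>x. d x * G d x \<partial>\<mu>) \<ge> 0"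
      unfolding G_def by (rule neutral_psd[OF d dC d0])
    moreover have "(\<integral>x. d x * g x \<partial>\<mu>) = (\<integral>x. d x * l x \<partial>\<mu>) / 2 + (\<integral>x. d x * G d x \<partial>\<mu>)"
      using idl idG by (simp add: g_def distrib_left)
    ultimately show "D / b / 2 \<le> (\<integral>x. d x * g x \<partial>\<mu>)" by simp
    have "(\<integral>x. (g x)\<^sup>2 \<partial>\<mu>) \<le> (\<integral>x. (1 / (2 * a\<^sup>2)) * (d x)\<^sup>2 + 2 * (G d x)\<^sup>2 \<partial>\<mu>)"
    proof (rule integral_mono)
      fix x assume x: "x \<in> space \<mu>"
      have "(l x)\<^sup>2 \<le> (\<bar>d x\<bar> / a)\<^sup>2" using power_mono[OF la(1)[OF x], of 2] by simp
      hence "(l x)\<^sup>2 \<le> (d x)\<^sup>2 / a\<^sup>2" by (simp add: power_divide)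
      moreover have "(g x)\<^sup>2 \<le> 2 * (l x / 2)\<^sup>2 + 2 * (G d x)\<^sup>2"
        unfolding g_def using zero_le_power2[of "l x / 2 - G d x"] by (simp add: power2_sum power2_diff)
      ultimately show "(g x)\<^sup>2 \<le> (1 / (2 * a\<^sup>2)) * (d x)\<^sup>2 + 2 * (G d x)\<^sup>2"
        by (simp add: power_divide)
    qed (use ig2 id2 iG2 in auto)
    also have "\<dots> = (1 / (2 * a\<^sup>2)) * D + 2 * (\<integral>x. (G d x)\<^sup>2 \<partial>\<mu>)" using id2 iG2 by (simp add: D_def)
    also have "\<dots> \<le> (1 / (2 * a\<^sup>2)) * D + 2 * (B\<^sup>2 * D)"
      using G_L2[OF d dC] by (simp add: D_def)
    finally show "(\<integral>x. (g x)\<^sup>2 \<partial>\<mu>) \<le> (1 / (2 * a\<^sup>2) + 2 * B\<^sup>2) * D" by (simp add: algebra_simps)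
  qed (use t in auto)
  also have "\<dots> = (1 - t / b + t\<^sup>2 * (1 / (2 * a\<^sup>2) + 2 * B\<^sup>2)) * D" by (simp add: algebra_simps)
  finally show ?thesis by (simp add: D_def d_def)
qed

theorem exists_solution:
  assumes M: "M > 0"
  shows "\<exists>\<rho> a b c. 0 < a \<and> \<rho> \<in> borel_measurable \<mu> \<and> (\<forall>x. a \<le> \<rho> x \<and> \<rho> x \<le> b) \<and>
    (\<integral>x. \<rho> x \<partial>\<mu>) = M \<and> (AE x in \<mu>. ln (\<rho> x) / 2 + (\<integral>y. \<kappa> x y * \<rho> y \<partial>\<mu>) = c)"
proof -
  note lu = lower_upper[OF M]
  define a where "a = lower M"
  define b where "b = upper M"
  have ab: "0 < a" "a < b" "a < M / m" "M / m < b" using lu by (auto simp: a_def b_def)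
  define L where "L = 1 / (2 * a\<^sup>2) + 2 * B\<^sup>2"
  have L0: "L > 0" using ab B_pos by (simp add: L_def add_pos_nonneg)
  \<comment> \<open>Small enough for \<open>step_box\<close>, and for t^2 L to use up at most half
    of the gain t / b.\<close>
  define t where "t = min a (1 / (2 * b * L))"
  have t: "t > 0" "t \<le> a" using ab L0 by (auto simp: t_def)
  define q where "q = 1 - t / (2 * b)"
  have q: "0 < q" "q < 1"
  proof -
    have "t / (2 * b) \<le> a / (2 * b)" using t ab by (intro divide_right_mono) auto
    also have "\<dots> < 1" using ab by simp
    finally show "0 < q" by (simp add: q_def)
    show "q < 1" using t ab by (simp add: q_def)
  qed
  have qL: "1 - t / b + t\<^sup>2 * L \<le> q"
  proof -
    have "t * L \<le> (1 / (2 * b * L)) * L" using L0 by (intro mult_right_mono) (auto simp: t_def)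
    also have "\<dots> = 1 / (2 * b)" using L0 ab by simp
    finally have "t * (t * L) \<le> t * (1 / (2 * b))" using t by (intro mult_left_mono) auto
    thus ?thesis by (simp add: q_def power2_eq_square field_simps)
  qed
  define X where "X = box a b M"
  define r where "r n = (step t ^^ n) (\<lambda>_. M / m)" for n
  have r0: "(\<lambda>_. M / m) \<in> X" using ab m_pos by (auto simp: X_def box_def m_def)
  have stepX: "step t \<rho> \<in> X" if "\<rho> \<in> X" for \<rho>
    using step_box[OF M _ t(1)] t(2) that by (simp add: X_def a_def b_def)
  have rX: "r n \<in> X" for n by (induction n) (auto simp: r_def r0 stepX)
  have rS: "r (Suc n) = step t (r n)" for n by (simp add: r_def)
  have rm [measurable]: "r n \<in> borel_measurable \<mu>" and rb: "\<And>x. x \<in> space \<mu> \<Longrightarrow> a \<le> r n x" "\<And>x. x \<in> space \<mu> \<Longrightarrow> r n x \<le> b"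
    and rM: "(\<integral>x. r n x \<partial>\<mu>) = M" for n
    using rX[of n] by (auto simp: X_def box_def)
  define D where "D n = (\<integral>x. (r (Suc n) x - r n x)\<^sup>2 \<partial>\<mu>)" for n
  have D0: "D n \<ge> 0" for n unfolding D_def by (intro integral_nonneg_AE AE_I2) simp
  have Dq: "D n \<le> q ^ n * D 0" for n
  proof (induction n)
    case (Suc n)
    have "D (Suc n) \<le> (1 - t / b + t\<^sup>2 * L) * D n"
      unfolding D_def L_def rS[of "Suc n"] rS[of n]
      using step_contraction[OF ab(1) stepX[OF rX, unfolded X_def] rX[unfolded X_def] t(1)] by simp
    also have "\<dots> \<le> q * D n" by (intro mult_right_mono qL D0)
    also have "\<dots> \<le> q * (q ^ n * D 0)" using q Suc by (intro mult_left_mono) auto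
    finally show ?case by simp
  qed simp
  \<comment> \<open>The squared L^2 norms of the increments decay like q^n = w^n w^n. The inequality
    z <= w^n + z^2 / w^n then makes the L^1 norms summable, hence the iterates converge almost
    everywhere.\<close>
  define w where "w = sqrt q"
  have w: "0 < w" "w < 1" "w\<^sup>2 = q" using q by (auto simp: w_def)
  have dm [measurable]: "(\<lambda>x. \<bar>r (Suc n) x - r n x\<bar>) \<in> borel_measurable \<mu>" for n by measurable
  have dC: "\<bar>r (Suc n) x - r n x\<bar> \<le> b" if "x \<in> space \<mu>" for n x
    using rb[OF that, of n] rb[OF that, of "Suc n"] ab unfolding abs_le_iff by linarith
  have id: "integrable \<mu> (\<lambda>x. \<bar>r (Suc n) x - r n x\<bar>)" for n
    by (rule int_bounded[OF dm, where C=b]) (use dC in auto)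
  have id2: "integrable \<mu> (\<lambda>x. (r (Suc n) x - r n x)\<^sup>2)" for n
  proof (rule int_bounded[where C="b\<^sup>2"])
    show "\<bar>(r (Suc n) x - r n x)\<^sup>2\<bar> \<le> b\<^sup>2" if "x \<in> space \<mu>" for x
      using power_mono[OF dC[OF that, of n], of 2] by simp
  qed measurable
  have L1: "(\<integral>x. \<bar>r (Suc n) x - r n x\<bar> \<partial>\<mu>) \<le> w ^ n * (m + D 0)" for n
  proof -
    have wn: "w ^ n > 0" using w by simp
    have "(\<integral>x. \<bar>r (Suc n) x - r n x\<bar> \<partial>\<mu>) \<le> (\<integral>x. w ^ n + (1 / w ^ n) * (r (Suc n) x - r n x)\<^sup>2 \<partial>\<mu>)"
    proof (rule integral_mono[OF id])
      show "\<bar>r (Suc n) x - r n x\<bar> \<le> w ^ n + (1 / w ^ n) * (r (Suc n) x - r n x)\<^sup>2" for x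
      proof -
        define z where "z = \<bar>r (Suc n) x - r n x\<bar>"
        have z: "z \<ge> 0" by (simp add: z_def)
        have "z \<le> w ^ n + z\<^sup>2 / w ^ n"
        proof (cases "z \<le> w ^ n")
          case True thus ?thesis using wn by (simp add: add_increasing2)
        next
          case False
          have "z * w ^ n \<le> z * z" using False z by (intro mult_left_mono) auto
          hence "z \<le> z\<^sup>2 / w ^ n" using wn by (simp add: field_simps power2_eq_square)
          thus ?thesis using wn by simp
        qed
        thus ?thesis by (simp add: z_def)
      qed
    qed (use id2 in auto)
    also have "\<dots> = w ^ n * m + (1 / w ^ n) * D n" using id2 by (simp add: D_def m_def mult.commute)
    also have "\<dots> \<le> w ^ n * m + (1 / w ^ n) * (q ^ n * D 0)"
      using wn by (intro add_left_mono mult_left_mono Dq) auto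
    also have "q ^ n = w ^ n * w ^ n" using w(3) by (simp add: power_mult_distrib[symmetric] power2_eq_square)
    finally show ?thesis using wn w(1) by (simp add: algebra_simps)
  qed
  have sumL1: "summable (\<lambda>n. \<integral>x. \<bar>r (Suc n) x - r n x\<bar> \<partial>\<mu>)"
  proof (rule summable_comparison_test'[where N=0])
    show "summable (\<lambda>n. w ^ n * (m + D 0))" using w by (intro summable_mult2 summable_geometric) auto
    show "norm (\<integral>x. \<bar>r (Suc n) x - r n x\<bar> \<partial>\<mu>) \<le> w ^ n * (m + D 0)" for n
      using L1[of n] by (simp add: abs_of_nonneg integral_nonneg_AE)
  qed
  have AEsum: "AE x in \<mu>. summable (\<lambda>n. r (Suc n) x - r n x)"
  proof -
    have "(\<integral>\<^sup>+x. (\<Sum>n. ennreal \<bar>r (Suc n) x - r n x\<bar>) \<partial>\<mu>) = (\<Sum>n. \<integral>\<^sup>+x. ennreal \<bar>r (Suc n) x - r n x\<bar> \<partial>\<mu>)"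
      by (rule nn_integral_suminf) measurable
    also have "\<dots> = (\<Sum>n. ennreal (\<integral>x. \<bar>r (Suc n) x - r n x\<bar> \<partial>\<mu>))"
      using id by (subst nn_integral_eq_integral) auto
    also have "\<dots> = ennreal (\<Sum>n. \<integral>x. \<bar>r (Suc n) x - r n x\<bar> \<partial>\<mu>)"
      by (rule suminf_ennreal2[OF _ sumL1]) (auto intro!: integral_nonneg_AE)
    finally have "(\<integral>\<^sup>+x. (\<Sum>n. ennreal \<bar>r (Suc n) x - r n x\<bar>) \<partial>\<mu>) \<noteq> \<infinity>" by simp
    hence "AE x in \<mu>. (\<Sum>n. ennreal \<bar>r (Suc n) x - r n x\<bar>) \<noteq> \<infinity>"
      by (intro nn_integral_noteq_infinite) measurable
    thus ?thesis
    proof eventually_elim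
      case (elim x)
      have "summable (\<lambda>n. \<bar>r (Suc n) x - r n x\<bar>)"
        by (rule summable_suminf_not_top) (use elim in auto)
      thus ?case by (rule summable_rabs_cancel)
    qed
  qed
  \<comment> \<open>Clamping makes the bounds hold at every point, including the null set where the
    iterates may diverge.\<close>
  define \<rho> where "\<rho> x = max a (min b (lim (\<lambda>n. r n x)))" for x
  have rhom [measurable]: "\<rho> \<in> borel_measurable \<mu>" unfolding \<rho>_def[abs_def] by measurable
  have rhob: "a \<le> \<rho> x" "\<rho> x \<le> b" for x using ab by (auto simp: \<rho>_def)
  have lim: "AE x in \<mu>. (\<lambda>n. r n x) \<longlonglongrightarrow> \<rho> x"
    using AEsum AE_space
  proof eventually_elim
    case (elim x)
    have "convergent (\<lambda>n. r n x)" using elim(1) by (simp add: summable_iff_convergent sum_lessThan_telescope[of "\<lambda>n. r n x"] convergent_diff_const_right_iff)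
    then obtain l where l: "(\<lambda>n. r n x) \<longlonglongrightarrow> l" by (auto simp: convergent_def)
    have "a \<le> l" "l \<le> b"
      using rb[OF elim(2)] by (auto intro: LIMSEQ_le_const[OF l] LIMSEQ_le_const2[OF l])
    thus ?case using l limI[OF l] by (simp add: \<rho>_def)
  qed
  have absr: "\<bar>r n x\<bar> \<le> b" if "x \<in> space \<mu>" for n x using rb[OF that, of n] ab by simp
  have "(\<lambda>n. \<integral>x. r n x \<partial>\<mu>) \<longlonglongrightarrow> (\<integral>x. \<rho> x \<partial>\<mu>)"
    by (rule integral_dominated_convergence[where w="\<lambda>_. b"]) (use lim absr in auto)
  hence rhoM: "(\<integral>x. \<rho> x \<partial>\<mu>) = M" by (simp add: rM LIMSEQ_const_iff)
  have limG: "(\<lambda>n. G (r n) x) \<longlonglongrightarrow> G \<rho> x" if x: "x \<in> space \<mu>" for x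
    unfolding G_def
  proof (rule integral_dominated_convergence[where w="\<lambda>y. b * \<kappa> x y"])
    show "AE y in \<mu>. (\<lambda>n. \<kappa> x y * r n y) \<longlonglongrightarrow> \<kappa> x y * \<rho> y"
      using lim by eventually_elim (intro tendsto_intros)
    show "AE y in \<mu>. norm (\<kappa> x y * r n y) \<le> b * \<kappa> x y" for n
    proof (rule AE_I2)
      fix y assume y: "y \<in> space \<mu>"
      have "\<bar>r n y\<bar> * \<kappa> x y \<le> b * \<kappa> x y" by (intro mult_right_mono absr kernel_nonneg x y)
      thus "norm (\<kappa> x y * r n y) \<le> b * \<kappa> x y"
        using kernel_nonneg[OF x y] by (simp add: abs_mult mult.commute)
    qed
    show "integrable \<mu> (\<lambda>y. b * \<kappa> x y)" using kernel_int[OF x] by simp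
  qed (use x in measurable)
  have limPhi: "AE x in \<mu>. (\<lambda>n. Phi (r n) x) \<longlonglongrightarrow> Phi \<rho> x"
    using lim AE_space
  proof eventually_elim
    case (elim x)
    have "\<rho> x \<noteq> 0" using rhob(1)[of x] ab by linarith
    thus ?case unfolding Phi_def using elim by (intro tendsto_intros limG) auto
  qed
  have PhiC: "\<bar>Phi (r n) x\<bar> \<le> \<bar>ln a\<bar> + \<bar>ln b\<bar> + b * B" if x: "x \<in> space \<mu>" for n x
  proof -
    have "ln a \<le> ln (r n x)" "ln (r n x) \<le> ln b" using rb[OF x, of n] ab by (auto intro!: ln_mono)
    moreover have "\<bar>G (r n) x\<bar> \<le> b * B" by (rule G_bound[OF rm absr x])
    ultimately show ?thesis unfolding Phi_def by linarith
  qed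
  have Phim: "Phi (r n) \<in> borel_measurable \<mu>" "Phi \<rho> \<in> borel_measurable \<mu>" for n
    unfolding Phi_def[abs_def] by measurable
  have "(\<lambda>n. \<integral>x. Phi (r n) x \<partial>\<mu>) \<longlonglongrightarrow> (\<integral>x. Phi \<rho> x \<partial>\<mu>)"
    by (rule integral_dominated_convergence[where w="\<lambda>_. \<bar>ln a\<bar> + \<bar>ln b\<bar> + b * B"])
       (use limPhi PhiC Phim in auto)
  hence limmean: "(\<lambda>n. mean (Phi (r n))) \<longlonglongrightarrow> mean (Phi \<rho>)"
    unfolding mean_def using m_pos by (intro tendsto_intros) auto
  have "AE x in \<mu>. Phi \<rho> x = mean (Phi \<rho>)"
    using lim limPhi
  proof eventually_elim
    case (elim x)
    \<comment> \<open>The increments are - t (Phi - mean) and tend to 0, which forces the equation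
      for the limit.\<close>
    have "(\<lambda>n. r (Suc n) x - r n x) \<longlonglongrightarrow> \<rho> x - \<rho> x"
      using elim(1) by (intro tendsto_diff LIMSEQ_Suc)
    moreover have "r (Suc n) x - r n x = - t * (Phi (r n) x - mean (Phi (r n)))" for n
      by (simp add: rS step_def)
    ultimately have "(\<lambda>n. - t * (Phi (r n) x - mean (Phi (r n)))) \<longlonglongrightarrow> \<rho> x - \<rho> x" by simp
    moreover have "(\<lambda>n. - t * (Phi (r n) x - mean (Phi (r n)))) \<longlonglongrightarrow> - t * (Phi \<rho> x - mean (Phi \<rho>))"
      by (intro tendsto_intros elim limmean)
    ultimately have "\<rho> x - \<rho> x = - t * (Phi \<rho> x - mean (Phi \<rho>))" by (rule LIMSEQ_unique)
    thus ?case using t by simp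
  qed
  hence "AE x in \<mu>. ln (\<rho> x) / 2 + (\<integral>y. \<kappa> x y * \<rho> y \<partial>\<mu>) = mean (Phi \<rho>)"
    by (simp only: Phi_def G_def)
  thus ?thesis using ab(1) rhom rhob rhoM by blast
qed

end

lemma ln_dist_meas [measurable]:
  "(\<lambda>u. ln (norm (fst u - snd u :: real^2))) \<in> borel_measurable (borel \<Otimes>\<^sub>M borel)"
proof -
  have "(\<lambda>u. norm (fst u - snd u :: real^2)) \<in> borel_measurable (borel \<Otimes>\<^sub>M borel)"
    unfolding borel_prod by (intro borel_measurable_continuous_onI continuous_intros)
  thus ?thesis by measurable
qed

subsection \<open>Global bounds for the potential and its energy\<close>

context log_density begin

lemma pot_meas [measurable]: "pot \<in> borel_measurable borel"
  using pot_continuous by (rule borel_measurable_continuous_onI)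

lemma pot_asymp_bounded: "\<exists>C\<ge>0. \<forall>x. norm x \<ge> 2 \<longrightarrow> \<bar>pot x - mass * ln (norm x)\<bar> \<le> C"
proof -
  obtain C where C: "C \<ge> 0" "\<And>x. norm x \<ge> 2 \<Longrightarrow> \<bar>pot x - mass * ln (norm x)\<bar> \<le> C * (1 + ln (norm x)) * norm x powr (- g)"
    using pot_asymp by blast
  have "\<bar>pot x - mass * ln (norm x)\<bar> \<le> C * (1 + 1 / g)" if n: "norm x \<ge> 2" for x
  proof -
    have "ln (norm x) \<le> norm x powr g / g" using n g by (intro ln_le_powr) auto
    moreover have "1 \<le> norm x powr g" using n g by (intro ge_one_powr_ge_zero) auto
    ultimately have "(1 + ln (norm x)) * norm x powr (- g) \<le> (norm x powr g + norm x powr g / g) * norm x powr (- g)"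
      by (intro mult_right_mono add_mono) auto
    also have "\<dots> = (1 + 1 / g) * (norm x powr g * norm x powr (- g))" by (simp add: distrib_right)
    also have "norm x powr g * norm x powr (- g) = 1" using n by (subst powr_add[symmetric]) auto
    finally have "(1 + ln (norm x)) * norm x powr (- g) \<le> 1 + 1 / g" by simp
    hence "C * ((1 + ln (norm x)) * norm x powr (- g)) \<le> C * (1 + 1 / g)" using C(1) by (rule mult_left_mono)
    thus ?thesis using C(2)[OF n] by (simp add: mult.assoc)
  qed
  moreover have "C * (1 + 1 / g) \<ge> 0" using C g by simp
  ultimately show ?thesis by blast
qed

text \<open>ln (1 + |x|) in place of ln |x| makes the estimate global; in this form it bounds the
  row integrals of \<open>kap\<close>.\<close>

lemma pot_bound: "\<exists>C\<ge>0. \<forall>x. \<bar>pot x - mass * ln (1 + norm x)\<bar> \<le> C"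
proof -
  obtain C where C: "C \<ge> 0" "\<And>x. norm x \<ge> 2 \<Longrightarrow> \<bar>pot x - mass * ln (norm x)\<bar> \<le> C"
    using pot_asymp_bounded by blast
  have nz: "1 + norm x \<noteq> 0" for x :: "real^2" using norm_ge_zero[of x] by linarith
  have cont: "continuous_on UNIV (\<lambda>x. pot x - mass * ln (1 + norm x))"
    using nz by (intro continuous_intros pot_continuous) auto
  obtain C2 where C2: "C2 \<ge> 0" "\<And>x. norm x \<le> 2 \<Longrightarrow> \<bar>pot x - mass * ln (1 + norm x)\<bar> \<le> C2"
    using bounded_on_cball[OF cont] by blast
  have "\<bar>pot x - mass * ln (1 + norm x)\<bar> \<le> C + C2 + mass" for x
  proof (cases "norm x \<ge> 2")
    case True
    have n: "norm x > 0" using True by linarith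
    have "ln (1 + norm x) - ln (norm x) = ln (1 + 1 / norm x)"
    proof -
      have "1 + norm x = norm x * (1 + 1 / norm x)" using n by (simp add: distrib_left)
      moreover have "1 + 1 / norm x > 0" using n by (simp add: add_pos_pos)
      ultimately show ?thesis using n by (simp add: ln_mult_pos)
    qed
    also have "\<dots> \<le> 1 / norm x" by (rule ln_add_one_self_le_self) simp
    also have "\<dots> \<le> 1" using True n by (simp add: divide_simps)
    finally have 1: "ln (1 + norm x) - ln (norm x) \<le> 1" .
    have 2: "ln (norm x) \<le> ln (1 + norm x)" using n by (intro ln_mono) auto
    have "\<bar>mass * (ln (1 + norm x) - ln (norm x))\<bar> \<le> mass * 1"
      unfolding abs_mult using 1 2 mass_nonneg by (intro mult_mono) auto
    thus ?thesis using C(2)[OF True] C2(1) by (simp add: right_diff_distrib)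
  next
    case False thus ?thesis using C2(2)[of x] C(1) mass_nonneg by simp
  qed
  moreover have "C + C2 + mass \<ge> 0" using C C2 mass_nonneg by simp
  ultimately show ?thesis by blast
qed

lemma abs_pot_integrable: "integrable lborel (\<lambda>y. \<bar>ln (norm (x - y))\<bar> * f y)"
  using integrable_abs[OF pot_integrable[of x]] f_nonneg by (simp add: abs_mult)

text \<open>Put L = ln |x - y| and h z = ln (1 + |z|). Since L <= h x + h y, one has |L| <= 2 (h x +
  h y) - L, so the signed potential, which is already under control, bounds the absolute
  one.\<close>

lemma abs_pot_bound: "\<exists>C\<ge>0. \<forall>x. (\<integral>y. \<bar>ln (norm (x - y))\<bar> * f y \<partial>lborel) \<le> C * (1 + norm x) powr g"
proof -
  obtain C where C: "C \<ge> 0" "\<And>x. \<bar>pot x - mass * ln (1 + norm x)\<bar> \<le> C" using pot_bound by blast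
  define G where "G = (\<integral>y. f y * (1 + norm y) powr g \<partial>lborel)"
  have G0: "G \<ge> 0" unfolding G_def by (intro Bochner_Integration.integral_nonneg mult_nonneg_nonneg f_nonneg) auto
  have "(\<integral>y. \<bar>ln (norm (x - y))\<bar> * f y \<partial>lborel) \<le> (3 * mass / g + 2 * G / g + C) * (1 + norm x) powr g" for x
  proof -
    let ?h = "\<lambda>x :: real^2. ln (1 + norm x)"
    have h0: "?h y \<ge> 0" "?h y \<le> (1 + norm y) powr g / g" for y :: "real^2"
      using g by (auto intro!: ln_le_powr simp: add_pos_nonneg)
    have i1: "integrable lborel (\<lambda>y. 2 * (?h x * f y + (1 / g) * (f y * (1 + norm y) powr g)))"
      by (intro integrable_mult_right Bochner_Integration.integrable_add int_f int_g)
    have "(\<integral>y. \<bar>ln (norm (x - y))\<bar> * f y \<partial>lborel)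
       \<le> (\<integral>y. 2 * (?h x * f y + (1 / g) * (f y * (1 + norm y) powr g)) - ln (norm (x - y)) * f y \<partial>lborel)"
    proof (rule integral_mono[OF abs_pot_integrable])
      show "integrable lborel (\<lambda>y. 2 * (?h x * f y + (1 / g) * (f y * (1 + norm y) powr g)) - ln (norm (x - y)) * f y)"
        by (intro Bochner_Integration.integrable_diff i1 pot_integrable)
      fix y
      have l: "ln (norm (x - y)) \<le> ?h x + ?h y"
      proof (cases "x = y")
        case False
        have "norm (x - y) \<le> (1 + norm x) * (1 + norm y)"
        proof -
          have "(1 + norm x) * (1 + norm y) = 1 + norm x + norm y + norm x * norm y" by (simp add: algebra_simps)
          thus ?thesis
            using norm_triangle_ineq4[of x y] mult_nonneg_nonneg[OF norm_ge_zero[of x] norm_ge_zero[of y]] by linarith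
        qed
        hence "ln (norm (x - y)) \<le> ln ((1 + norm x) * (1 + norm y))" using False by (intro ln_mono) auto
        also have "\<dots> = ?h x + ?h y" by (rule ln_mult_pos) (auto simp: add_pos_nonneg)
        finally show ?thesis .
      qed (use h0 in \<open>simp add: add_nonneg_nonneg\<close>)
      have "\<bar>ln (norm (x - y))\<bar> \<le> 2 * (?h x + ?h y) - ln (norm (x - y))"
        using l h0(1)[of x] h0(1)[of y] by (cases "ln (norm (x - y)) \<ge> 0") simp_all
      also have "\<dots> \<le> 2 * (?h x + (1 + norm y) powr g / g) - ln (norm (x - y))" using h0(2)[of y] by simp
      finally have "\<bar>ln (norm (x - y))\<bar> * f y \<le> (2 * (?h x + (1 + norm y) powr g / g) - ln (norm (x - y))) * f y"
        by (intro mult_right_mono f_nonneg)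
      thus "\<bar>ln (norm (x - y))\<bar> * f y \<le> 2 * (?h x * f y + (1 / g) * (f y * (1 + norm y) powr g)) - ln (norm (x - y)) * f y"
        by (simp add: algebra_simps)
    qed
    also have "\<dots> = 2 * (?h x * mass + (1 / g) * G) - pot x"
      using int_f int_g pot_integrable[of x] by (subst Bochner_Integration.integral_diff[OF i1 pot_integrable]) (simp add: mass_def G_def pot_def)
    also have "\<dots> \<le> 3 * mass * ?h x + 2 * G / g + C"
    proof -
      have "- pot x \<le> C - mass * ?h x" using C(2)[of x] by linarith
      moreover have "0 \<le> mass * ?h x" using mass_nonneg h0(1)[of x] by simp
      ultimately show ?thesis by (simp add: algebra_simps)
    qed
    also have "\<dots> \<le> 3 * mass * ((1 + norm x) powr g / g) + (2 * G / g) * (1 + norm x) powr g + C * (1 + norm x) powr g"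
    proof (intro add_mono mult_left_mono h0)
      show "2 * G / g \<le> 2 * G / g * (1 + norm x) powr g"
        using mult_left_mono[OF weight_ge_1[of x], of "2 * G / g"] G0 g by simp
      show "C \<le> C * (1 + norm x) powr g" using mult_left_mono[OF weight_ge_1[of x] C(1)] by simp
    qed (use mass_nonneg in simp)
    finally show ?thesis by (simp add: distrib_right)
  qed
  moreover have "3 * mass / g + 2 * G / g + C \<ge> 0" using mass_nonneg G0 C g by simp
  ultimately show ?thesis by blast
qed

text \<open>Fubini passes the Laplacian to the kernel, where \<open>fundamental_solution\<close>
  applies; the bound on the absolute potential over the support of phi makes the double integral
  converge.\<close>

lemma pot_laplacian:
  assumes phi: "test_function \<phi>"
  shows "(\<integral>x. pot x * laplacian \<phi> x \<partial>lborel) = 2 * pi * (\<integral>y. f y * \<phi> y \<partial>lborel)"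
proof -
  obtain R where R: "R > 0" "\<And>x. norm x > R \<Longrightarrow> \<phi> x = 0" "continuous_on UNIV \<phi>"
    "continuous_on UNIV (laplacian \<phi>)" "\<And>x. norm x > R \<Longrightarrow> laplacian \<phi> x = 0"
    by (rule test_functionE[OF phi]) blast
  have [measurable]: "laplacian \<phi> \<in> borel_measurable borel" using R(4) by (rule borel_measurable_continuous_onI)
  obtain C where C: "C \<ge> 0" "\<And>x. (\<integral>y. \<bar>ln (norm (x - y))\<bar> * f y \<partial>lborel) \<le> C * (1 + norm x) powr g"
    using abs_pot_bound by blast
  obtain D where D: "D \<ge> 0" "\<And>x. \<bar>laplacian \<phi> x\<bar> \<le> D"
    using continuous_cpt_supp_bounded[OF R(4,5)] by blast
  define H where "H x y = ln (norm (x - y)) * f y * laplacian \<phi> x" for x y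
  have mH: "(\<lambda>(x, y). H x y) \<in> borel_measurable (lborel \<Otimes>\<^sub>M lborel)"
    unfolding H_def split_beta by measurable
  have nH: "(\<integral>y. norm (H x y) \<partial>lborel) = \<bar>laplacian \<phi> x\<bar> * (\<integral>y. \<bar>ln (norm (x - y))\<bar> * f y \<partial>lborel)" for x
    using f_nonneg by (simp add: H_def abs_mult mult.commute)
  have iH: "integrable (lborel \<Otimes>\<^sub>M lborel) (\<lambda>(x, y). H x y)"
  proof (rule lborel_pair.Fubini_integrable[OF mH])
    have [measurable]: "(\<lambda>x. \<integral>y. norm (H x y) \<partial>lborel) \<in> borel_measurable lborel"
      using mH by measurable
    have "integrable lborel (\<lambda>x. \<integral>y. norm (H x y) \<partial>lborel)"
    proof (rule integrable_bounded_cball[where R=R and C="D * (C * (1 + R) powr g)"])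
      fix x
      show "(\<integral>y. norm (H x y) \<partial>lborel) = 0" if "norm x > R"
        unfolding nH using R(5)[OF that] by simp
      show "\<bar>\<integral>y. norm (H x y) \<partial>lborel\<bar> \<le> D * (C * (1 + R) powr g)"
      proof (cases "norm x > R")
        case True
        thus ?thesis unfolding nH using R(5)[OF True] D C by simp
      next
        case False
        have "(1 + norm x) powr g \<le> (1 + R) powr g" using False g by (intro powr_mono2) auto
        hence "C * (1 + norm x) powr g \<le> C * (1 + R) powr g" using C(1) by (rule mult_left_mono)
        hence "(\<integral>y. \<bar>ln (norm (x - y))\<bar> * f y \<partial>lborel) \<le> C * (1 + R) powr g" using C(2)[of x] by linarith
        moreover have "0 \<le> (\<integral>y. \<bar>ln (norm (x - y))\<bar> * f y \<partial>lborel)"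
          by (intro Bochner_Integration.integral_nonneg mult_nonneg_nonneg f_nonneg) auto
        ultimately show ?thesis unfolding nH using D by (auto simp: abs_mult intro!: mult_mono)
      qed
    qed measurable
    thus "integrable lborel (\<lambda>x. \<integral>y. norm (case (x, y) of (x, y) \<Rightarrow> H x y) \<partial>lborel)" by simp
    show "AE x in lborel. integrable lborel (\<lambda>y. case (x, y) of (x, y) \<Rightarrow> H x y)"
      using pot_integrable by (intro AE_I2) (simp add: H_def)
  qed
  have "(\<integral>x. pot x * laplacian \<phi> x \<partial>lborel) = (\<integral>x. \<integral>y. H x y \<partial>lborel \<partial>lborel)"
    by (simp add: H_def pot_def)
  also have "\<dots> = (\<integral>y. \<integral>x. H x y \<partial>lborel \<partial>lborel)"
    using lborel_pair.Fubini_integral[OF iH] by simp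
  also have "\<dots> = (\<integral>y. 2 * pi * (f y * \<phi> y) \<partial>lborel)"
  proof (rule Bochner_Integration.integral_cong[OF refl])
    fix y
    have "(\<integral>x. H x y \<partial>lborel) = (\<integral>x. f y * (ln (norm (x - y)) * laplacian \<phi> x) \<partial>lborel)"
      by (simp add: H_def mult_ac)
    also have "\<dots> = f y * (2 * pi * \<phi> y)"
      by (simp only: integral_mult_right_zero fundamental_solution(2)[OF phi])
    finally show "(\<integral>x. H x y \<partial>lborel) = 2 * pi * (f y * \<phi> y)" by simp
  qed
  finally show ?thesis by simp
qed

lemma pot_smallo:
  assumes d: "d < g"
  shows "(\<lambda>x. pot x - mass * ln (norm x)) \<in> o[at_infinity](\<lambda>x. norm x powr (- d))"
proof -
  obtain C where C: "C \<ge> 0" "\<And>x. norm x \<ge> 2 \<Longrightarrow> \<bar>pot x - mass * ln (norm x)\<bar> \<le> C * (1 + ln (norm x)) * norm x powr (- g)"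
    using pot_asymp by blast
  \<comment> \<open>Half of the gap g - d pays for the logarithm, the other half is left as
    decay.\<close>
  define e where "e = (g - d) / 2"
  have e: "e > 0" using d by (simp add: e_def)
  have "((\<lambda>x::real^2. norm x powr (- e)) \<longlongrightarrow> 0) at_infinity"
    using e by (intro tendsto_neg_powr filterlim_norm_at_top) auto
  from tendsto_mult_left[OF this, of "C * (1 + 1 / e)"]
  have lim: "((\<lambda>x::real^2. C * (1 + 1 / e) * norm x powr (- e)) \<longlongrightarrow> 0) at_infinity" by simp
  show ?thesis
  proof (rule landau_o.smallI)
    fix c :: real assume c: "c > 0"
    have "\<forall>\<^sub>F x::real^2 in at_infinity. C * (1 + 1 / e) * norm x powr (- e) < c"
      using lim c by (rule order_tendstoD)
    moreover have "\<forall>\<^sub>F x::real^2 in at_infinity. norm x \<ge> 2"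
      using filterlim_norm_at_top[where 'a="real^2"] by (auto simp: filterlim_at_top)
    ultimately show "\<forall>\<^sub>F x in at_infinity. norm (pot x - mass * ln (norm x)) \<le> c * norm (norm x powr (- d))"
    proof eventually_elim
      case (elim x)
      have "ln (norm x) \<le> norm x powr e / e" using elim e by (intro ln_le_powr) auto
      moreover have "1 \<le> norm x powr e" using elim e by (intro ge_one_powr_ge_zero) auto
      ultimately have "(1 + ln (norm x)) * norm x powr (- g) \<le> (norm x powr e + norm x powr e / e) * norm x powr (- g)"
        by (intro mult_right_mono add_mono) auto
      also have "\<dots> = (1 + 1 / e) * (norm x powr e * norm x powr (- g))" by (simp add: distrib_right)
      also have "norm x powr e * norm x powr (- g) = norm x powr (- e) * norm x powr (- d)"
        unfolding powr_add[symmetric] by (simp add: e_def field_simps)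
      finally have "C * ((1 + ln (norm x)) * norm x powr (- g)) \<le> C * ((1 + 1 / e) * (norm x powr (- e) * norm x powr (- d)))"
        using C(1) by (rule mult_left_mono)
      also have "\<dots> = (C * (1 + 1 / e) * norm x powr (- e)) * norm x powr (- d)" by simp
      also have "\<dots> \<le> c * norm x powr (- d)" using elim by (intro mult_right_mono) auto
      finally show ?case using C(2)[of x] elim by (simp add: mult.assoc)
    qed
  qed
qed

text \<open>Domination by a multiple of f lends the signed \<rho> the absolute convergence known for
  f, which Fubini and \<open>log_energy_nonpos\<close> ask for. It is applied with f = W.\<close>

lemma log_energy:
  assumes rho [measurable]: "\<rho> \<in> borel_measurable borel" and dom: "\<And>x. \<bar>\<rho> x\<bar> \<le> C * f x"
    and neutral: "(\<integral>x. \<rho> x \<partial>lborel) = 0"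
  shows "integrable lborel (\<lambda>x. \<rho> x * (\<integral>y. ln (norm (x - y)) * \<rho> y \<partial>lborel))"
    "(\<integral>x. \<rho> x * (\<integral>y. ln (norm (x - y)) * \<rho> y \<partial>lborel) \<partial>lborel) \<le> 0"
proof -
  have dom': "\<bar>\<rho> x\<bar> \<le> \<bar>C\<bar> * f x" for x
    using order_trans[OF dom[of x] mult_right_mono[OF abs_ge_self f_nonneg]] .
  have irho: "integrable lborel \<rho>"
    by (rule Bochner_Integration.integrable_bound[OF integrable_mult_right[OF int_f, of "\<bar>C\<bar>"]])
       (use dom' f_nonneg in \<open>auto intro!: AE_I2 simp: abs_mult\<close>)
  obtain D where D: "D \<ge> 0" "\<And>x. (\<integral>y. \<bar>ln (norm (x - y))\<bar> * f y \<partial>lborel) \<le> D * (1 + norm x) powr g"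
    using abs_pot_bound by blast
  define H where "H x y = ln (norm (x - y)) * (\<rho> x * \<rho> y)" for x y
  have mH: "(\<lambda>(x, y). H x y) \<in> borel_measurable (lborel \<Otimes>\<^sub>M lborel)"
    unfolding H_def split_beta by measurable
  have Hb: "norm (H x y) \<le> (\<bar>C\<bar> * \<bar>C\<bar> * f x) * (\<bar>ln (norm (x - y))\<bar> * f y)" for x y
  proof -
    have "norm (H x y) = \<bar>ln (norm (x - y))\<bar> * (\<bar>\<rho> x\<bar> * \<bar>\<rho> y\<bar>)" by (simp add: H_def abs_mult)
    also have "\<dots> \<le> \<bar>ln (norm (x - y))\<bar> * ((\<bar>C\<bar> * f x) * (\<bar>C\<bar> * f y))"
      using f_nonneg by (intro mult_left_mono mult_mono dom') auto
    finally show ?thesis by (simp add: mult_ac)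
  qed
  have [measurable]: "H x \<in> borel_measurable borel" for x unfolding H_def by measurable
  have iHy: "integrable lborel (H x)" for x
    by (rule Bochner_Integration.integrable_bound[OF integrable_mult_right[OF abs_pot_integrable[of x], of "\<bar>C\<bar> * \<bar>C\<bar> * f x"]])
       (use order_trans[OF Hb abs_ge_self] in \<open>auto intro!: AE_I2\<close>)
  have iH: "integrable (lborel \<Otimes>\<^sub>M lborel) (\<lambda>(x, y). H x y)"
  proof (rule lborel_pair.Fubini_integrable[OF mH])
    have [measurable]: "(\<lambda>x. \<integral>y. norm (H x y) \<partial>lborel) \<in> borel_measurable lborel"
      using mH by measurable
    have "integrable lborel (\<lambda>x. \<integral>y. norm (H x y) \<partial>lborel)"
    proof (rule Bochner_Integration.integrable_bound[OF integrable_mult_right[OF int_g, of "\<bar>C\<bar> * \<bar>C\<bar> * D"]])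
      show "AE x in lborel. norm (\<integral>y. norm (H x y) \<partial>lborel) \<le> norm (\<bar>C\<bar> * \<bar>C\<bar> * D * (f x * (1 + norm x) powr g))"
      proof (rule AE_I2)
        fix x
        have "(\<integral>y. norm (H x y) \<partial>lborel) \<le> (\<integral>y. (\<bar>C\<bar> * \<bar>C\<bar> * f x) * (\<bar>ln (norm (x - y))\<bar> * f y) \<partial>lborel)"
          by (intro integral_mono integrable_norm iHy integrable_mult_right abs_pot_integrable Hb)
        also have "\<dots> = (\<bar>C\<bar> * \<bar>C\<bar> * f x) * (\<integral>y. \<bar>ln (norm (x - y))\<bar> * f y \<partial>lborel)" by (rule integral_mult_right_zero)
        also have "\<dots> \<le> (\<bar>C\<bar> * \<bar>C\<bar> * f x) * (D * (1 + norm x) powr g)"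
          using f_nonneg by (intro mult_left_mono D) auto
        also have "\<dots> = \<bar>C\<bar> * \<bar>C\<bar> * D * (f x * (1 + norm x) powr g)" by (simp add: mult_ac)
        finally have "(\<integral>y. norm (H x y) \<partial>lborel) \<le> \<bar>C\<bar> * \<bar>C\<bar> * D * (f x * (1 + norm x) powr g)" .
        moreover have "0 \<le> (\<integral>y. norm (H x y) \<partial>lborel)" by (intro Bochner_Integration.integral_nonneg) simp
        ultimately show "norm (\<integral>y. norm (H x y) \<partial>lborel) \<le> norm (\<bar>C\<bar> * \<bar>C\<bar> * D * (f x * (1 + norm x) powr g))"
          unfolding real_norm_def by linarith
      qed
    qed measurable
    thus "integrable lborel (\<lambda>x. \<integral>y. norm (case (x, y) of (x, y) \<Rightarrow> H x y) \<partial>lborel)" by simp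
    show "AE x in lborel. integrable lborel (\<lambda>y. case (x, y) of (x, y) \<Rightarrow> H x y)"
      using iHy by simp
  qed
  have inner: "(\<integral>y. H x y \<partial>lborel) = \<rho> x * (\<integral>y. ln (norm (x - y)) * \<rho> y \<partial>lborel)" for x
  proof -
    have "(\<integral>y. H x y \<partial>lborel) = (\<integral>y. \<rho> x * (ln (norm (x - y)) * \<rho> y) \<partial>lborel)" by (simp add: H_def mult_ac)
    thus ?thesis by (simp only: integral_mult_right_zero)
  qed
  show "integrable lborel (\<lambda>x. \<rho> x * (\<integral>y. ln (norm (x - y)) * \<rho> y \<partial>lborel))"
    using lborel_pair.integrable_fst[OF iH] by (simp add: inner)
  have iH': "integrable (lborel \<Otimes>\<^sub>M lborel) (\<lambda>p. ln (norm (fst p - snd p)) * (\<rho> (fst p) * \<rho> (snd p)))"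
    using iH by (simp add: H_def case_prod_unfold)
  have "(\<integral>x. \<integral>y. H x y \<partial>lborel \<partial>lborel) = (\<integral>p. ln (norm (fst p - snd p)) * (\<rho> (fst p) * \<rho> (snd p)) \<partial>(lborel \<Otimes>\<^sub>M lborel))"
    using lborel_pair.integral_fst[OF iH] by (simp add: H_def case_prod_unfold)
  also have "\<dots> \<le> 0" by (rule log_energy_nonpos[OF irho neutral iH'])
  finally show "(\<integral>x. \<rho> x * (\<integral>y. ln (norm (x - y)) * \<rho> y \<partial>lborel) \<partial>lborel) \<le> 0" by (simp add: inner)
qed

end

subsection \<open>Solutions for a Borel measurable weight\<close>

text \<open>Here k is a Borel version of -K and a the growth rate. The exponent g in
  \<open>int_ka\<close> is the moment left over after the factor exp (2 u), which grows like (1 +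
  |x|)^(2 a).\<close>

locale curvature =
  fixes k :: "real ^ 2 \<Rightarrow> real" and a g p q :: real
  assumes k_meas [measurable]: "k \<in> borel_measurable borel"
    and k_nonneg: "\<And>x. k x \<ge> 0"
    and k_nonzero: "\<not> (AE x in lborel. k x = 0)"
    and a: "a > 0" and g: "0 < g" "g \<le> 1" and p: "p > 1"
    and int_ka: "integrable lborel (\<lambda>x. k x * (1 + norm x) powr (2 * a + g))"
    and int_kp: "integrable lborel (\<lambda>x. k x powr p * (1 + norm x) powr q)"
begin

definition W :: "real ^ 2 \<Rightarrow> real" where "W x = k x * (1 + norm x) powr (2 * a)"
definition sol :: "(real ^ 2 \<Rightarrow> real) \<Rightarrow> bool" where
  "sol u \<longleftrightarrow> continuous_on UNIV u \<and>
     (\<forall>\<phi>. test_function \<phi> \<longrightarrow>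
        (\<integral>x. u x * laplacian \<phi> x \<partial>lborel) = (\<integral>x. k x * exp (2 * u x) * \<phi> x \<partial>lborel))"
definition growth :: "(real ^ 2 \<Rightarrow> real) \<Rightarrow> bool" where
  "growth u \<longleftrightarrow> (\<exists>C R. \<forall>x. norm x \<ge> R \<longrightarrow> \<bar>u x - a * ln (norm x)\<bar> \<le> C)"

lemma one_plus_norm_pos: "1 + norm (x :: real^2) > 0"
  using norm_ge_zero[of x] by linarith

lemma W_meas [measurable]: "W \<in> borel_measurable borel" unfolding W_def by measurable
lemma W_nonneg: "W x \<ge> 0" by (simp add: W_def k_nonneg)

text \<open>The power W^p carries the extra factor (1 + |x|)^(2 a p), which accounts for the shift
  of q; the surplus g in \<open>int_ka\<close> becomes the moment of f.\<close>

lemma density_dominated: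
  assumes f [measurable]: "f \<in> borel_measurable borel" and f0: "\<And>x. f x \<ge> 0"
    and dom: "AE x in lborel. f x \<le> A * W x"
  shows "log_density f g p (q - 2 * a * p)"
proof
  show "f \<in> borel_measurable borel" by (rule f)
  have Wg: "W x * (1 + norm x) powr g = k x * (1 + norm x) powr (2 * a + g)" for x
    by (simp add: W_def powr_add)
  show "integrable lborel (\<lambda>y. f y * (1 + norm y) powr g)"
  proof (rule Bochner_Integration.integrable_bound[OF integrable_mult_right[OF int_ka, of A]])
    show "AE x in lborel. norm (f x * (1 + norm x) powr g) \<le> norm (A * (k x * (1 + norm x) powr (2 * a + g)))"
      using dom
    proof eventually_elim
      case (elim x)
      have "f x * (1 + norm x) powr g \<le> A * W x * (1 + norm x) powr g" by (intro mult_right_mono elim) simp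
      also have "\<dots> = A * (k x * (1 + norm x) powr (2 * a + g))" by (simp only: mult.assoc Wg)
      finally have "f x * (1 + norm x) powr g \<le> A * (k x * (1 + norm x) powr (2 * a + g))" .
      from order_trans[OF this abs_ge_self] show ?case
        using f0[of x] by (simp only: real_norm_def abs_of_nonneg mult_nonneg_nonneg powr_ge_zero)
    qed
  qed measurable
  have Wp: "W x powr p * (1 + norm x) powr (q - 2 * a * p) = k x powr p * (1 + norm x) powr q" for x
  proof -
    have "W x powr p = k x powr p * (1 + norm x) powr (2 * a * p)"
      by (simp add: W_def powr_mult powr_powr)
    hence "W x powr p * (1 + norm x) powr (q - 2 * a * p) = k x powr p * ((1 + norm x) powr (2 * a * p) * (1 + norm x) powr (q - 2 * a * p))"
      by simp
    thus ?thesis by (simp add: powr_add[symmetric])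
  qed
  show "integrable lborel (\<lambda>y. f y powr p * (1 + norm y) powr (q - 2 * a * p))"
  proof (rule Bochner_Integration.integrable_bound[OF integrable_mult_right[OF int_kp, of "\<bar>A\<bar> powr p"]])
    show "AE x in lborel. norm (f x powr p * (1 + norm x) powr (q - 2 * a * p)) \<le> norm (\<bar>A\<bar> powr p * (k x powr p * (1 + norm x) powr q))"
      using dom
    proof eventually_elim
      case (elim x)
      have "f x \<le> \<bar>A\<bar> * W x" using elim mult_right_mono[OF abs_ge_self[of A] W_nonneg[of x]] by linarith
      hence "f x powr p \<le> (\<bar>A\<bar> * W x) powr p" using f0 p by (intro powr_mono2) auto
      also have "\<dots> = \<bar>A\<bar> powr p * W x powr p" by (rule powr_mult)
      finally have "f x powr p * (1 + norm x) powr (q - 2 * a * p) \<le> \<bar>A\<bar> powr p * W x powr p * (1 + norm x) powr (q - 2 * a * p)"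
        by (intro mult_right_mono) auto
      also have "\<dots> = \<bar>A\<bar> powr p * (W x powr p * (1 + norm x) powr (q - 2 * a * p))" by simp
      also have "\<dots> = \<bar>A\<bar> powr p * (k x powr p * (1 + norm x) powr q)" by (simp only: Wp)
      finally show ?case by simp
    qed
  qed measurable
qed (use f0 g p in auto)

sublocale W: log_density W g p "q - 2 * a * p"
  by (rule density_dominated[of _ 1]) (auto simp: W_nonneg)

lemma growth_bound:
  assumes u: "continuous_on UNIV u" and gr: "growth u"
  shows "\<exists>C. \<forall>x. u x \<le> a * ln (1 + norm x) + C"
proof -
  obtain C R where C: "\<And>x. norm x \<ge> R \<Longrightarrow> \<bar>u x - a * ln (norm x)\<bar> \<le> C" using gr by (auto simp: growth_def)
  obtain D where D: "D \<ge> 0" "\<And>x. norm x \<le> max R 1 \<Longrightarrow> \<bar>u x\<bar> \<le> D" using bounded_on_cball[OF u] by blast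
  have "u x \<le> a * ln (1 + norm x) + (\<bar>C\<bar> + D)" for x
  proof (cases "norm x \<le> max R 1")
    case True
    have "a * ln (1 + norm x) \<ge> 0" using a by simp
    thus ?thesis using D(2)[OF True] by linarith
  next
    case False
    have "ln (norm x) \<le> ln (1 + norm x)" using False by (intro ln_mono) auto
    hence "a * ln (norm x) \<le> a * ln (1 + norm x)" using a by (intro mult_left_mono) auto
    moreover have "\<bar>u x - a * ln (norm x)\<bar> \<le> C" using C[of x] False by simp
    ultimately show ?thesis using D(1) by linarith
  qed
  thus ?thesis by blast
qed

lemma exp_weight_bound:
  assumes "u x \<le> a * ln (1 + norm x) + C"
  shows "k x * exp (2 * u x) \<le> exp (2 * C) * W x"
proof -
  have "exp (2 * u x) \<le> exp (2 * a * ln (1 + norm x) + 2 * C)" using assms by simp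
  also have "\<dots> = exp (2 * C) * (1 + norm x) powr (2 * a)"
    using one_plus_norm_pos[of x] by (simp add: exp_add powr_def)
  finally have "k x * exp (2 * u x) \<le> k x * (exp (2 * C) * (1 + norm x) powr (2 * a))"
    by (intro mult_left_mono k_nonneg)
  thus ?thesis by (simp add: W_def mult_ac)
qed

text \<open>The growth condition first dominates f by W, so that its potential makes sense. After
  Liouville the mass comes from comparing the coefficients of ln |x|: a constant stays within
  bounded distance of b ln |x| only for b = 0.\<close>

lemma representation:
  assumes s: "sol u" and gr: "growth u"
  defines "f \<equiv> \<lambda>x. k x * exp (2 * u x)"
  shows "log_density f g p (q - 2 * a * p)"
    "\<exists>A. \<forall>x. f x \<le> A * W x"
    "(\<integral>x. f x \<partial>lborel) = 2 * pi * a"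
    "\<exists>c. \<forall>x. u x = c + log_density.pot f x / (2 * pi)"
proof -
  have cu: "continuous_on UNIV u" using s by (simp add: sol_def)
  have um [measurable]: "u \<in> borel_measurable borel" using cu by (rule borel_measurable_continuous_onI)
  obtain C where C: "\<And>x. u x \<le> a * ln (1 + norm x) + C" using growth_bound[OF cu gr] by blast
  have fA: "f x \<le> exp (2 * C) * W x" for x unfolding f_def by (rule exp_weight_bound[OF C])
  show "\<exists>A. \<forall>x. f x \<le> A * W x" using fA by blast
  show dens: "log_density f g p (q - 2 * a * p)"
  proof (rule density_dominated)
    show "f \<in> borel_measurable borel" unfolding f_def by measurable
    show "f x \<ge> 0" for x by (simp add: f_def k_nonneg)
    show "AE x in lborel. f x \<le> exp (2 * C) * W x" using fA by simp
  qed
  interpret F: log_density f g p "q - 2 * a * p" by (rule dens)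
  define w where "w x = u x - F.pot x / (2 * pi)" for x
  have cw: "continuous_on UNIV w" unfolding w_def by (intro continuous_intros cu F.pot_continuous) simp
  have harm: "(\<integral>x. w x * laplacian \<phi> x \<partial>lborel) = 0" if phi: "test_function \<phi>" for \<phi>
  proof -
    obtain R where R: "R > 0" "\<And>x. norm x > R \<Longrightarrow> \<phi> x = 0" "continuous_on UNIV \<phi>"
      "continuous_on UNIV (laplacian \<phi>)" "\<And>x. norm x > R \<Longrightarrow> laplacian \<phi> x = 0"
      by (rule test_functionE[OF phi]) blast
    have i1: "integrable lborel (\<lambda>x. u x * laplacian \<phi> x)"
      by (rule integrable_cpt_supp[where R=R]) (auto intro!: continuous_intros cu R simp: R(5))
    have i2: "integrable lborel (\<lambda>x. F.pot x * laplacian \<phi> x)"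
      by (rule integrable_cpt_supp[where R=R]) (auto intro!: continuous_intros F.pot_continuous R simp: R(5))
    have "(\<integral>x. w x * laplacian \<phi> x \<partial>lborel) = (\<integral>x. u x * laplacian \<phi> x - (1 / (2 * pi)) * (F.pot x * laplacian \<phi> x) \<partial>lborel)"
      by (simp add: w_def left_diff_distrib)
    also have "\<dots> = (\<integral>x. u x * laplacian \<phi> x \<partial>lborel) - (1 / (2 * pi)) * (2 * pi * (\<integral>y. f y * \<phi> y \<partial>lborel))"
      unfolding F.pot_laplacian[OF phi, symmetric] using i1 i2 by simp
    also have "(\<integral>x. u x * laplacian \<phi> x \<partial>lborel) = (\<integral>y. f y * \<phi> y \<partial>lborel)"
      using s phi by (simp add: sol_def f_def)
    finally show ?thesis by simp
  qed
  obtain C1 R1 where C1: "\<And>x. norm x \<ge> R1 \<Longrightarrow> \<bar>u x - a * ln (norm x)\<bar> \<le> C1" using gr by (auto simp: growth_def)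
  obtain C2 where C2: "C2 \<ge> 0" "\<And>x. norm x \<ge> 2 \<Longrightarrow> \<bar>F.pot x - F.mass * ln (norm x)\<bar> \<le> C2" using F.pot_asymp_bounded by blast
  define R where "R = max R1 2"
  define b where "b = a - F.mass / (2 * pi)"
  define C3 where "C3 = \<bar>C1\<bar> + C2 / (2 * pi)"
  have C3: "C3 \<ge> 0" using C2 by (simp add: C3_def)
  have wb: "\<bar>w x - b * ln (norm x)\<bar> \<le> C3" if "norm x \<ge> R" for x
  proof -
    have 1: "\<bar>u x - a * ln (norm x)\<bar> \<le> C1" and 2: "\<bar>F.pot x - F.mass * ln (norm x)\<bar> \<le> C2"
      using C1[of x] C2(2)[of x] that by (auto simp: R_def)
    have 3: "\<bar>(F.pot x - F.mass * ln (norm x)) / (2 * pi)\<bar> \<le> C2 / (2 * pi)"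
      using 2 by (simp add: divide_right_mono)
    have "w x - b * ln (norm x) = (u x - a * ln (norm x)) - (F.pot x - F.mass * ln (norm x)) / (2 * pi)"
      by (simp add: w_def b_def left_diff_distrib diff_divide_distrib)
    also have "\<bar>\<dots>\<bar> \<le> \<bar>u x - a * ln (norm x)\<bar> + \<bar>(F.pot x - F.mass * ln (norm x)) / (2 * pi)\<bar>" by (rule abs_triangle_ineq4)
    finally show ?thesis using 1 3 unfolding C3_def by linarith
  qed
  obtain D where D: "D \<ge> 0" "\<And>x. norm x \<le> R \<Longrightarrow> \<bar>w x\<bar> \<le> D" using bounded_on_cball[OF cw] by blast
  \<comment> \<open>Logarithmic growth is relaxed to a square root, the form that
    \<open>weak_Liouville\<close> takes.\<close>
  have gw: "\<bar>w x\<bar> \<le> (2 * \<bar>b\<bar> + C3 + D) * sqrt (1 + norm x)" for x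
  proof -
    have sq: "sqrt (1 + norm x) \<ge> 1" by simp
    have "(C3 + D) * 1 \<le> (C3 + D) * sqrt (1 + norm x)" using C3 D sq by (intro mult_left_mono) auto
    moreover have "\<bar>w x\<bar> \<le> \<bar>b\<bar> * (2 * sqrt (1 + norm x)) + (C3 + D)"
    proof (cases "norm x \<le> R")
      case True
      have "0 \<le> \<bar>b\<bar> * (2 * sqrt (1 + norm x))" by simp
      thus ?thesis using D(2)[OF True] C3 by linarith
    next
      case False
      hence n: "norm x \<ge> 2" "norm x \<ge> R" by (auto simp: R_def)
      have "ln (norm x) \<le> ln (1 + norm x)" using n(1) by (intro ln_mono) auto
      also have "\<dots> \<le> (1 + norm x) powr (1/2) / (1/2)" by (rule ln_le_powr) (auto simp: one_plus_norm_pos)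
      finally have "\<bar>ln (norm x)\<bar> \<le> 2 * sqrt (1 + norm x)" using n(1) one_plus_norm_pos[of x] by (simp add: powr_half_sqrt)
      hence "\<bar>b * ln (norm x)\<bar> \<le> \<bar>b\<bar> * (2 * sqrt (1 + norm x))" unfolding abs_mult by (intro mult_left_mono) auto
      thus ?thesis using wb[OF n(2)] D(1) by linarith
    qed
    ultimately show ?thesis by (simp add: algebra_simps)
  qed
  have wc: "w x = w 0" for x by (rule weak_Liouville[OF cw harm gw])
  show "\<exists>c. \<forall>x. u x = c + log_density.pot f x / (2 * pi)"
  proof (intro exI allI)
    show "u x = w 0 + F.pot x / (2 * pi)" for x using wc[of x] by (simp add: w_def)
  qed
  have "b = 0"
  proof (rule ccontr)
    assume "b \<noteq> 0"
    \<comment> \<open>At a point with ln |x| >= L the size of b ln |x| exceeds |w 0| + C3, against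
      \<open>wb\<close>.\<close>
    define L where "L = (\<bar>w 0\<bar> + C3 + 1) / \<bar>b\<bar>"
    have L: "L > 0" using C3 \<open>b \<noteq> 0\<close> by (simp add: L_def add_nonneg_pos)
    define x where "x = (max R (exp L)) *\<^sub>R (axis 1 1 :: real^2)"
    have n: "norm x = max R (exp L)" by (simp add: x_def abs_of_nonneg le_max_iff_disj)
    have "ln (exp L) \<le> ln (norm x)" unfolding n by (intro ln_mono) auto
    hence l: "L \<le> ln (norm x)" by simp
    have "\<bar>b\<bar> * L \<le> \<bar>b * ln (norm x)\<bar>" using l L unfolding abs_mult by (intro mult_left_mono) auto
    hence "\<bar>w 0\<bar> + C3 + 1 \<le> \<bar>b * ln (norm x)\<bar>" using \<open>b \<noteq> 0\<close> by (simp add: L_def)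
    moreover have "\<bar>w x - b * ln (norm x)\<bar> \<le> C3" by (rule wb) (simp add: n)
    ultimately show False using wc[of x] by linarith
  qed
  thus "(\<integral>x. f x \<partial>lborel) = 2 * pi * a" by (simp add: b_def F.mass_def field_simps)
qed

theorem solution_unique:
  assumes u: "sol u" "growth u" and v: "sol v" "growth v"
  shows "u = v"
proof -
  define f1 where "f1 = (\<lambda>x. k x * exp (2 * u x))"
  define f2 where "f2 = (\<lambda>x. k x * exp (2 * v x))"
  note r1 = representation[OF u, folded f1_def] and r2 = representation[OF v, folded f2_def]
  interpret F1: log_density f1 g p "q - 2 * a * p" by (rule r1)
  interpret F2: log_density f2 g p "q - 2 * a * p" by (rule r2)
  obtain c1 c2 where c1: "\<And>x. u x = c1 + F1.pot x / (2 * pi)" and c2: "\<And>x. v x = c2 + F2.pot x / (2 * pi)"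
    using r1(4) r2(4) by blast
  obtain A1 where A1: "\<And>x. k x * exp (2 * u x) \<le> A1 * W x" using representation(2)[OF u] by blast
  obtain A2 where A2: "\<And>x. k x * exp (2 * v x) \<le> A2 * W x" using representation(2)[OF v] by blast
  have A: "f1 x \<le> A1 * W x" "f2 x \<le> A2 * W x" for x using A1 A2 by (auto simp: f1_def f2_def)
  have m12: "(\<integral>x. f1 x \<partial>lborel) = 2 * pi * a" "(\<integral>x. f2 x \<partial>lborel) = 2 * pi * a"
    using representation(3)[OF u] representation(3)[OF v] by (simp_all add: f1_def f2_def)
  define \<rho> where "\<rho> x = f1 x - f2 x" for x
  have [measurable]: "\<rho> \<in> borel_measurable borel" unfolding \<rho>_def[abs_def] by measurable
  have dom: "\<bar>\<rho> x\<bar> \<le> (\<bar>A1\<bar> + \<bar>A2\<bar>) * W x" for x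
  proof -
    have "A1 * W x \<le> \<bar>A1\<bar> * W x" "A2 * W x \<le> \<bar>A2\<bar> * W x" by (intro mult_right_mono W_nonneg abs_ge_self)+
    thus ?thesis using A[of x] F1.f_nonneg[of x] F2.f_nonneg[of x] unfolding \<rho>_def abs_le_iff
      by (auto simp: distrib_right)
  qed
  have neutral: "(\<integral>x. \<rho> x \<partial>lborel) = 0"
    using F1.int_f F2.int_f m12 by (simp add: \<rho>_def)
  have irho: "integrable lborel \<rho>" unfolding \<rho>_def using F1.int_f F2.int_f by simp
  have pot: "(\<integral>y. ln (norm (x - y)) * \<rho> y \<partial>lborel) = F1.pot x - F2.pot x" for x
    using F1.pot_integrable[of x] F2.pot_integrable[of x]
    by (simp add: \<rho>_def right_diff_distrib F1.pot_def F2.pot_def)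
  have E: "integrable lborel (\<lambda>x. \<rho> x * (F1.pot x - F2.pot x))" "(\<integral>x. \<rho> x * (F1.pot x - F2.pot x) \<partial>lborel) \<le> 0"
    using W.log_energy[OF _ dom neutral] by (simp_all add: pot)
  define d where "d x = u x - v x" for x
  \<comment> \<open>The additive constants pair with the neutral \<rho> to 0, so the integral of
    \<rho> d is the logarithmic energy divided by 2 pi.\<close>
  have dd: "\<rho> x * d x = (c1 - c2) * \<rho> x + (1 / (2 * pi)) * (\<rho> x * (F1.pot x - F2.pot x))" for x
    unfolding d_def c1 c2 by (simp add: algebra_simps diff_divide_distrib)
  have id: "integrable lborel (\<lambda>x. \<rho> x * d x)" unfolding dd using irho E(1) by simp
  have "(\<integral>x. \<rho> x * d x \<partial>lborel) = (1 / (2 * pi)) * (\<integral>x. \<rho> x * (F1.pot x - F2.pot x) \<partial>lborel)"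
    unfolding dd using irho E(1) neutral by simp
  also have "\<dots> \<le> 0" using E(2) by (simp add: divide_le_0_iff)
  finally have le: "(\<integral>x. \<rho> x * d x \<partial>lborel) \<le> 0" .
  have nn: "\<rho> x * d x \<ge> 0" for x
  proof -
    have "(exp (2 * u x) - exp (2 * v x)) * (u x - v x) \<ge> 0"
    proof (cases "u x \<ge> v x")
      case True
      thus ?thesis by (intro mult_nonneg_nonneg) auto
    next
      case False
      thus ?thesis by (intro mult_nonpos_nonpos) auto
    qed
    hence "k x * ((exp (2 * u x) - exp (2 * v x)) * (u x - v x)) \<ge> 0"
      by (rule mult_nonneg_nonneg[OF k_nonneg])
    thus ?thesis by (simp add: \<rho>_def f1_def f2_def d_def algebra_simps)
  qed
  have "(\<integral>x. \<rho> x * d x \<partial>lborel) \<ge> 0" by (intro Bochner_Integration.integral_nonneg nn)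
  hence "(\<integral>x. \<rho> x * d x \<partial>lborel) = 0" using le by simp
  hence "AE x in lborel. \<rho> x * d x = 0"
    using integral_nonneg_eq_0_iff_AE[OF id] nn by simp
  hence AE: "AE x in lborel. k x = 0 \<or> d x = 0"
  proof eventually_elim
    case (elim x)
    have "k x * (exp (2 * u x) - exp (2 * v x)) = 0 \<or> d x = 0"
      using elim by (simp add: \<rho>_def f1_def f2_def right_diff_distrib)
    thus ?case by (auto simp: d_def)
  qed
  \<comment> \<open>Where k = 0 both densities vanish and elsewhere u = v, so the densities agree
    almost everywhere and their potentials everywhere. Hence u - v is constant, and a nonzero
    constant would force k = 0 almost everywhere.\<close>
  hence f12: "AE x in lborel. f1 x = f2 x"
    by eventually_elim (auto simp: f1_def f2_def d_def)
  have "F1.pot x = F2.pot x" for x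
    unfolding F1.pot_def F2.pot_def
  proof (rule integral_cong_AE)
    show "AE y in lborel. ln (norm (x - y)) * f1 y = ln (norm (x - y)) * f2 y"
      using f12 by eventually_elim simp
  qed measurable
  hence dc: "d x = c1 - c2" for x by (simp add: d_def c1 c2)
  have "c1 - c2 = 0"
  proof (rule ccontr)
    assume "c1 - c2 \<noteq> 0"
    hence "AE x in lborel. k x = 0" using AE by (simp add: dc)
    thus False using k_nonzero by blast
  qed
  thus ?thesis using dc by (auto simp: d_def fun_eq_iff)
qed

section \<open>The nonnegative kernel and the existence of a solution\<close>

definition kap :: "real ^ 2 \<Rightarrow> real ^ 2 \<Rightarrow> real" where
  "kap x y = ln ((1 + norm x) * (1 + norm y) / norm (x - y)) / (2 * pi)"

lemma kap_eq:
  assumes "x \<noteq> y"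
  shows "kap x y = (ln (1 + norm x) + ln (1 + norm y) - ln (norm (x - y))) / (2 * pi)"
  using assms one_plus_norm_pos[of x] one_plus_norm_pos[of y] by (simp add: kap_def ln_div ln_mult_pos)

text \<open>The inequality |x - y| <= (1 + |x|) (1 + |y|) makes the logarithm nonnegative. On the
  diagonal division by zero and \<open>ln 0 = 0\<close> give the value 0.\<close>

lemma kap_nonneg: "kap x y \<ge> 0"
proof (cases "x = y")
  case False
  have "(1 + norm x) * (1 + norm y) = 1 + norm x + norm y + norm x * norm y" by (simp add: algebra_simps)
  hence "norm (x - y) \<le> (1 + norm x) * (1 + norm y)"
    using norm_triangle_ineq4[of x y] mult_nonneg_nonneg[OF norm_ge_zero[of x] norm_ge_zero[of y]] by linarith
  hence "1 \<le> (1 + norm x) * (1 + norm y) / norm (x - y)" using False by simp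
  thus ?thesis by (simp add: kap_def)
qed (simp add: kap_def)

lemma kap_meas [measurable]: "(\<lambda>u. kap (fst u) (snd u)) \<in> borel_measurable (borel \<Otimes>\<^sub>M borel)"
proof -
  have "(\<lambda>u. norm (fst u - snd u :: real^2)) \<in> borel_measurable (borel \<Otimes>\<^sub>M borel)"
    unfolding borel_prod by (intro borel_measurable_continuous_onI continuous_intros)
  thus ?thesis unfolding kap_def by measurable
qed

lemma int_W_ln: "integrable lborel (\<lambda>x. ln (1 + norm x) * W x)"
proof (rule Bochner_Integration.integrable_bound[OF integrable_mult_right[OF W.int_g, of "1 / g"]])
  show "AE x in lborel. norm (ln (1 + norm x) * W x) \<le> norm (1 / g * (W x * (1 + norm x) powr g))"
  proof (rule AE_I2)
    fix x :: "real^2"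
    have "ln (1 + norm x) \<le> (1 + norm x) powr g / g" using g by (intro ln_le_powr one_plus_norm_pos) auto
    hence "ln (1 + norm x) * W x \<le> (1 + norm x) powr g / g * W x" by (intro mult_right_mono W_nonneg)
    thus "norm (ln (1 + norm x) * W x) \<le> norm (1 / g * (W x * (1 + norm x) powr g))"
      using W_nonneg[of x] g by (simp add: abs_mult mult_ac)
  qed
qed measurable

text \<open>In the kernel the terms depending on one variable only are irrelevant against neutral
  densities; they make the kernel nonnegative.\<close>

lemma kap_integral:
  assumes rho [measurable]: "\<rho> \<in> borel_measurable borel" and dom: "\<And>x. \<bar>\<rho> x\<bar> \<le> C * W x"
  shows "integrable lborel \<rho>" "integrable lborel (\<lambda>y. kap x y * \<rho> y)"
    "(\<integral>y. kap x y * \<rho> y \<partial>lborel) = (ln (1 + norm x) * (\<integral>y. \<rho> y \<partial>lborel)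
        + (\<integral>y. ln (1 + norm y) * \<rho> y \<partial>lborel) - (\<integral>y. ln (norm (x - y)) * \<rho> y \<partial>lborel)) / (2 * pi)"
proof -
  show i1: "integrable lborel \<rho>"
    by (rule Bochner_Integration.integrable_bound[OF integrable_mult_right[OF W.int_f, of C]])
       (use order_trans[OF dom abs_ge_self] in \<open>auto intro!: AE_I2\<close>)
  have i2: "integrable lborel (\<lambda>y. ln (1 + norm y) * \<rho> y)"
  proof (rule Bochner_Integration.integrable_bound[OF integrable_mult_right[OF int_W_ln, of C]])
    show "AE y in lborel. norm (ln (1 + norm y) * \<rho> y) \<le> norm (C * (ln (1 + norm y) * W y))"
    proof (rule AE_I2)
      fix y :: "real^2"
      have "ln (1 + norm y) * \<bar>\<rho> y\<bar> \<le> ln (1 + norm y) * (C * W y)" by (intro mult_left_mono dom) simp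
      also have "\<dots> = C * (ln (1 + norm y) * W y)" by simp
      also have "\<dots> \<le> norm (C * (ln (1 + norm y) * W y))" by simp
      finally show "norm (ln (1 + norm y) * \<rho> y) \<le> norm (C * (ln (1 + norm y) * W y))"
        by (simp only: real_norm_def abs_mult[of "ln (1 + norm y)" "\<rho> y"]) simp
    qed
  qed measurable
  have i3: "integrable lborel (\<lambda>y. ln (norm (x - y)) * \<rho> y)"
  proof (rule Bochner_Integration.integrable_bound[OF integrable_mult_right[OF W.abs_pot_integrable[of x], of C]])
    show "AE y in lborel. norm (ln (norm (x - y)) * \<rho> y) \<le> norm (C * (\<bar>ln (norm (x - y))\<bar> * W y))"
    proof (rule AE_I2)
      fix y :: "real^2"
      have "\<bar>ln (norm (x - y))\<bar> * \<bar>\<rho> y\<bar> \<le> \<bar>ln (norm (x - y))\<bar> * (C * W y)" by (intro mult_left_mono dom) simp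
      also have "\<dots> = C * (\<bar>ln (norm (x - y))\<bar> * W y)" by simp
      also have "\<dots> \<le> norm (C * (\<bar>ln (norm (x - y))\<bar> * W y))" by (simp only: real_norm_def abs_ge_self)
      finally show "norm (ln (norm (x - y)) * \<rho> y) \<le> norm (C * (\<bar>ln (norm (x - y))\<bar> * W y))"
        by (simp only: real_norm_def abs_mult[of "ln (norm (x - y))" "\<rho> y"])
    qed
  qed measurable
  define e where "e y = (1 / (2 * pi)) * (ln (1 + norm x) * \<rho> y + ln (1 + norm y) * \<rho> y - ln (norm (x - y)) * \<rho> y)" for y
  have ie: "integrable lborel e" unfolding e_def[abs_def] using i1 i2 i3 by simp
  have mk: "(\<lambda>y. kap x y * \<rho> y) \<in> borel_measurable lborel"
    using measurable_compose[OF _ kap_meas, of "\<lambda>y. (x, y)" borel] by simp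
  have AE: "AE y in lborel. kap x y * \<rho> y = e y"
    using AE_lborel_singleton[of x]
    by eventually_elim (simp add: kap_eq e_def distrib_right left_diff_distrib add_divide_distrib diff_divide_distrib)
  have me: "e \<in> borel_measurable lborel" using ie by auto
  show "integrable lborel (\<lambda>y. kap x y * \<rho> y)"
    using ie integrable_cong_AE[OF mk me AE] by simp
  have "(\<integral>y. kap x y * \<rho> y \<partial>lborel) = (\<integral>y. e y \<partial>lborel)" by (rule integral_cong_AE[OF mk me AE])
  also have "\<dots> = (1 / (2 * pi)) * (ln (1 + norm x) * (\<integral>y. \<rho> y \<partial>lborel)
        + (\<integral>y. ln (1 + norm y) * \<rho> y \<partial>lborel) - (\<integral>y. ln (norm (x - y)) * \<rho> y \<partial>lborel))"
    unfolding e_def[abs_def] using i1 i2 i3 by simp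
  finally show "(\<integral>y. kap x y * \<rho> y \<partial>lborel) = (ln (1 + norm x) * (\<integral>y. \<rho> y \<partial>lborel)
        + (\<integral>y. ln (1 + norm y) * \<rho> y \<partial>lborel) - (\<integral>y. ln (norm (x - y)) * \<rho> y \<partial>lborel)) / (2 * pi)"
    by simp
qed

theorem solution_exists: "\<exists>u. sol u \<and> growth u"
proof -
  define \<mu> where "\<mu> = density lborel (\<lambda>x. ennreal (W x))"
  have sets_mu [measurable_cong]: "sets \<mu> = sets borel" by (simp add: \<mu>_def)
  have space_mu [simp]: "space \<mu> = UNIV" by (simp add: \<mu>_def)
  have bm: "borel_measurable \<mu> = borel_measurable borel" by (intro measurable_cong_sets sets_mu refl)
  have int_mu: "(\<integral>x. d x \<partial>\<mu>) = (\<integral>x. W x * d x \<partial>lborel)" if "d \<in> borel_measurable borel" for d :: "real^2 \<Rightarrow> real"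
    unfolding \<mu>_def using that W_nonneg by (subst integral_density) auto
  have intg_mu: "integrable \<mu> d = integrable lborel (\<lambda>x. W x * d x)" if "d \<in> borel_measurable borel" for d :: "real^2 \<Rightarrow> real"
    unfolding \<mu>_def using that W_nonneg by (subst integrable_density) auto
  have kapx [measurable]: "kap x \<in> borel_measurable borel" for x
    using measurable_compose[OF _ kap_meas, of "\<lambda>y. (x, y)" borel] by simp
  have emass: "emeasure \<mu> UNIV = ennreal W.mass"
  proof -
    have "emeasure \<mu> UNIV = (\<integral>\<^sup>+x. ennreal (W x) \<partial>lborel)" unfolding \<mu>_def by (subst emeasure_density) auto
    also have "\<dots> = ennreal W.mass" unfolding W.mass_def using W.int_f W_nonneg by (intro nn_integral_eq_integral) auto
    finally show ?thesis .
  qed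
  have Wpos: "W.mass > 0"
  proof -
    have "W.mass \<noteq> 0"
    proof
      assume "W.mass = 0"
      hence "AE x in lborel. W x = 0"
        unfolding W.mass_def using integral_nonneg_eq_0_iff_AE[OF W.int_f] W_nonneg by auto
      hence "AE x in lborel. k x = 0"
      proof eventually_elim
        case (elim x)
        thus ?case using one_plus_norm_pos[of x] by (simp add: W_def)
      qed
      thus False using k_nonzero by blast
    qed
    thus ?thesis using W.mass_nonneg by simp
  qed
  obtain C0 where C0: "C0 \<ge> 0" "\<And>x. \<bar>W.pot x - W.mass * ln (1 + norm x)\<bar> \<le> C0" using W.pot_bound by blast
  define J where "J = (\<integral>y. ln (1 + norm y) * W y \<partial>lborel)"
  have J0: "J \<ge> 0" unfolding J_def by (intro Bochner_Integration.integral_nonneg mult_nonneg_nonneg W_nonneg) simp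
  \<comment> \<open>In the row integral ln (1 + |x|) times the mass cancels the potential up to C0,
    by \<open>pot_bound\<close>; the summand 1 makes B positive.\<close>
  define B where "B = (C0 + J) / (2 * pi) + 1"
  have WC: "\<bar>W x\<bar> \<le> 1 * W x" for x using W_nonneg[of x] by simp
  interpret fm: finite_measure \<mu> by (rule finite_measureI) (simp add: emass)
  interpret pk: positive_kernel \<mu> kap B
  proof
    show "(\<lambda>(x, y). kap x y) \<in> borel_measurable (\<mu> \<Otimes>\<^sub>M \<mu>)"
      using kap_meas unfolding case_prod_unfold by (simp cong: measurable_cong_sets sets_pair_measure_cong add: sets_mu)
    show "kap x y \<ge> 0" for x y by (rule kap_nonneg)
    show "kap x y = kap y x" for x y by (simp add: kap_def norm_minus_commute mult.commute)
    show "integrable \<mu> (kap x)" for x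
      using kap_integral(2)[OF W_meas WC, of x] by (simp add: intg_mu mult.commute)
    show "(\<integral>y. kap x y \<partial>\<mu>) \<le> B" for x
    proof -
      have "(\<integral>y. kap x y \<partial>\<mu>) = (ln (1 + norm x) * W.mass + J - W.pot x) / (2 * pi)"
        using kap_integral(3)[OF W_meas WC, of x] by (simp add: int_mu W.mass_def J_def W.pot_def mult.commute)
      also have "\<dots> \<le> (C0 + J) / (2 * pi)"
        using C0(2)[of x] by (intro divide_right_mono) (auto simp: mult.commute abs_le_iff)
      finally show ?thesis by (simp add: B_def)
    qed
    show "B > 0" using C0 J0 by (simp add: B_def add_nonneg_pos)
    show "measure \<mu> (space \<mu>) > 0" using Wpos by (simp add: measure_def emass)
    show "(\<integral>x. d x * (\<integral>y. kap x y * d y \<partial>\<mu>) \<partial>\<mu>) \<ge> 0"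
      if d: "d \<in> borel_measurable \<mu>" and C: "\<And>x. x \<in> space \<mu> \<Longrightarrow> \<bar>d x\<bar> \<le> C" and d0: "(\<integral>x. d x \<partial>\<mu>) = 0" for d C
    proof -
      have [measurable]: "d \<in> borel_measurable borel" using d by (simp add: bm)
      define \<rho> where "\<rho> x = W x * d x" for x
      have rm [measurable]: "\<rho> \<in> borel_measurable borel" unfolding \<rho>_def[abs_def] by measurable
      have dom: "\<bar>\<rho> x\<bar> \<le> C * W x" for x
        using mult_left_mono[OF C[of x] W_nonneg[of x]] W_nonneg[of x] by (simp add: \<rho>_def abs_mult mult.commute)
      have neutral: "(\<integral>x. \<rho> x \<partial>lborel) = 0" using d0 by (simp add: int_mu \<rho>_def)
      \<comment> \<open>Neutrality removes the term with ln (1 + |x|) here. The remaining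
        one-variable term does not depend on x, so the outer integration against \<rho> removes it
        as well.\<close>
      have inner: "(\<integral>y. kap x y * d y \<partial>\<mu>) = ((\<integral>y. ln (1 + norm y) * \<rho> y \<partial>lborel) - (\<integral>y. ln (norm (x - y)) * \<rho> y \<partial>lborel)) / (2 * pi)" for x
      proof -
        have "(\<integral>y. kap x y * d y \<partial>\<mu>) = (\<integral>y. kap x y * \<rho> y \<partial>lborel)"
          by (subst int_mu) (auto simp: \<rho>_def mult_ac)
        thus ?thesis using kap_integral(3)[OF rm dom, of x] by (simp add: neutral)
      qed
      note E = W.log_energy[OF rm dom neutral]
      have mp: "(\<lambda>x. \<integral>y. ln (norm (x - y)) * \<rho> y \<partial>lborel) \<in> borel_measurable borel"
        by measurable
      have "(\<integral>x. d x * (\<integral>y. kap x y * d y \<partial>\<mu>) \<partial>\<mu>) = (\<integral>x. (1 / (2 * pi)) * ((\<integral>y. ln (1 + norm y) * \<rho> y \<partial>lborel) * \<rho> x - \<rho> x * (\<integral>y. ln (norm (x - y)) * \<rho> y \<partial>lborel)) \<partial>lborel)"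
        unfolding inner
        by (subst int_mu) (use mp in \<open>auto intro!: Bochner_Integration.integral_cong simp: \<rho>_def right_diff_distrib diff_divide_distrib mult_ac\<close>)
      also have "\<dots> = (1 / (2 * pi)) * (0 - (\<integral>x. \<rho> x * (\<integral>y. ln (norm (x - y)) * \<rho> y \<partial>lborel) \<partial>lborel))"
        using kap_integral(1)[OF rm dom] E(1) neutral by simp
      also have "\<dots> \<ge> 0" using E(2) by (simp add: divide_le_0_iff)
      finally show ?thesis .
    qed
  qed
  \<comment> \<open>By \<open>representation\<close>, 2 pi a is the mass that growth like a ln |x|
    forces.\<close>
  obtain \<rho> l b c where l: "0 < l" and rm: "\<rho> \<in> borel_measurable \<mu>" and rb: "\<And>x. l \<le> \<rho> x" "\<And>x. \<rho> x \<le> b"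
    and rM: "(\<integral>x. \<rho> x \<partial>\<mu>) = 2 * pi * a" and rc: "AE x in \<mu>. ln (\<rho> x) / 2 + (\<integral>y. kap x y * \<rho> y \<partial>\<mu>) = c"
    using pk.exists_solution[of "2 * pi * a"] a by auto blast
  have [measurable]: "\<rho> \<in> borel_measurable borel" using rm by (simp add: bm)
  define f where "f x = W x * \<rho> x" for x
  have r0: "\<rho> x > 0" for x using l rb(1)[of x] by linarith
  have fm [measurable]: "f \<in> borel_measurable borel" unfolding f_def[abs_def] by measurable
  have f0: "f x \<ge> 0" for x unfolding f_def using W_nonneg r0[of x] by simp
  have fb: "f x \<le> b * W x" for x
    unfolding f_def using mult_left_mono[OF rb(2)[of x] W_nonneg[of x]] by (simp add: mult.commute)
  have fdom: "\<bar>f x\<bar> \<le> b * W x" for x using fb[of x] f0[of x] by simp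
  interpret F: log_density f g p "q - 2 * a * p" by (rule density_dominated[of f b]) (use f0 fb in auto)
  have Fm: "F.mass = 2 * pi * a" using rM by (simp add: F.mass_def int_mu f_def)
  define J' where "J' = (\<integral>y. ln (1 + norm y) * f y \<partial>lborel)"
  have Gr: "(\<integral>y. kap x y * \<rho> y \<partial>\<mu>) = a * ln (1 + norm x) + J' / (2 * pi) - F.pot x / (2 * pi)" for x
  proof -
    have "(\<integral>y. kap x y * \<rho> y \<partial>\<mu>) = (\<integral>y. kap x y * f y \<partial>lborel)"
      by (subst int_mu) (auto simp: f_def mult_ac)
    also have "\<dots> = (ln (1 + norm x) * F.mass + J' - F.pot x) / (2 * pi)"
      using kap_integral(3)[OF fm fdom, of x] by (simp add: F.mass_def J'_def F.pot_def)
    also have "\<dots> = a * ln (1 + norm x) + J' / (2 * pi) - F.pot x / (2 * pi)"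
      unfolding Fm by (simp add: add_divide_distrib diff_divide_distrib)
    finally show ?thesis .
  qed
  \<comment> \<open>The integral equation holds only almost everywhere for W dx, while u must be
    continuous, so u is defined at every point through the potential. The constant collects the
    multiplier c and the one-variable term J' of the kernel.\<close>
  define u where "u x = (c - J' / (2 * pi)) + F.pot x / (2 * pi)" for x
  have cu: "continuous_on UNIV u" unfolding u_def by (intro continuous_intros F.pot_continuous) simp
  have [measurable]: "u \<in> borel_measurable borel" using cu by (rule borel_measurable_continuous_onI)
  \<comment> \<open>Where W > 0 the integral equation reads ln \<rho> = 2 u - 2 a ln (1 + |x|), that
    is, W \<rho> = k exp (2 u); where W = 0 both sides vanish.\<close>
  have fu: "AE x in lborel. f x = k x * exp (2 * u x)"
  proof -
    have "AE x in lborel. 0 < W x \<longrightarrow> ln (\<rho> x) / 2 + (\<integral>y. kap x y * \<rho> y \<partial>\<mu>) = c"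
      using rc unfolding \<mu>_def by (subst (asm) AE_density) auto
    thus ?thesis
    proof eventually_elim
      case (elim x)
      show ?case
      proof (cases "W x = 0")
        case True
        hence "k x = 0" using one_plus_norm_pos[of x] by (simp add: W_def)
        thus ?thesis using True by (simp add: f_def)
      next
        case False
        hence "0 < W x" using W_nonneg[of x] by simp
        hence "ln (\<rho> x) / 2 + (a * ln (1 + norm x) + J' / (2 * pi) - F.pot x / (2 * pi)) = c" using elim unfolding Gr by blast
        hence "ln (\<rho> x) = 2 * u x - 2 * (a * ln (1 + norm x))" 
        proof -
          have "L = 2 * ((C - Y) + P) - 2 * H" if "L / 2 + (H + Y - P) = C" for L H Y P C :: real
            unfolding that[symmetric] by (simp add: algebra_simps)
          thus ?thesis using \<open>ln (\<rho> x) / 2 + _ = c\<close> unfolding u_def by blast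
        qed
        hence "exp (ln (\<rho> x)) = exp (2 * u x - 2 * a * ln (1 + norm x))" by (simp add: mult.assoc)
        hence "\<rho> x = exp (2 * u x) / (1 + norm x) powr (2 * a)"
          using r0[of x] one_plus_norm_pos[of x] by (simp add: exp_diff powr_def)
        thus ?thesis using one_plus_norm_pos[of x] by (simp add: f_def W_def)
      qed
    qed
  qed
  have "sol u"
    unfolding sol_def
  proof (intro conjI allI impI cu)
    fix \<phi> :: "real^2 \<Rightarrow> real" assume phi: "test_function \<phi>"
    obtain R where R: "R > 0" "\<And>x. norm x > R \<Longrightarrow> \<phi> x = 0" "continuous_on UNIV \<phi>"
      "continuous_on UNIV (laplacian \<phi>)" "\<And>x. norm x > R \<Longrightarrow> laplacian \<phi> x = 0"
      by (rule test_functionE[OF phi]) blast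
    have [measurable]: "\<phi> \<in> borel_measurable borel" using R(3) by (rule borel_measurable_continuous_onI)
    have i0: "integrable lborel (laplacian \<phi>)" by (rule integrable_cpt_supp[OF R(4,5)])
    have i1: "integrable lborel (\<lambda>x. F.pot x * laplacian \<phi> x)"
      by (rule integrable_cpt_supp[where R=R]) (auto intro!: continuous_intros F.pot_continuous R simp: R(5))
    \<comment> \<open>Constants are weakly harmonic, so the additive constant of u drops out of the
      equation.\<close>
    have lap0: "(\<integral>x. laplacian \<phi> x \<partial>lborel) = 0"
    proof -
      have one: "partial_deriv i (\<lambda>_. 1 :: real) = (\<lambda>_ :: real^2. 0)" for i
        by (rule ext, rule partial_deriv_eqI) simp
      have zero: "partial_deriv i (\<lambda>_. 0 :: real) = (\<lambda>_ :: real^2. 0)" for i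
        by (rule ext, rule partial_deriv_eqI) simp
      have "(\<integral>x. 1 * laplacian \<phi> x \<partial>lborel) = (\<integral>x. laplacian (\<lambda>_. 1) x * \<phi> x \<partial>lborel)"
        by (rule integral_laplacian_by_parts[OF phi]) (auto simp: one zero)
      thus ?thesis by (simp add: laplacian_def one zero)
    qed
    have "(\<integral>x. u x * laplacian \<phi> x \<partial>lborel) = (\<integral>x. (c - J' / (2 * pi)) * laplacian \<phi> x + (1 / (2 * pi)) * (F.pot x * laplacian \<phi> x) \<partial>lborel)"
      by (simp add: u_def distrib_right)
    also have "\<dots> = (c - J' / (2 * pi)) * 0 + (1 / (2 * pi)) * (2 * pi * (\<integral>y. f y * \<phi> y \<partial>lborel))"
      unfolding F.pot_laplacian[OF phi, symmetric] lap0[symmetric] using i0 i1 by simp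
    also have "\<dots> = (\<integral>y. f y * \<phi> y \<partial>lborel)" by simp
    also have "\<dots> = (\<integral>x. k x * exp (2 * u x) * \<phi> x \<partial>lborel)"
    proof (rule integral_cong_AE)
      show "AE x in lborel. f x * \<phi> x = k x * exp (2 * u x) * \<phi> x" using fu by eventually_elim simp
    qed measurable
    finally show "(\<integral>x. u x * laplacian \<phi> x \<partial>lborel) = (\<integral>x. k x * exp (2 * u x) * \<phi> x \<partial>lborel)" .
  qed
  moreover have "growth u"
  proof -
    obtain C where C: "C \<ge> 0" "\<And>x. norm x \<ge> 2 \<Longrightarrow> \<bar>F.pot x - F.mass * ln (norm x)\<bar> \<le> C" using F.pot_asymp_bounded by blast
    have "\<bar>u x - a * ln (norm x)\<bar> \<le> \<bar>c - J' / (2 * pi)\<bar> + C / (2 * pi)" if "norm x \<ge> 2" for x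
    proof -
      have "u x - a * ln (norm x) = (c - J' / (2 * pi)) + (F.pot x - F.mass * ln (norm x)) / (2 * pi)"
        unfolding Fm by (simp add: u_def diff_divide_distrib)
      also have "\<bar>\<dots>\<bar> \<le> \<bar>c - J' / (2 * pi)\<bar> + \<bar>(F.pot x - F.mass * ln (norm x)) / (2 * pi)\<bar>" by (rule abs_triangle_ineq)
      also have "\<bar>(F.pot x - F.mass * ln (norm x)) / (2 * pi)\<bar> \<le> C / (2 * pi)"
        using C(2)[OF that] by (simp add: divide_right_mono)
      finally show ?thesis by simp
    qed
    thus ?thesis unfolding growth_def by blast
  qed
  ultimately show ?thesis by blast
qed

end

subsection \<open>Lebesgue measurable weights\<close>

lemma log_growth_iff:
  "log_growth a u \<longleftrightarrow> (\<exists>C R. \<forall>x. norm x \<ge> R \<longrightarrow> \<bar>u x - a * ln (norm x)\<bar> \<le> C)"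
proof
  assume "log_growth a u"
  then obtain C where "\<forall>\<^sub>F x in at_infinity. norm (u x - a * ln (norm x)) \<le> C * norm (1 :: real)"
    unfolding log_growth_def by (elim landau_o.bigE)
  thus "\<exists>C R. \<forall>x. norm x \<ge> R \<longrightarrow> \<bar>u x - a * ln (norm x)\<bar> \<le> C"
    by (auto simp: eventually_at_infinity)
next
  assume "\<exists>C R. \<forall>x. norm x \<ge> R \<longrightarrow> \<bar>u x - a * ln (norm x)\<bar> \<le> C"
  then obtain C R where C: "\<And>x. norm x \<ge> R \<Longrightarrow> \<bar>u x - a * ln (norm x)\<bar> \<le> C" by blast
  show "log_growth a u" unfolding log_growth_def
    by (rule bigoI[of _ C]) (use C in \<open>auto simp: eventually_at_infinity\<close>)
qed

lemma alpha_greaterE: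
  assumes "alpha p K > ereal b"
  obtains a where "a > b"
    "(\<integral>\<^sup>+ x. ennreal (\<bar>K x\<bar> powr p * (1 + norm x) powr (2 * a * p + 2 * (p - 1))) \<partial>lebesgue) < \<infinity>"
  using assms unfolding alpha_def less_SUP_iff by auto

text \<open>The potential theory is carried out for Borel functions while K is Lebesgue measurable;
  a Borel k equal to -K almost everywhere has the same integrals.\<close>

lemma integrable_Borel_version:
  assumes [measurable]: "k \<in> borel_measurable (borel :: (real^2) measure)" and AE: "AE x in lborel. K x = - k x"
    and k0: "\<And>x. k x \<ge> 0"
    and fin: "(\<integral>\<^sup>+ x. ennreal (\<bar>K x\<bar> powr p * (1 + norm x) powr r) \<partial>lebesgue) < \<infinity>"
  shows "integrable lborel (\<lambda>x. k x powr p * (1 + norm x) powr r)"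
proof (rule integrableI_nonneg)
  have "(\<integral>\<^sup>+ x. ennreal (k x powr p * (1 + norm x) powr r) \<partial>lborel)
      = (\<integral>\<^sup>+ x. ennreal (k x powr p * (1 + norm x) powr r) \<partial>lebesgue)"
    by (rule nn_integral_completion[symmetric])
  also have "\<dots> = (\<integral>\<^sup>+ x. ennreal (\<bar>K x\<bar> powr p * (1 + norm x) powr r) \<partial>lebesgue)"
  proof (rule nn_integral_cong_AE)
    have "AE x in lebesgue. K x = - k x" by (rule AE_completion[OF AE])
    thus "AE x in lebesgue. ennreal (k x powr p * (1 + norm x) powr r) = ennreal (\<bar>K x\<bar> powr p * (1 + norm x) powr r)"
      by eventually_elim (simp add: k0)
  qed
  finally show "(\<integral>\<^sup>+ x. ennreal (k x powr p * (1 + norm x) powr r) \<partial>lborel) < \<infinity>" using fin by simp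
qed auto

lemma lebesgue_integral_Borel_version:
  fixes K k F :: "real ^ 2 \<Rightarrow> real"
  assumes [measurable]: "k \<in> borel_measurable borel" "F \<in> borel_measurable borel"
    and K: "K \<in> borel_measurable lebesgue" and AE: "AE x in lborel. K x = - k x"
  shows "(\<integral>x. K x * F x \<partial>lebesgue) = - (\<integral>x. k x * F x \<partial>lborel)"
    "integrable lebesgue (\<lambda>x. K x * F x) \<longleftrightarrow> integrable lborel (\<lambda>x. k x * F x)"
proof -
  have F: "F \<in> borel_measurable lebesgue" "k \<in> borel_measurable lebesgue"
    by (auto intro: measurable_completion)
  have AE': "AE x in lebesgue. K x * F x = - (k x * F x)"
    using AE_completion[OF AE] by eventually_elim simp
  have m: "(\<lambda>x. K x * F x) \<in> borel_measurable lebesgue" "(\<lambda>x. - (k x * F x)) \<in> borel_measurable lebesgue"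
    using K F by auto
  have "(\<integral>x. K x * F x \<partial>lebesgue) = (\<integral>x. - (k x * F x) \<partial>lebesgue)" by (rule integral_cong_AE[OF m AE'])
  also have "\<dots> = (\<integral>x. - (k x * F x) \<partial>lborel)" by (rule integral_completion) auto
  finally show "(\<integral>x. K x * F x \<partial>lebesgue) = - (\<integral>x. k x * F x \<partial>lborel)" by simp
  have "integrable lebesgue (\<lambda>x. K x * F x) \<longleftrightarrow> integrable lebesgue (\<lambda>x. - (k x * F x))"
    by (rule integrable_cong_AE[OF m AE'])
  also have "\<dots> \<longleftrightarrow> integrable lborel (\<lambda>x. - (k x * F x))" by (rule integrable_completion) auto
  finally show "integrable lebesgue (\<lambda>x. K x * F x) \<longleftrightarrow> integrable lborel (\<lambda>x. k x * F x)" by simp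
qed

theorem theorem1p1:
  fixes K :: "real ^ 2 \<Rightarrow> real"
  assumes nonpos: "\<And>x. K x \<le> 0"
    and loc_bdd: "locally_bounded K"
    and nonzero: "\<not> (AE x in lebesgue. K x = 0)"
    and alpha1: "alpha 1 K > 0"
    and alphap: "\<exists>p::real. p > 1 \<and> alpha p K > -\<infinity>"
  shows "\<forall>\<alpha>::real. 0 < \<alpha> \<and> ereal \<alpha> < alpha 1 K \<longrightarrow>
    (\<exists>!u. is_solution K u \<and> log_growth \<alpha> u) \<and>
    (\<forall>u. is_solution K u \<and> log_growth \<alpha> u \<longrightarrow>
       has_bochner_integral lebesgue (\<lambda>x. K x * exp (2 * u x)) (- 2 * \<alpha> * pi) \<and>
       (\<exists>c::real. \<forall>\<beta>::real. 0 < \<beta> \<and> ereal \<beta> < alpha 1 K - ereal \<alpha> \<longrightarrow>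
          (\<lambda>x. u x - (\<alpha> * ln (norm x) + c))
            \<in> o[at_infinity](\<lambda>x. norm x powr (- (2 * \<beta>) / (1 + 2 * \<beta>)))))"
proof (intro allI impI)
  fix \<alpha> :: real assume \<alpha>: "0 < \<alpha> \<and> ereal \<alpha> < alpha 1 K"
  have Km: "K \<in> borel_measurable lebesgue" using loc_bdd by (simp add: locally_bounded_def)
  obtain K' where K'm: "K' \<in> borel_measurable lborel" and K': "AE x in lborel. K x = K' x"
    using completion_ex_borel_measurable_real[OF Km] by blast
  \<comment> \<open>The absolute value makes k nonnegative at every point, while K = - k still holds
    almost everywhere because K <= 0.\<close>
  define k where "k x = \<bar>K' x\<bar>" for x
  have km [measurable]: "k \<in> borel_measurable borel" unfolding k_def[abs_def] using K'm by simp
  have k0: "k x \<ge> 0" for x by (simp add: k_def)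
  have Kk: "AE x in lborel. K x = - k x"
    using K'
  proof eventually_elim
    case (elim x)
    thus ?case using nonpos[of x] by (simp add: k_def)
  qed
  have knz: "\<not> (AE x in lborel. k x = 0)"
  proof
    assume "AE x in lborel. k x = 0"
    hence "AE x in lborel. K x = 0" using Kk by eventually_elim simp
    from AE_completion[OF this] show False using nonzero by blast
  qed
  obtain p where p: "p > 1" "alpha p K > -\<infinity>" using alphap by blast
  then obtain b where "alpha p K > ereal b" using ereal_dense2 by blast
  then obtain a where ap: "(\<integral>\<^sup>+ x. ennreal (\<bar>K x\<bar> powr p * (1 + norm x) powr (2 * a * p + 2 * (p - 1))) \<partial>lebesgue) < \<infinity>"
    by (rule alpha_greaterE)
  define q where "q = 2 * a * p + 2 * (p - 1)"
  have ikp: "integrable lborel (\<lambda>x. k x powr p * (1 + norm x) powr q)"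
    unfolding q_def by (rule integrable_Borel_version[OF km Kk k0 ap])
  \<comment> \<open>Every positive g up to min 1 (2 b) is admissible: the supremum supplies a finite
    integral at some a > \<alpha> + b, and then 2 \<alpha> + g <= 2 a.\<close>
  have curv: "curvature k \<alpha> g p q" if g: "0 < g" "g \<le> 1" "g \<le> 2 * b" and b: "ereal (\<alpha> + b) < alpha 1 K" for g b
  proof
    obtain a where a: "a > \<alpha> + b" "(\<integral>\<^sup>+ x. ennreal (\<bar>K x\<bar> powr 1 * (1 + norm x) powr (2 * a * 1 + 2 * (1 - 1))) \<partial>lebesgue) < \<infinity>"
      using b by (rule alpha_greaterE)
    have i: "integrable lborel (\<lambda>x. k x * (1 + norm x) powr (2 * a))"
      using integrable_Borel_version[OF km Kk k0 a(2)] k0 by simp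
    show "integrable lborel (\<lambda>x. k x * (1 + norm x) powr (2 * \<alpha> + g))"
    proof (rule Bochner_Integration.integrable_bound[OF i])
      show "AE x in lborel. norm (k x * (1 + norm x) powr (2 * \<alpha> + g)) \<le> norm (k x * (1 + norm x) powr (2 * a))"
        using a(1) g k0 by (intro AE_I2) (auto simp: abs_mult intro!: mult_left_mono powr_mono)
    qed measurable
  qed (use \<alpha> g p k0 knz ikp in auto)
  have ex_b: "\<exists>b>0. ereal (\<alpha> + b) < alpha 1 K"
  proof -
    obtain r where r: "ereal \<alpha> < ereal r" "ereal r < alpha 1 K" using \<alpha> ereal_dense2 by blast
    thus ?thesis by (intro exI[of _ "r - \<alpha>"]) auto
  qed
  then obtain b where b: "b > 0" "ereal (\<alpha> + b) < alpha 1 K" by blast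
  \<comment> \<open>One fixed b carries existence and uniqueness; the rate of the expansion comes
    from a second interpretation for each \<beta>.\<close>
  interpret C: curvature k \<alpha> "min 1 (2 * b)" p q by (rule curv[OF _ _ _ b(2)]) (use b in auto)
  have sol: "is_solution K u \<longleftrightarrow> C.sol u" for u
  proof (cases "continuous_on UNIV u")
    case True
    hence [measurable]: "u \<in> borel_measurable borel" by (rule borel_measurable_continuous_onI)
    have "(\<integral>x. u x * laplacian \<phi> x \<partial>lebesgue) + (\<integral>x. K x * exp (2 * u x) * \<phi> x \<partial>lebesgue) = 0 \<longleftrightarrow>
        (\<integral>x. u x * laplacian \<phi> x \<partial>lborel) = (\<integral>x. k x * exp (2 * u x) * \<phi> x \<partial>lborel)"
      if phi: "test_function \<phi>" for \<phi>
    proof -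
      have "continuous_on UNIV (laplacian \<phi>)" "continuous_on UNIV \<phi>" using test_functionE[OF phi] by metis+
      hence [measurable]: "laplacian \<phi> \<in> borel_measurable borel" "\<phi> \<in> borel_measurable borel"
        by (auto intro: borel_measurable_continuous_onI)
      have 1: "(\<integral>x. u x * laplacian \<phi> x \<partial>lebesgue) = (\<integral>x. u x * laplacian \<phi> x \<partial>lborel)"
        by (rule integral_completion) measurable
      have 2: "(\<integral>x. K x * (exp (2 * u x) * \<phi> x) \<partial>lebesgue) = - (\<integral>x. k x * (exp (2 * u x) * \<phi> x) \<partial>lborel)"
        by (rule lebesgue_integral_Borel_version(1)[OF km _ Km Kk]) measurable
      show ?thesis using 1 2 by (simp add: mult.assoc)
    qed
    thus ?thesis using True unfolding is_solution_def C.sol_def by auto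
  qed (simp add: is_solution_def C.sol_def)
  have grow: "log_growth \<alpha> u \<longleftrightarrow> C.growth u" for u
    unfolding log_growth_iff C.growth_def ..
  have "\<exists>!u. is_solution K u \<and> log_growth \<alpha> u"
    unfolding sol grow using C.solution_exists C.solution_unique by blast
  moreover have "has_bochner_integral lebesgue (\<lambda>x. K x * exp (2 * u x)) (- 2 * \<alpha> * pi) \<and>
       (\<exists>c::real. \<forall>\<beta>::real. 0 < \<beta> \<and> ereal \<beta> < alpha 1 K - ereal \<alpha> \<longrightarrow>
          (\<lambda>x. u x - (\<alpha> * ln (norm x) + c))
            \<in> o[at_infinity](\<lambda>x. norm x powr (- (2 * \<beta>) / (1 + 2 * \<beta>))))"
    if u: "is_solution K u \<and> log_growth \<alpha> u" for u
  proof
    have u': "C.sol u" "C.growth u" using u sol grow by auto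
    have cu: "continuous_on UNIV u" using u by (simp add: is_solution_def)
    have [measurable]: "u \<in> borel_measurable borel" using cu by (rule borel_measurable_continuous_onI)
    have em: "(\<lambda>x. exp (2 * u x)) \<in> borel_measurable borel" by measurable
    define f where "f = (\<lambda>x. k x * exp (2 * u x))"
    note rep = C.representation[OF u', folded f_def]
    have mass: "(\<integral>x. f x \<partial>lborel) = 2 * pi * \<alpha>" using C.representation(3)[OF u'] by (simp add: f_def)
    have intf: "integrable lborel f" by (rule log_density.int_f[OF rep(1)])
    show "has_bochner_integral lebesgue (\<lambda>x. K x * exp (2 * u x)) (- 2 * \<alpha> * pi)"
      using lebesgue_integral_Borel_version[OF km em Km Kk] intf mass
      by (simp add: has_bochner_integral_iff f_def)
    obtain c where c: "\<And>x. u x = c + log_density.pot f x / (2 * pi)" using rep(4) by blast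
    show "\<exists>c::real. \<forall>\<beta>::real. 0 < \<beta> \<and> ereal \<beta> < alpha 1 K - ereal \<alpha> \<longrightarrow>
          (\<lambda>x. u x - (\<alpha> * ln (norm x) + c))
            \<in> o[at_infinity](\<lambda>x. norm x powr (- (2 * \<beta>) / (1 + 2 * \<beta>)))"
    \<comment> \<open>The constant is fixed before \<beta>: it comes from the first interpretation,
      and the potential of f is the same function whatever exponent g is used.\<close>
    proof (intro exI[of _ c] allI impI)
      fix \<beta> :: real assume \<beta>: "0 < \<beta> \<and> ereal \<beta> < alpha 1 K - ereal \<alpha>"
      have "ereal (\<alpha> + \<beta>) < alpha 1 K" using \<beta> by (cases "alpha 1 K") auto
      then interpret D: curvature k \<alpha> "min 1 (2 * \<beta>)" p q by (rule curv[rotated 3]) (use \<beta> in auto)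
      have u'': "D.sol u" "D.growth u" using u' by (auto simp: C.sol_def D.sol_def C.growth_def D.growth_def)
      interpret F: log_density f "min 1 (2 * \<beta>)" p "q - 2 * \<alpha> * p"
        using D.representation(1)[OF u''] by (simp add: f_def)
      \<comment> \<open>For \<beta> > 0 the quotient is below 1 and below 2 \<beta>, and this strict
        gap lets \<open>pot_smallo\<close> absorb the logarithm.\<close>
      have lt: "2 * \<beta> / (1 + 2 * \<beta>) < min 1 (2 * \<beta>)" using \<beta> by (simp add: field_simps)
      have "(\<lambda>x. (1 / (2 * pi)) * (F.pot x - F.mass * ln (norm x))) \<in> o[at_infinity](\<lambda>x. norm x powr (- (2 * \<beta> / (1 + 2 * \<beta>))))"
        using F.pot_smallo[OF lt] by simp
      moreover have "(\<lambda>x. u x - (\<alpha> * ln (norm x) + c)) = (\<lambda>x. (1 / (2 * pi)) * (F.pot x - F.mass * ln (norm x)))"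
        unfolding c F.mass_def mass by (simp add: fun_eq_iff diff_divide_distrib)
      ultimately show "(\<lambda>x. u x - (\<alpha> * ln (norm x) + c)) \<in> o[at_infinity](\<lambda>x. norm x powr (- (2 * \<beta>) / (1 + 2 * \<beta>)))"
        by (simp only: minus_divide_left)
    qed
  qed
  ultimately show "(\<exists>!u. is_solution K u \<and> log_growth \<alpha> u) \<and>
    (\<forall>u. is_solution K u \<and> log_growth \<alpha> u \<longrightarrow>
       has_bochner_integral lebesgue (\<lambda>x. K x * exp (2 * u x)) (- 2 * \<alpha> * pi) \<and>
       (\<exists>c::real. \<forall>\<beta>::real. 0 < \<beta> \<and> ereal \<beta> < alpha 1 K - ereal \<alpha> \<longrightarrow>
          (\<lambda>x. u x - (\<alpha> * ln (norm x) + c))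
            \<in> o[at_infinity](\<lambda>x. norm x powr (- (2 * \<beta>) / (1 + 2 * \<beta>)))))"
    by blast
qed

end
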